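(* Let $v\in\mathbb{C}$ with $|v|<1$ and let $(L(f,s))_{f\in C_c^\infty(\mathbb{C};\mathbb{R}),\,s\ge0}$ be the centered Gaussian field with covariance $\mathbb{E}[L(f,t)L(g,s)]=\Gamma_v(f,g,|t-s|)$. This field is not Markovian with respect to the time variable. More precisely, denote $\Sigma_{s-}=\sigma(\{L(g,u):0\le u\le s,\ g\in C_c^\infty\})$ and $\Sigma_s=\sigma(\{L(g,s):g\in C_c^\infty\})$. Then for any $0<s<t$ there exists $f\in C_c^\infty(\mathbb{C};\mathbb{R})$ such that $$\mathbb{P}\Big(\mathbb{E}[L(f,t)\mid\Sigma_{s-}]=\mathbb{E}[L(f,t)\mid\Sigma_s]\Big)<1.$$
   Context: For $\tau\ge 0$ and $r=\tau(1-|v|^2)$, $$\Gamma_v(f,g,\tau)=-\frac{1}{\pi^2}\int_{\mathbb{C}^2}\partial_{\bar z}f(z)\partial_wg(w)\,\partial_z\partial_{\bar w}\log\big(\tau(1-|v|^2)+|z-w|^2\big)dz\,dw=\frac1\pi\int_{\mathbb{C}^2}\partial_{\bar z}f(z)\,\partial_wg(w)\,q_r(z-w)\,dz\,dw,$$ where $q_r(z)=\frac{r}{\pi(r+|z|^2)^2}$ for $r>0$ and $q_0=\delta_0$; $dz,dw$ are Lebesgue measure on $\mathbb{C}$. This is a positive semi-definite covariance in $(f,s)$, and the field $L$ is the scaling limit of mesoscopic centered linear statistics of eigenvalues under the non-Hermitian matrix Ornstein–Uhlenbeck flow. *)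

theory Defs
  imports "HOL-Probability.Probability"
begin

section \<open>Smooth compactly supported functions and Wirtinger derivatives\<close>

fun C_k_on_UNIV :: "nat \<Rightarrow> ('a::real_normed_vector \<Rightarrow> 'b::real_normed_vector) \<Rightarrow> bool" where
  "C_k_on_UNIV 0 f \<longleftrightarrow> continuous_on UNIV f"
| "C_k_on_UNIV (Suc k) f \<longleftrightarrow>
     (\<forall>x. f differentiable (at x)) \<and>
     (\<forall>v. C_k_on_UNIV k (\<lambda>x. frechet_derivative f (at x) v))"

definition Cc_infty :: "(complex \<Rightarrow> real) set" where
  "Cc_infty = {f. (\<forall>k. C_k_on_UNIV k f) \<and> compact (closure {z. f z \<noteq> 0})}"

text \<open>The derivatives are real Frechet derivatives: the directions \<open>1\<close> and \<open>\<i>\<close> give the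
  partial derivatives in \<open>x\<close> and \<open>y\<close>, where \<open>z = x + \<i> y\<close>.\<close>

definition wirtinger_dz :: "(complex \<Rightarrow> complex) \<Rightarrow> complex \<Rightarrow> complex" where
  "wirtinger_dz h z =
     (frechet_derivative h (at z) 1 - \<i> * frechet_derivative h (at z) \<i>) / 2"

definition wirtinger_dzbar :: "(complex \<Rightarrow> complex) \<Rightarrow> complex \<Rightarrow> complex" where
  "wirtinger_dzbar h z =
     (frechet_derivative h (at z) 1 + \<i> * frechet_derivative h (at z) \<i>) / 2"

section \<open>The covariance\<close>

definition q_kernel :: "real \<Rightarrow> complex \<Rightarrow> real" where
  "q_kernel r z = r / (pi * (r + (cmod z)\<^sup>2)\<^sup>2)"

text \<open>The first case is the convention \<open>q\<^sub>0 = \<delta>\<^sub>0\<close>: the double integral collapses to the diagonal.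
  The value is a complex number by definition; it is in fact real for real test functions.\<close>

definition Gamma_cov ::
  "complex \<Rightarrow> (complex \<Rightarrow> real) \<Rightarrow> (complex \<Rightarrow> real) \<Rightarrow> real \<Rightarrow> complex" where
  "Gamma_cov v f g \<tau> =
     (let r = \<tau> * (1 - (cmod v)\<^sup>2);
          F = wirtinger_dzbar (\<lambda>z. complex_of_real (f z));
          G = wirtinger_dz (\<lambda>w. complex_of_real (g w))
      in if r = 0
         then 1 / complex_of_real pi * (\<integral>z. F z * G z \<partial>lborel)
         else 1 / complex_of_real pi *
              (\<integral>(z, w). F z * G w * complex_of_real (q_kernel r (z - w)) \<partial>(lborel \<Otimes>\<^sub>M lborel)))"

text \<open>For \<open>r > 0\<close> the kernel is the mixed logarithmic derivative, so \<open>Gamma_cov\<close> is also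
  \<open>-1/\<pi>\<^sup>2 \<integral>\<integral> (wirtinger_dzbar f)(z) (wirtinger_dz g)(w) K(z, w) dz dw\<close>, where \<open>K\<close> is the
  left-hand side below.\<close>

lemma log_kernel_eq_q_kernel:
  assumes r: "r > 0"
  shows "wirtinger_dz (\<lambda>z. wirtinger_dzbar (\<lambda>w. complex_of_real (ln (r + (cmod (z - w))\<^sup>2))) w) z
         = - complex_of_real (pi * q_kernel r (z - w))"
proof -
  have pos: "r + (x \<bullet> x) > 0" for x :: complex
    using r by (simp add: add_pos_nonneg)
  have nz: "complex_of_real (r + (x \<bullet> x)) \<noteq> 0" for x :: complex
    using pos[of x] by (simp only: of_real_eq_0_iff)
  have d1: "((\<lambda>w. complex_of_real (ln (r + (z - w) \<bullet> (z - w)))) has_derivative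
        (\<lambda>d. complex_of_real (- 2 * ((z - w) \<bullet> d) / (r + (z - w) \<bullet> (z - w))))) (at w)" for z w :: complex
    using pos[of "z - w"]
    by (auto intro!: derivative_eq_intros simp: inner_commute field_simps)
  have e1: "wirtinger_dzbar (\<lambda>w. complex_of_real (ln (r + (cmod (z - w))\<^sup>2))) w
      = - (z - w) / complex_of_real (r + (z - w) \<bullet> (z - w))" for z
  proof -
    define D where "D = r + (z - w) \<bullet> (z - w)"
    have D: "D \<noteq> 0" using pos[of "z - w"] by (simp add: D_def)
    show ?thesis
      unfolding wirtinger_dzbar_def power2_norm_eq_inner frechet_derivative_at[OF d1, symmetric]
        D_def[symmetric]
      using D by (simp add: complex_eq_iff inner_complex_def field_simps)
  qed
  have d2: "((\<lambda>z. - (z - w) / complex_of_real (r + (z - w) \<bullet> (z - w))) has_derivative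
     (\<lambda>d. - d / complex_of_real (r + (z - w) \<bullet> (z - w)) +
        (z - w) * complex_of_real (2 * ((z - w) \<bullet> d)) / (complex_of_real (r + (z - w) \<bullet> (z - w)))\<^sup>2)) (at z)"
  proof -
    define D where "D = complex_of_real (r + (z - w) \<bullet> (z - w))"
    have D: "D \<noteq> 0" using nz[of "z - w"] by (simp add: D_def)
    have n: "((\<lambda>z. - (z - w)) has_derivative (\<lambda>d. - d)) (at z)"
      by (auto intro!: derivative_eq_intros)
    have m: "((\<lambda>z. complex_of_real (r + (z - w) \<bullet> (z - w))) has_derivative
        (\<lambda>d. complex_of_real (2 * ((z - w) \<bullet> d)))) (at z)"
      by (auto intro!: derivative_eq_intros simp: inner_commute)
    show ?thesis
      unfolding D_def[symmetric]
      by (rule has_derivative_eq_rhs[OF has_derivative_divide'[OF n m nz]], fold D_def)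
        (use D in \<open>simp add: fun_eq_iff field_simps power2_eq_square\<close>)
  qed
  define D where "D = r + (z - w) \<bullet> (z - w)"
  have D: "D \<noteq> 0" using pos[of "z - w"] by (simp add: D_def)
  have "wirtinger_dz (\<lambda>z. - (z - w) / complex_of_real (r + (z - w) \<bullet> (z - w))) z =
      - 1 / complex_of_real D + (z - w) * cnj (z - w) / (complex_of_real D)\<^sup>2"
    unfolding wirtinger_dz_def frechet_derivative_at[OF d2, symmetric] D_def[symmetric]
    using D by (simp add: complex_eq_iff inner_complex_def field_simps power2_eq_square)
  also have "(z - w) * cnj (z - w) = complex_of_real (D - r)"
    by (simp add: D_def complex_norm_square[symmetric] power2_norm_eq_inner[symmetric] del: complex_cnj_diff)
  also have "- 1 / complex_of_real D + complex_of_real (D - r) / (complex_of_real D)\<^sup>2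
      = - complex_of_real (pi * q_kernel r (z - w))"
  proof -
    have "pi * q_kernel r (z - w) = r / D\<^sup>2"
      by (simp add: q_kernel_def D_def power2_norm_eq_inner)
    then show ?thesis using D by (simp only: ) (simp add: field_simps power2_eq_square)
  qed
  finally show ?thesis unfolding e1 .
qed

section \<open>Gaussian fields\<close>

text \<open>Degenerate (almost surely constant) laws count as Gaussian.\<close>

definition gaussian_rv :: "'w measure \<Rightarrow> ('w \<Rightarrow> real) \<Rightarrow> bool" where
  "gaussian_rv M X \<longleftrightarrow> X \<in> borel_measurable M \<and>
     ((\<exists>\<mu> \<sigma>. \<sigma> > 0 \<and> distributed M lborel X (normal_density \<mu> \<sigma>)) \<or>
      (\<exists>\<mu>. AE \<omega> in M. X \<omega> = \<mu>))"

definition centered_gaussian_family :: "'w measure \<Rightarrow> 'i set \<Rightarrow> ('i \<Rightarrow> 'w \<Rightarrow> real) \<Rightarrow> bool" where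
  "centered_gaussian_family M I X \<longleftrightarrow> prob_space M \<and>
     (\<forall>J a. finite J \<and> J \<subseteq> I \<longrightarrow> gaussian_rv M (\<lambda>\<omega>. \<Sum>j\<in>J. a j * X j \<omega>)) \<and>
     (\<forall>i\<in>I. integral\<^sup>L M (X i) = 0)"

section \<open>The time filtration and the Markov property\<close>

text \<open>\<open>field_sigma M L {0..s}\<close> is the past \<open>\<Sigma>\<^sub>s\<^sub>-\<close> (the present time \<open>s\<close> included) and
  \<open>field_sigma M L {s}\<close> is the present \<open>\<Sigma>\<^sub>s\<close>.\<close>

definition field_sigma ::
  "'w measure \<Rightarrow> ((complex \<Rightarrow> real) \<Rightarrow> real \<Rightarrow> 'w \<Rightarrow> real) \<Rightarrow> real set \<Rightarrow> 'w measure" where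
  "field_sigma M L T =
     sigma (space M) {L g u -` B \<inter> space M | g u B. g \<in> Cc_infty \<and> u \<in> T \<and> B \<in> sets borel}"

definition markovian_in_time ::
  "'w measure \<Rightarrow> ((complex \<Rightarrow> real) \<Rightarrow> real \<Rightarrow> 'w \<Rightarrow> real) \<Rightarrow> bool" where
  "markovian_in_time M L \<longleftrightarrow>
     (\<forall>s t Y. 0 \<le> s \<and> s \<le> t \<and> Y \<in> borel_measurable (field_sigma M L {t}) \<and>
        (\<exists>B. \<forall>\<omega>\<in>space M. \<bar>Y \<omega>\<bar> \<le> B) \<longrightarrow>
        (AE \<omega> in M. real_cond_exp M (field_sigma M L {0..s}) Y \<omega> =
                     real_cond_exp M (field_sigma M L {s}) Y \<omega>))"

end

theory Submission
  imports Defs "HOL-Real_Asymp.Real_Asymp"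
begin

text \<open>
  Put \<open>\<kappa> = 1 - |v|\<^sup>2\<close>. At lag \<open>\<tau>\<close> the spatial covariance is obtained from the one at lag \<open>0\<close> by
  convolution with \<open>q\<^sub>r\<close>, \<open>r = \<kappa>\<tau>\<close>. A Gaussian field with such a covariance can only be Markovian in
  time if these convolutions form a semigroup, \<open>q\<^sub>a * q\<^sub>b = q\<^bsub>a+b\<^esub>\<close>, and they do not: the Fourier
  transform of \<open>q\<^sub>r\<close> is \<open>\<surd>r |\<xi>| K\<^sub>1(\<surd>r |\<xi>|)\<close>, which is no exponential in \<open>r\<close>. The proof carries
  out both halves without Fourier analysis in the plane.

  \<^emph>\<open>The Markov step forces the semigroup law\<close> (lemma \<open>markov_step_forces_semigroup\<close>). For centered
  Gaussian variables, \<open>E[L(f,t) | \<Sigma>\<^sub>s]\<close> is the orthogonal projection of \<open>L(f,t)\<close> on the closed span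
  of the variables \<open>L(h,s)\<close>, hence the \<open>L\<^sup>2\<close> limit of finite linear combinations \<open>H\<^sub>n\<close> of them (lemma
  \<open>conditional_expectation_approximation\<close>). That an orthogonal residual \<open>Z\<close> has conditional
  expectation \<open>0\<close> follows from Gaussian integration by parts, which gives \<open>E[Z exp(iW)] = 0\<close> for
  \<open>W\<close> in the span, and from the uniqueness of characteristic functions, applied one coordinate at a
  time. If \<open>E[L(f,t) | \<Sigma>\<^sub>s]\<close> also is the conditional expectation given the past, then
  \<open>E[L(f,t) L(g,u)] = lim E[H\<^sub>n L(g,u)]\<close> for every \<open>u \<le> s\<close>. Now \<open>\<Gamma>(h,g,\<tau>)\<close> is the average of
  \<open>\<Gamma>(h,T\<^sub>yg,0)\<close> over translations \<open>T\<^sub>y\<close> with weight \<open>q\<^bsub>\<kappa>\<tau>\<^esub>(y)\<close> (lemma \<open>Gamma_cov_average\<close>), so that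
  \<open>E[H\<^sub>n L(g,u)]\<close> is an average over \<open>y\<close> of the correlations \<open>E[H\<^sub>n L(T\<^sub>yg,s)]\<close>. These converge to
  \<open>\<Gamma>(f,T\<^sub>yg,t-s)\<close> and are bounded uniformly in \<open>y\<close>, because the variance of \<open>L(T\<^sub>yg,s)\<close> does not depend
  on \<open>y\<close>. Passing to the limit under the integral, with \<open>a = \<kappa>(t-s)\<close> and \<open>b = \<kappa>(s-u)\<close>,
  \<open>\<Gamma>(f,g,(a+b)/\<kappa>) = \<integral> q\<^sub>b(y) \<Gamma>(f,T\<^sub>yg,a/\<kappa>) dy\<close>. Averaging over translations replaces the
  approximation of \<open>q\<^sub>b * g\<close>, which does not have compact support, by test functions.

  \<^emph>\<open>The semigroup law fails\<close> (lemma \<open>log_energy_not_semigroup\<close>). Let \<open>b \<rightarrow> 0\<close>. The left-hand side is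
  smooth in \<open>b\<close> and changes by \<open>O(b)\<close>. On the right, \<open>q\<^sub>b\<close> has tails \<open>b/(\<pi>|y|\<^sup>4)\<close> and therefore a
  logarithmically divergent second moment: against a function \<open>\<psi>\<close> that is strictly concave at \<open>0\<close>
  the average loses an amount of order \<open>b log(1/b)\<close> from \<open>\<psi>(0)\<close> (lemma \<open>q_kernel_average_log_defect\<close>).
  To see the concavity of \<open>\<psi>(y) = \<Gamma>(f,T\<^sub>yf,a/\<kappa>)\<close> for a bump function \<open>f\<close> of small support, two
  integrations by parts move the derivatives from the test functions to the kernel (lemma
  \<open>Gamma_cov_eq_log_kernel\<close>); the resulting kernel is an explicit rational function of \<open>|z|\<^sup>2\<close> whose
  second differences near the origin are negative.

  The failure of the Markov property for bounded functions of the field reduces to the failure for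
  \<open>L(f,t)\<close> itself by truncation (lemma \<open>conditional_expectation_eq_of_truncations\<close>).
\<close>

section \<open>Radial integrals and the kernel \<open>q\<^sub>b\<close>\<close>

text \<open>Polar coordinates in the variable \<open>\<rho> = |z|\<^sup>2\<close>, in which the area of a disc is linear: the
  push-forward of Lebesgue measure is \<open>\<pi> d\<rho>\<close>. Both sides agree on the half-lines, which generate.\<close>

lemma distr_norm_square_lborel:
  "distr lborel borel (\<lambda>z::complex. (cmod z)\<^sup>2) = density lborel (\<lambda>\<rho>. ennreal pi * indicator {0..} \<rho>)"
proof -
  have cyl: "emeasure lborel {z::complex. (cmod z)\<^sup>2 \<le> x} = ennreal (pi * x)" if "x \<ge> 0" for x
  proof -
    have "{z::complex. (cmod z)\<^sup>2 \<le> x} = cball 0 (sqrt x)"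
    proof (intro set_eqI)
      fix z :: complex
      have "(cmod z)\<^sup>2 \<le> x \<longleftrightarrow> cmod z \<le> sqrt x"
        using that real_sqrt_le_iff[of "(cmod z)\<^sup>2" x] by simp
      then show "z \<in> {z. (cmod z)\<^sup>2 \<le> x} \<longleftrightarrow> z \<in> cball 0 (sqrt x)"
        by simp
    qed
    then show ?thesis
      using that by (simp add: emeasure_cball unit_ball_vol_2)
  qed
  show ?thesis
  proof (rule measure_eqI_generator_eq[where E="range atMost" and \<Omega>=UNIV and A="\<lambda>n::nat. {..real n}"])
    show "Int_stable (range (atMost :: real \<Rightarrow> _))"
      by (auto simp: Int_stable_def)
    show "range atMost \<subseteq> Pow (UNIV :: real set)" by simp
    show "sets (distr lborel borel (\<lambda>z::complex. (cmod z)\<^sup>2)) = sigma_sets UNIV (range atMost)"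
      by (simp add: borel_eq_atMost)
    show "sets (density lborel (\<lambda>\<rho>. ennreal pi * indicator {0..} \<rho>)) = sigma_sets UNIV (range (atMost :: real \<Rightarrow> _))"
      by (simp add: borel_eq_atMost)
    show "range (\<lambda>n::nat. {..real n}) \<subseteq> range atMost" by auto
    show "(\<Union>n::nat. {..real n}) = UNIV"
      by (auto simp: real_arch_simple)
    show "emeasure (distr lborel borel (\<lambda>z::complex. (cmod z)\<^sup>2)) {..real n} \<noteq> \<infinity>" for n :: nat
      using cyl[of "real n"] by (simp add: emeasure_distr vimage_def)
    fix X :: "real set" assume "X \<in> range atMost"
    then obtain x where X: "X = {..x}" by auto
    have L: "emeasure (distr lborel borel (\<lambda>z::complex. (cmod z)\<^sup>2)) X = emeasure lborel {z::complex. (cmod z)\<^sup>2 \<le> x}"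
      unfolding X by (simp add: emeasure_distr vimage_def)
    have "emeasure (density lborel (\<lambda>\<rho>. ennreal pi * indicator {0..} \<rho>)) X
        = (\<integral>\<^sup>+\<rho>. ennreal pi * indicator {0..x} \<rho> \<partial>lborel)"
      unfolding X by (subst emeasure_density) (auto intro!: nn_integral_cong simp: indicator_def)
    also have "\<dots> = ennreal pi * emeasure lborel {0..x}"
      by (subst nn_integral_cmult_indicator) auto
    finally have R: "emeasure (density lborel (\<lambda>\<rho>. ennreal pi * indicator {0..} \<rho>)) X
       = ennreal pi * emeasure lborel {0..x}" .
    show "emeasure (distr lborel borel (\<lambda>z::complex. (cmod z)\<^sup>2)) X =
      emeasure (density lborel (\<lambda>\<rho>. ennreal pi * indicator {0..} \<rho>)) X"
    proof (cases "x \<ge> 0")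
      case True then show ?thesis unfolding L R using cyl[OF True] by (simp add: ennreal_mult)
    next
      case False
      then have "{z::complex. (cmod z)\<^sup>2 \<le> x} = {}"
        by (auto simp: not_le intro: less_le_trans[OF _ zero_le_power2])
      then show ?thesis unfolding L R using False by simp
    qed
  qed
qed

lemma nn_integral_radial:
  assumes [measurable]: "h \<in> borel_measurable (borel :: real measure)"
  shows "(\<integral>\<^sup>+z. h ((cmod z)\<^sup>2) \<partial>lborel) = ennreal pi * (\<integral>\<^sup>+\<rho>. h \<rho> * indicator {0..} \<rho> \<partial>lborel)"
proof -
  have "(\<integral>\<^sup>+z. h ((cmod z)\<^sup>2) \<partial>lborel) = (\<integral>\<^sup>+\<rho>. h \<rho> \<partial>distr lborel borel (\<lambda>z::complex. (cmod z)\<^sup>2))"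
    by (subst nn_integral_distr) auto
  also have "\<dots> = (\<integral>\<^sup>+\<rho>. ennreal pi * (h \<rho> * indicator {0..} \<rho>) \<partial>lborel)"
    unfolding distr_norm_square_lborel
    by (subst nn_integral_density) (auto simp: mult_ac)
  also have "\<dots> = ennreal pi * (\<integral>\<^sup>+\<rho>. h \<rho> * indicator {0..} \<rho> \<partial>lborel)"
    by (subst nn_integral_cmult) auto
  finally show ?thesis .
qed

lemma q_kernel_nonneg: "0 \<le> r \<Longrightarrow> 0 \<le> q_kernel r z"
  by (simp add: q_kernel_def)

lemma q_kernel_measurable [measurable]: "q_kernel r \<in> borel_measurable borel"
  unfolding q_kernel_def by measurable

text \<open>The primitive of \<open>b/(\<pi>(b + \<rho>)\<^sup>2)\<close> is elementary. The case \<open>e = 0\<close> shows that \<open>q\<^sub>b\<close> is a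
  probability density.\<close>

lemma nn_integral_q_kernel_tail:
  assumes b: "0 < b" and e: "0 \<le> e"
  shows "(\<integral>\<^sup>+y. ennreal (q_kernel b y) * indicator {y. e \<le> (cmod y)\<^sup>2} y \<partial>lborel) = ennreal (b / (b + e))"
proof -
  let ?h = "\<lambda>\<rho>::real. ennreal (b / (pi * (b + \<rho>)\<^sup>2)) * indicator {e..} \<rho>"
  have "(\<integral>\<^sup>+y. ennreal (q_kernel b y) * indicator {y. e \<le> (cmod y)\<^sup>2} y \<partial>lborel) = (\<integral>\<^sup>+z. ?h ((cmod z)\<^sup>2) \<partial>lborel)"
    by (intro nn_integral_cong) (simp add: q_kernel_def indicator_def)
  also have "\<dots> = ennreal pi * (\<integral>\<^sup>+\<rho>. ?h \<rho> * indicator {0..} \<rho> \<partial>lborel)"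
    by (rule nn_integral_radial) measurable
  also have "(\<integral>\<^sup>+\<rho>. ?h \<rho> * indicator {0..} \<rho> \<partial>lborel) = (\<integral>\<^sup>+\<rho>. ?h \<rho> \<partial>lborel)"
    using e by (intro nn_integral_cong) (auto simp: indicator_def)
  also have "\<dots> = ennreal (0 - (- (b / (pi * (b + e)))))"
  proof (rule nn_integral_FTC_atLeast)
    show "((\<lambda>\<rho>. - (b / (pi * (b + \<rho>)))) has_real_derivative b / (pi * (b + x)\<^sup>2)) (at x)" if "e \<le> x" for x
    proof -
      have "b + x > 0" using that b e by simp
      then show ?thesis
        by (auto intro!: derivative_eq_intros simp: power2_eq_square)
    qed
    show "((\<lambda>\<rho>. - (b / (pi * (b + \<rho>)))) \<longlongrightarrow> 0) at_top"
      using b by real_asymp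
  qed (use b in auto)
  also have "ennreal pi * \<dots> = ennreal (b / (b + e))"
    by (subst ennreal_mult[symmetric]) (use b e in auto)
  finally show ?thesis .
qed

lemma nn_integral_q_kernel: "0 < b \<Longrightarrow> (\<integral>\<^sup>+y. ennreal (q_kernel b y) \<partial>lborel) = 1"
  using nn_integral_q_kernel_tail[of b 0] by simp

lemma has_bochner_integral_q_kernel:
  assumes "0 < b" shows "has_bochner_integral lborel (q_kernel b) 1"
  using nn_integral_q_kernel[OF assms] assms
  by (intro has_bochner_integral_nn_integral) (auto intro!: AE_I2 q_kernel_nonneg)

text \<open>The truncated second moment of \<open>q\<^sub>b\<close> is of order \<open>b log(1/b)\<close>. This logarithm is the reason for
  the failure of the semigroup law.\<close>

lemma nn_integral_q_kernel_square:
  assumes b: "0 < b" and e: "0 \<le> e"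
  shows "(\<integral>\<^sup>+y. ennreal (q_kernel b y * (cmod y)\<^sup>2) * indicator {y. (cmod y)\<^sup>2 \<le> e} y \<partial>lborel)
     = ennreal (b * (ln (1 + e / b) + b / (b + e) - 1))"
proof -
  let ?h = "\<lambda>\<rho>::real. ennreal (b / (pi * (b + \<rho>)\<^sup>2) * \<rho>) * indicator {..e} \<rho>"
  let ?F = "\<lambda>\<rho>. b / pi * (ln (b + \<rho>) + b / (b + \<rho>))"
  have "(\<integral>\<^sup>+y. ennreal (q_kernel b y * (cmod y)\<^sup>2) * indicator {y. (cmod y)\<^sup>2 \<le> e} y \<partial>lborel) = (\<integral>\<^sup>+z. ?h ((cmod z)\<^sup>2) \<partial>lborel)"
    by (intro nn_integral_cong) (simp add: q_kernel_def indicator_def)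
  also have "\<dots> = ennreal pi * (\<integral>\<^sup>+\<rho>. ?h \<rho> * indicator {0..} \<rho> \<partial>lborel)"
    by (rule nn_integral_radial) measurable
  also have "(\<integral>\<^sup>+\<rho>. ?h \<rho> * indicator {0..} \<rho> \<partial>lborel) = (\<integral>\<^sup>+\<rho>. ennreal (b / (pi * (b + \<rho>)\<^sup>2) * \<rho>) * indicator {0..e} \<rho> \<partial>lborel)"
    using e by (intro nn_integral_cong) (auto simp: indicator_def)
  also have "\<dots> = ennreal (?F e - ?F 0)"
  proof (rule nn_integral_FTC_Icc)
    show "(?F has_real_derivative b / (pi * (b + x)\<^sup>2) * x) (at x)" if "x \<in> {0..e}" for x
    proof -
      have "b + x > 0" using that b by simp
      then have "(?F has_real_derivative b / pi * (1 / (b + x) - b / (b + x)\<^sup>2)) (at x)"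
        by (auto intro!: derivative_eq_intros simp: power2_eq_square)
      moreover have "1 / (b + x) - b / (b + x)\<^sup>2 = x / (b + x)\<^sup>2"
        using \<open>b + x > 0\<close> by (simp add: power2_eq_square divide_simps)
      ultimately show ?thesis by simp
    qed
  qed (use b e in auto)
  also have "ennreal pi * \<dots> = ennreal (pi * (?F e - ?F 0))"
    by (rule ennreal_mult'[symmetric]) simp
  also have "pi * (?F e - ?F 0) = b * (ln (1 + e / b) + b / (b + e) - 1)"
  proof -
    have "1 + e / b = (b + e) / b" using b by (simp add: field_simps)
    then have "ln (1 + e / b) = ln (b + e) - ln b" using b e by (simp add: ln_div)
    moreover have "pi * (b / pi * X - b / pi * Y) = b * (X - Y)" for X Y :: real
      by (simp add: field_simps)
    ultimately show ?thesis using b by simp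
  qed
  finally show ?thesis .
qed


lemma lborel_distr_reflect:
  fixes c :: "'a::euclidean_space"
  shows "distr lborel borel (\<lambda>x. c - x) = lborel"
  by (subst lborel_affine[of "-1" c]) (auto simp: density_1)

lemma has_bochner_integral_lborel_reflect:
  fixes f :: "'a::euclidean_space \<Rightarrow> 'b::{banach, second_countable_topology}"
  assumes "has_bochner_integral lborel f I"
  shows "has_bochner_integral lborel (\<lambda>x. f (c - x)) I"
proof -
  have [measurable]: "f \<in> borel_measurable borel"
    using assms borel_measurable_integrable[of lborel f] by (simp add: has_bochner_integral_iff)
  have "has_bochner_integral (distr lborel borel (\<lambda>x. c - x)) f I"
    using assms unfolding lborel_distr_reflect .
  then show ?thesis
    by (simp add: has_bochner_integral_iff integrable_distr_eq integral_distr)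
qed

lemma has_bochner_integral_lborel_translate:
  fixes f :: "'a::euclidean_space \<Rightarrow> 'b::{banach, second_countable_topology}"
  assumes "has_bochner_integral lborel f I"
  shows "has_bochner_integral lborel (\<lambda>x. f (x + c)) I"
  using has_bochner_integral_lborel_reflect[OF has_bochner_integral_lborel_reflect[OF assms, of c], of 0]
  by (simp add: add.commute)

lemma has_bochner_integral_q_kernel_tail:
  assumes "0 < b" "0 \<le> e"
  shows "has_bochner_integral lborel (\<lambda>y. q_kernel b y * indicator {y. e \<le> (cmod y)\<^sup>2} y) (b / (b + e))"
proof (rule has_bochner_integral_nn_integral)
  show "(\<integral>\<^sup>+y. ennreal (q_kernel b y * indicator {y. e \<le> (cmod y)\<^sup>2} y) \<partial>lborel) = ennreal (b / (b + e))"
    unfolding nn_integral_q_kernel_tail[OF assms, symmetric]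
    by (intro nn_integral_cong) (auto simp: indicator_def)
qed (use assms in \<open>auto intro!: AE_I2 mult_nonneg_nonneg q_kernel_nonneg\<close>)

lemma has_bochner_integral_q_kernel_square:
  assumes "0 < b" "0 \<le> e"
  shows "has_bochner_integral lborel (\<lambda>y. q_kernel b y * (cmod y)\<^sup>2 * indicator {y. (cmod y)\<^sup>2 \<le> e} y)
    (b * (ln (1 + e / b) + b / (b + e) - 1))"
proof (rule has_bochner_integral_nn_integral)
  show "(\<integral>\<^sup>+y. ennreal (q_kernel b y * (cmod y)\<^sup>2 * indicator {y. (cmod y)\<^sup>2 \<le> e} y) \<partial>lborel)
     = ennreal (b * (ln (1 + e / b) + b / (b + e) - 1))"
    unfolding nn_integral_q_kernel_square[OF assms, symmetric]
    by (intro nn_integral_cong) (auto simp: indicator_def)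
  have "ln (inverse (1 + e / b)) \<le> inverse (1 + e / b) - 1"
    using assms by (intro ln_le_minus_one) (auto simp: add_pos_nonneg)
  also have "ln (inverse (1 + e / b)) = - ln (1 + e / b)"
    by (simp add: ln_inverse)
  also have "inverse (1 + e / b) = b / (b + e)"
    using assms by (simp add: field_simps)
  finally have "0 \<le> ln (1 + e / b) + b / (b + e) - 1"
    by simp
  then show "0 \<le> b * (ln (1 + e / b) + b / (b + e) - 1)"
    using assms by simp
qed (use assms in \<open>auto intro!: AE_I2 mult_nonneg_nonneg q_kernel_nonneg\<close>)

lemma q_kernel_minus [simp]: "q_kernel b (- y) = q_kernel b y"
  by (simp add: q_kernel_def)

lemma integrable_q_kernel_mult:
  fixes \<psi> :: "complex \<Rightarrow> 'b::{banach, second_countable_topology, real_normed_algebra}"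
  assumes b: "0 < b" and [measurable]: "\<psi> \<in> borel_measurable borel" and bd: "\<And>y. norm (\<psi> y) \<le> B"
  shows "integrable lborel (\<lambda>y. q_kernel b y *\<^sub>R \<psi> y)"
proof (rule Bochner_Integration.integrable_bound)
  show "integrable lborel (\<lambda>y. q_kernel b y * B)"
    using has_bochner_integral_q_kernel[OF b] by (simp add: has_bochner_integral_iff)
  show "AE y in lborel. norm (q_kernel b y *\<^sub>R \<psi> y) \<le> norm (q_kernel b y * B)"
    using b bd order_trans[OF bd abs_ge_self] by (intro AE_I2) (auto simp: abs_mult intro!: mult_left_mono)
qed measurable

text \<open>The average of \<open>\<psi>\<close> over \<open>q\<^sub>b\<close> is compared with \<open>\<psi>(0)\<close> after symmetrising in \<open>y\<close>. Near \<open>0\<close> the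
  concavity contributes at most \<open>-m/2\<close> times the truncated second moment, which beats every multiple
  of \<open>b\<close>; away from \<open>0\<close> the mass of \<open>q\<^sub>b\<close>, hence the contribution of the bounded function, is \<open>O(b)\<close>.\<close>

lemma q_kernel_average_log_defect:
  fixes \<psi> :: "complex \<Rightarrow> real"
  assumes meas [measurable]: "\<psi> \<in> borel_measurable borel" and bound: "\<And>y. \<bar>\<psi> y\<bar> \<le> B"
    and m: "0 < m" and e: "0 < e"
    and concave: "\<And>y. (cmod y)\<^sup>2 \<le> e \<Longrightarrow> \<psi> y + \<psi> (- y) - 2 * \<psi> 0 \<le> - m * (cmod y)\<^sup>2"
  shows "\<exists>b0>0. \<forall>b. 0 < b \<and> b < b0 \<longrightarrow> (\<integral>y. q_kernel b y * \<psi> y \<partial>lborel) \<le> \<psi> 0 - N * b"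
proof -
  define R where "R = (2 * N + m + 4 * B / e) / m"
  have B: "0 \<le> B" using bound[of 0] by linarith
  \<comment> \<open>The number \<open>R\<close> is the size of \<open>ln (e/b)\<close> at which the concave part outweighs the tail and \<open>2Nb\<close>.\<close>
  have "(\<integral>y. q_kernel b y * \<psi> y \<partial>lborel) \<le> \<psi> 0 - N * b" if b: "0 < b" "b < e * exp (- R)" for b
  proof -
    let ?I = "\<integral>y. q_kernel b y * \<psi> y \<partial>lborel"
    let ?l = "ln (1 + e / b) + b / (b + e) - 1"
    have int: "has_bochner_integral lborel (\<lambda>y. q_kernel b y * \<psi> y) ?I"
      using integrable_q_kernel_mult[OF b(1) meas, of B] bound by (simp add: has_bochner_integral_iff)
    have int': "has_bochner_integral lborel (\<lambda>y. q_kernel b y * \<psi> (- y)) ?I"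
      using has_bochner_integral_lborel_reflect[OF int, of 0] by simp
    have lhs: "has_bochner_integral lborel
        (\<lambda>y. q_kernel b y * \<psi> y + q_kernel b y * \<psi> (- y) - q_kernel b y * (2 * \<psi> 0)) (?I + ?I - 1 * (2 * \<psi> 0))"
      by (intro has_bochner_integral_add has_bochner_integral_diff has_bochner_integral_mult_left
          int int' has_bochner_integral_q_kernel b)
    have rhs: "has_bochner_integral lborel
        (\<lambda>y. q_kernel b y * indicator {y. e \<le> (cmod y)\<^sup>2} y * (4 * B)
          - q_kernel b y * (cmod y)\<^sup>2 * indicator {y. (cmod y)\<^sup>2 \<le> e} y * m)
        (b / (b + e) * (4 * B) - b * ?l * m)"
      using b(1) e by (intro has_bochner_integral_diff has_bochner_integral_mult_left
          has_bochner_integral_q_kernel_tail has_bochner_integral_q_kernel_square) auto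
    have "?I + ?I - 1 * (2 * \<psi> 0) \<le> b / (b + e) * (4 * B) - b * ?l * m"
    proof (rule integral_mono[of lborel, OF lhs[THEN integrable.intros] rhs[THEN integrable.intros],
          unfolded lhs[THEN has_bochner_integral_integral_eq] rhs[THEN has_bochner_integral_integral_eq]])
      fix y
      let ?t = "indicator {y. e \<le> (cmod y)\<^sup>2} y * (4 * B) - (cmod y)\<^sup>2 * indicator {y. (cmod y)\<^sup>2 \<le> e} y * m"
      have "\<psi> y + \<psi> (- y) - 2 * \<psi> 0 \<le> ?t"
      proof (cases "(cmod y)\<^sup>2 \<le> e")
        case True
        have "- m * (cmod y)\<^sup>2 \<le> ?t"
          using True B by (simp add: indicator_def)
        with concave[OF True] show ?thesis by linarith
      next
        case False
        then show ?thesis using bound[of y] bound[of "- y"] bound[of 0] by (simp add: indicator_def)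
      qed
      from mult_left_mono[OF this q_kernel_nonneg[of b y]] b(1)
      show "q_kernel b y * \<psi> y + q_kernel b y * \<psi> (- y) - q_kernel b y * (2 * \<psi> 0)
        \<le> q_kernel b y * indicator {y. e \<le> (cmod y)\<^sup>2} y * (4 * B)
          - q_kernel b y * (cmod y)\<^sup>2 * indicator {y. (cmod y)\<^sup>2 \<le> e} y * m"
        by (simp add: algebra_simps)
    qed
    also have "\<dots> \<le> b / e * (4 * B) - b * (R - 1) * m"
    proof -
      have "exp R \<le> e / b" using b by (simp add: exp_minus field_simps)
      then have "R \<le> ln (1 + e / b)"
        using b(1) e by (subst ln_ge_iff) (auto simp: add_pos_pos)
      moreover have "0 \<le> b / (b + e)" using b(1) e by simp
      ultimately have "R - 1 \<le> ?l" by linarith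
      then have "b * (R - 1) * m \<le> b * ?l * m"
        using b(1) m by (intro mult_right_mono mult_left_mono) auto
      moreover have "b / (b + e) * (4 * B) \<le> b / e * (4 * B)"
        using b(1) e B by (intro mult_right_mono divide_left_mono) auto
      ultimately show ?thesis by linarith
    qed
    also have "b * (R - 1) * m = b * (2 * N + 4 * B / e)"
      using m by (simp add: R_def field_simps)
    finally show ?thesis
      using e b by (simp add: field_simps)
  qed
  moreover have "0 < e * exp (- R)" using e by simp
  ultimately show ?thesis by blast
qed

section \<open>Smooth bump functions and translations\<close>

text \<open>The powers of \<open>t\<close> in the denominator make the family closed under differentiation.\<close>

definition flat_exp :: "nat \<Rightarrow> real \<Rightarrow> real" where
  "flat_exp k t = (if 0 < t then exp (- 1 / t) / t ^ k else 0)"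

lemma flat_exp_nonneg: "0 \<le> flat_exp k t"
  by (simp add: flat_exp_def)

text \<open>The term of order \<open>k + 2\<close> of the exponential series of \<open>1/t\<close> bounds \<open>exp (1/t)\<close> from below. The
  quadratic bound gives the derivative \<open>0\<close> at the origin.\<close>

lemma flat_exp_le_square: "flat_exp k t \<le> fact (k + 2) * t\<^sup>2"
proof (cases "0 < t")
  case True
  have "(1 / t) ^ (k + 2) /\<^sub>R fact (k + 2) \<le> (\<Sum>n. (1 / t) ^ n /\<^sub>R fact n)"
  proof -
    have "(\<Sum>n\<in>{k + 2}. (1 / t) ^ n /\<^sub>R fact n) \<le> (\<Sum>n. (1 / t) ^ n /\<^sub>R fact n)"
      by (rule sum_le_suminf) (use True in \<open>auto simp: mult.commute intro: summable_exp\<close>)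
    then show ?thesis by simp
  qed
  then have "(1 / t) ^ (k + 2) / fact (k + 2) \<le> exp (1 / t)"
    by (simp add: exp_def divide_inverse mult.commute)
  moreover have "1 \<le> E * (F * t ^ n)" if "(1 / t) ^ n / F \<le> E" "0 < F" for E F :: real and n
    using that True by (simp add: power_divide field_simps)
  ultimately have "1 \<le> exp (1 / t) * (fact (k + 2) * t ^ (k + 2))"
    using fact_gt_zero by blast
  moreover have inv: "inverse E \<le> Y" if "1 \<le> E * Y" "0 < E" for E Y :: real
    using that by (simp add: field_simps)
  ultimately have "exp (- 1 / t) \<le> fact (k + 2) * t ^ (k + 2)"
    using inv[of "exp (1 / t)", OF _ exp_gt_zero] unfolding exp_minus[symmetric] by simp
  also have "\<dots> = fact (k + 2) * t\<^sup>2 * t ^ k"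
    by (simp add: power_add power2_eq_square mult_ac)
  finally show ?thesis
    using True by (simp add: flat_exp_def divide_le_eq)
qed (simp add: flat_exp_def)

lemma flat_exp_has_derivative:
  "(flat_exp k has_real_derivative flat_exp (k + 2) t - real k * flat_exp (k + 1) t) (at t)"
proof -
  consider "t < 0" | "t = 0" | "0 < t" by linarith
  then show ?thesis
  proof cases
    case 1
    have "((\<lambda>_. 0) has_real_derivative flat_exp (k + 2) t - real k * flat_exp (k + 1) t) (at t)"
      using 1 by (simp add: flat_exp_def)
    then show ?thesis
      by (rule has_field_derivative_transform_within_open[where S="{..<0}"])
         (use 1 in \<open>auto simp: flat_exp_def\<close>)
  next
    case 2
    have "((\<lambda>h. flat_exp k h / h) \<longlongrightarrow> 0) (at 0)"
    proof (rule Lim_null_comparison)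
      show "\<forall>\<^sub>F h in at 0. norm (flat_exp k h / h) \<le> fact (k + 2) * \<bar>h\<bar>"
      proof (rule always_eventually, rule allI)
        fix h
        have "flat_exp k h \<le> fact (k + 2) * \<bar>h\<bar> * \<bar>h\<bar>"
          using flat_exp_le_square[of k h] by (simp add: power2_eq_square mult.assoc abs_mult_self_eq)
        then show "norm (flat_exp k h / h) \<le> fact (k + 2) * \<bar>h\<bar>"
          using flat_exp_nonneg[of k h]
          by (cases "h = 0") (auto simp: divide_le_eq)
      qed
      show "((\<lambda>h. fact (k + 2) * \<bar>h\<bar>) \<longlongrightarrow> 0) (at (0::real))"
        by (rule tendsto_eq_intros refl | simp)+
    qed
    then show ?thesis
      unfolding 2 by (simp add: DERIV_def flat_exp_def)
  next
    case 3
    have "((\<lambda>t. exp (- 1 / t) / t ^ k) has_real_derivative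
        (exp (- 1 / t) * (1 / t\<^sup>2) * t ^ k - exp (- 1 / t) * (real k * t ^ (k - 1))) / (t ^ k * t ^ k)) (at t)"
      using 3 by (auto intro!: derivative_eq_intros simp: power2_eq_square)
    also have "(exp (- 1 / t) * (1 / t\<^sup>2) * t ^ k - exp (- 1 / t) * (real k * t ^ (k - 1))) / (t ^ k * t ^ k)
        = flat_exp (k + 2) t - real k * flat_exp (k + 1) t"
      using 3 by (cases k) (simp_all add: flat_exp_def field_simps power_add power2_eq_square)
    finally show ?thesis
      by (rule has_field_derivative_transform_within_open[where S="{0<..}"])
         (use 3 in \<open>auto simp: flat_exp_def\<close>)
  qed
qed

text \<open>An algebra of functions that contains the bump functions and is closed under directional
  derivatives; smoothness of all its members then follows by one induction.\<close>

inductive flat_algebra :: "real \<Rightarrow> (complex \<Rightarrow> real) \<Rightarrow> bool" for \<delta> where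
  const: "flat_algebra \<delta> (\<lambda>_. c)"
| inner: "flat_algebra \<delta> (\<lambda>z. z \<bullet> v)"
| flat: "flat_algebra \<delta> (\<lambda>z. flat_exp k (\<delta> - z \<bullet> z))"
| add: "flat_algebra \<delta> f \<Longrightarrow> flat_algebra \<delta> g \<Longrightarrow> flat_algebra \<delta> (\<lambda>z. f z + g z)"
| mult: "flat_algebra \<delta> f \<Longrightarrow> flat_algebra \<delta> g \<Longrightarrow> flat_algebra \<delta> (\<lambda>z. f z * g z)"

lemma flat_algebra_derivative:
  assumes "flat_algebra \<delta> f"
  shows "\<exists>D. (\<forall>x. (f has_derivative (\<lambda>v. D v x)) (at x)) \<and> (\<forall>v. flat_algebra \<delta> (D v))"
  using assms
proof induction
  case (const c)
  show ?case by (rule exI[of _ "\<lambda>v x. 0"]) (auto intro: flat_algebra.const)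
next
  case (inner v)
  show ?case
    by (rule exI[of _ "\<lambda>w x. w \<bullet> v"]) (auto intro!: flat_algebra.const derivative_eq_intros)
next
  case (flat k)
  let ?D = "\<lambda>v x. (flat_exp (k + 2) (\<delta> - x \<bullet> x) + (- real k) * flat_exp (k + 1) (\<delta> - x \<bullet> x)) * ((- 2) * (x \<bullet> v))"
  have "((\<lambda>z. flat_exp k (\<delta> - z \<bullet> z)) has_derivative (\<lambda>v. ?D v x)) (at x)" for x
  proof -
    have "((\<lambda>z. \<delta> - z \<bullet> z) has_derivative (\<lambda>v. - 2 * (x \<bullet> v))) (at x)"
      by (auto intro!: derivative_eq_intros simp: inner_commute)
    from has_derivative_compose[OF this flat_exp_has_derivative[unfolded has_field_derivative_def]]
    show ?thesis by (simp add: mult_ac)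
  qed
  moreover have "flat_algebra \<delta> (?D v)" for v
    by (intro flat_algebra.intros)
  ultimately show ?case by (intro exI[of _ ?D]) blast
next
  case (add f g)
  then obtain D E where D: "\<And>x. (f has_derivative (\<lambda>v. D v x)) (at x)" "\<And>v. flat_algebra \<delta> (D v)"
    and E: "\<And>x. (g has_derivative (\<lambda>v. E v x)) (at x)" "\<And>v. flat_algebra \<delta> (E v)"
    by blast
  show ?case
    by (rule exI[of _ "\<lambda>v x. D v x + E v x"])
       (auto intro!: has_derivative_add D E flat_algebra.add)
next
  case (mult f g)
  then obtain D E where D: "\<And>x. (f has_derivative (\<lambda>v. D v x)) (at x)" "\<And>v. flat_algebra \<delta> (D v)"
    and E: "\<And>x. (g has_derivative (\<lambda>v. E v x)) (at x)" "\<And>v. flat_algebra \<delta> (E v)"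
    by blast
  show ?case
    by (rule exI[of _ "\<lambda>v x. f x * E v x + D v x * g x"])
       (auto intro!: has_derivative_mult D E flat_algebra.add flat_algebra.mult mult.hyps)
qed

lemma flat_algebra_smooth: "flat_algebra \<delta> f \<Longrightarrow> C_k_on_UNIV k f"
proof (induction k arbitrary: f)
  case 0
  from flat_algebra_derivative[OF 0] obtain D where "\<And>x. (f has_derivative (\<lambda>v. D v x)) (at x)" by blast
  then show ?case by (auto intro!: continuous_at_imp_continuous_on has_derivative_continuous)
next
  case (Suc k)
  from flat_algebra_derivative[OF Suc.prems] obtain D
    where D: "\<And>x. (f has_derivative (\<lambda>v. D v x)) (at x)" "\<And>v. flat_algebra \<delta> (D v)" by blast
  have "frechet_derivative f (at x) v = D v x" for x v
    using frechet_derivative_at[OF D(1)] by metis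
  then show ?case
    using D Suc.IH by (auto simp: differentiable_def)
qed

definition bump :: "real \<Rightarrow> complex \<Rightarrow> real" where
  "bump \<delta> z = flat_exp 0 (\<delta> - z \<bullet> z)"

lemma bump_nonneg: "0 \<le> bump \<delta> z"
  by (simp add: bump_def flat_exp_nonneg)

lemma bump_eq_0: "\<delta> \<le> (cmod z)\<^sup>2 \<Longrightarrow> bump \<delta> z = 0"
  by (simp add: bump_def flat_exp_def power2_norm_eq_inner)

lemma bump_in_Cc_infty: "bump \<delta> \<in> Cc_infty"
proof -
  have "{z. bump \<delta> z \<noteq> 0} \<subseteq> cball 0 (sqrt \<delta>)"
  proof
    fix z assume "z \<in> {z. bump \<delta> z \<noteq> 0}"
    then have "(cmod z)\<^sup>2 < \<delta>" using bump_eq_0[of \<delta> z] by force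
    then show "z \<in> cball 0 (sqrt \<delta>)" by (simp add: real_le_rsqrt)
  qed
  then have "bounded {z. bump \<delta> z \<noteq> 0}"
    using bounded_cball bounded_subset by blast
  moreover have "C_k_on_UNIV k (bump \<delta>)" for k
    unfolding bump_def by (rule flat_algebra_smooth[OF flat_algebra.flat])
  ultimately show ?thesis by (simp add: Cc_infty_def compact_closure)
qed

lemma frechet_derivative_shift:
  fixes g :: "'a::real_normed_vector \<Rightarrow> 'b::real_normed_vector"
  assumes "\<And>x. g differentiable (at x)"
  shows "frechet_derivative (\<lambda>x. g (x - y)) (at x) = frechet_derivative g (at (x - y))"
proof -
  have "((\<lambda>x. g (x - y)) has_derivative frechet_derivative g (at (x - y))) (at x)"
    by (rule has_derivative_eq_rhs[OF has_derivative_compose[where f="\<lambda>x. x - y" and f'="\<lambda>d. d"]])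
       (use assms in \<open>auto intro!: derivative_eq_intros simp: frechet_derivative_works[symmetric]\<close>)
  then show ?thesis by (rule frechet_derivative_at[symmetric])
qed

lemma C_k_on_UNIV_shift: "C_k_on_UNIV k g \<Longrightarrow> C_k_on_UNIV k (\<lambda>x. g (x - y))"
proof (induction k arbitrary: g)
  case 0
  then show ?case by (auto intro!: continuous_on_compose2[of UNIV g] continuous_intros)
next
  case (Suc k)
  then have d: "\<And>x. g differentiable (at x)" by simp
  have "(\<lambda>x. g (x - y)) differentiable (at x)" for x
    using d by (intro differentiable_chain_at[of "\<lambda>x. x - y" x g, unfolded o_def])
      (auto intro: derivative_intros)
  moreover have "C_k_on_UNIV k (\<lambda>x. frechet_derivative g (at (x - y)) v)" for v
    using Suc.prems by (intro Suc.IH[of "\<lambda>x. frechet_derivative g (at x) v"]) simp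
  ultimately show ?case
    by (simp add: frechet_derivative_shift[OF d])
qed

lemma Cc_infty_iff:
  "f \<in> Cc_infty \<longleftrightarrow> (\<forall>k. C_k_on_UNIV k f) \<and> (\<exists>R. \<forall>z. R < cmod z \<longrightarrow> f z = 0)"
proof -
  have "bounded {z. f z \<noteq> 0} \<longleftrightarrow> (\<exists>R. \<forall>z. R < cmod z \<longrightarrow> f z = 0)"
    unfolding bounded_iff by (auto simp: not_less[symmetric])
  then show ?thesis by (simp add: Cc_infty_def compact_closure)
qed

lemma Cc_infty_shift:
  assumes "g \<in> Cc_infty" shows "(\<lambda>x. g (x - y)) \<in> Cc_infty"
proof -
  from assms obtain R where R: "\<And>z. R < cmod z \<Longrightarrow> g z = 0" by (auto simp: Cc_infty_iff)
  have "g (z - y) = 0" if "R + cmod y < cmod z" for z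
    using that norm_triangle_ineq2[of z y] by (intro R) linarith
  with assms show ?thesis by (auto simp: Cc_infty_iff intro: C_k_on_UNIV_shift)
qed

section \<open>Integration by parts in the plane\<close>

text \<open>The form of the derivative in which dominated convergence applies along a sequence of step sizes.\<close>

lemma has_vector_derivative_difference_quotient:
  fixes f :: "real \<Rightarrow> 'a::real_normed_vector"
  assumes "(f has_vector_derivative v) (at 0)"
  shows "((\<lambda>h. (f h - f 0) /\<^sub>R h) \<longlongrightarrow> v) (at 0)"
proof -
  have "((\<lambda>h. norm (f h - f 0 - h *\<^sub>R v) / \<bar>h\<bar>) \<longlongrightarrow> 0) (at 0)"
    using assms by (simp add: has_vector_derivative_def has_derivative_iff_norm)
  then have "((\<lambda>h. norm ((f h - f 0) /\<^sub>R h - v)) \<longlongrightarrow> 0) (at 0)"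
  proof (rule Lim_transform_eventually)
    have "norm (f h - f 0 - h *\<^sub>R v) / \<bar>h\<bar> = norm ((f h - f 0) /\<^sub>R h - v)" if "h \<noteq> 0" for h
    proof -
      have "(f h - f 0) /\<^sub>R h - v = (f h - f 0 - h *\<^sub>R v) /\<^sub>R h"
        using that by (simp add: scaleR_diff_right)
      then show ?thesis by (simp add: divide_inverse_commute)
    qed
    then show "\<forall>\<^sub>F h in at 0. norm (f h - f 0 - h *\<^sub>R v) / \<bar>h\<bar> = norm ((f h - f 0) /\<^sub>R h - v)"
      by (auto simp: eventually_at_filter)
  qed
  from tendsto_norm_zero_cancel[OF this] show ?thesis
    by (simp add: LIM_zero_iff)
qed

lemma compactly_supported_bounded:
  fixes h :: "'a::euclidean_space \<Rightarrow> 'b::real_normed_vector"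
  assumes "continuous_on UNIV h" and "\<And>z. R < norm z \<Longrightarrow> h z = 0"
  obtains C where "0 \<le> C" "\<And>z. norm (h z) \<le> C"
proof -
  have "compact (h ` cball 0 R)"
    using assms(1) by (intro compact_continuous_image) (auto intro: continuous_on_subset)
  then obtain C where C: "\<And>z. z \<in> cball 0 R \<Longrightarrow> norm (h z) \<le> C"
    by (metis bounded_iff compact_imp_bounded imageI)
  have "norm (h z) \<le> max C 0" for z
    using C[of z] assms(2)[of z] by (cases "R < norm z") (auto simp: not_less)
  then show ?thesis by (intro that[of "max C 0"]) auto
qed

lemma compactly_supported_integrable:
  fixes h :: "'a::euclidean_space \<Rightarrow> 'b::{banach, second_countable_topology}"
  assumes "continuous_on UNIV h" and "\<And>z. R < norm z \<Longrightarrow> h z = 0"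
  shows "integrable lborel h"
proof -
  have "integrable lborel (\<lambda>x. indicator (cball 0 R) x *\<^sub>R h x)"
    using assms(1) by (intro borel_integrable_compact) (auto intro: continuous_on_subset)
  also have "(\<lambda>x. indicator (cball 0 R) x *\<^sub>R h x) = h"
    using assms(2) by (auto simp: fun_eq_iff indicator_def not_le[symmetric])
  finally show ?thesis .
qed

lemma derivative_eq_0_off_support:
  fixes p :: "'a::real_normed_vector \<Rightarrow> 'b::real_normed_vector"
  assumes supp: "\<And>z. R < norm z \<Longrightarrow> p z = 0"
    and deriv: "(p has_derivative p') (at z)" and z: "R < norm z"
  shows "p' = (\<lambda>_. 0)"
proof -
  have "((\<lambda>_. 0) has_derivative p') (at z)"
    by (rule has_derivative_transform_within_open[OF deriv, where s="- cball 0 R"])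
       (use z supp in \<open>auto simp: open_Compl\<close>)
  then show ?thesis
    using has_derivative_unique[OF _ has_derivative_const] by blast
qed

text \<open>The integral of every difference quotient in direction \<open>d\<close> vanishes by translation invariance,
  and the difference quotients are dominated by a multiple of the indicator of a ball.\<close>

lemma integral_directional_derivative_eq_0:
  fixes p :: "'a::euclidean_space \<Rightarrow> 'b::{banach, second_countable_topology}"
  assumes deriv: "\<And>x. (p has_derivative p' x) (at x)"
    and cont: "continuous_on UNIV (\<lambda>x. p' x d)"
    and supp: "\<And>z. R < norm z \<Longrightarrow> p z = 0"
  shows "(\<integral>x. p' x d \<partial>lborel) = 0"
proof -
  have contp: "continuous_on UNIV p"
    using deriv by (auto intro!: continuous_at_imp_continuous_on has_derivative_continuous)
  have [measurable]: "p \<in> borel_measurable borel" "(\<lambda>x. p' x d) \<in> borel_measurable borel"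
    using contp cont by (auto intro: borel_measurable_continuous_onI)
  have supp': "p' z d = 0" if "R < norm z" for z
    using derivative_eq_0_off_support[OF supp deriv that] by simp
  obtain C where C: "0 \<le> C" "\<And>z. norm (p' z d) \<le> C"
    using compactly_supported_bounded[OF cont supp'] by blast
  have line: "((\<lambda>t. p (x + t *\<^sub>R d)) has_vector_derivative p' (x + t *\<^sub>R d) d) (at t)" for x t
  proof -
    have "((\<lambda>t. x + t *\<^sub>R d) has_derivative (\<lambda>h. h *\<^sub>R d)) (at t)"
      by (auto intro!: derivative_eq_intros)
    from has_derivative_compose[OF this deriv]
    show ?thesis
      using deriv[THEN has_derivative_linear]
      by (simp add: has_vector_derivative_def linear_cmul)
  qed
  have lip: "norm (p (x + t *\<^sub>R d) - p x) \<le> C * t" if "0 \<le> t" for x t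
  proof -
    have "norm (p (x + t *\<^sub>R d) - p (x + 0 *\<^sub>R d)) \<le> C * norm (t - 0)"
    proof (rule differentiable_bound[of UNIV _ "\<lambda>s h. h *\<^sub>R p' (x + s *\<^sub>R d) d"])
      show "((\<lambda>t. p (x + t *\<^sub>R d)) has_derivative (\<lambda>h. h *\<^sub>R p' (x + s *\<^sub>R d) d)) (at s within UNIV)" for s
        using line by (simp add: has_vector_derivative_def)
      show "onorm (\<lambda>h. h *\<^sub>R p' (x + s *\<^sub>R d) d) \<le> C" for s
        by (rule onorm_bound) (use C in \<open>auto simp: mult.commute[of C] intro!: mult_left_mono\<close>)
    qed auto
    then show ?thesis using that by simp
  qed
  define t where "t n = inverse (real (Suc n))" for n
  have t: "0 < t n" "t n \<le> 1" for n by (auto simp: t_def field_simps)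
  have tlim: "t \<longlonglongrightarrow> 0" unfolding t_def by (rule LIMSEQ_inverse_real_of_nat)
  have tlim': "filterlim t (at 0) sequentially"
    using tlim t(1) by (auto simp: filterlim_at less_imp_neq[symmetric] intro!: always_eventually)
  let ?s = "\<lambda>n x. (p (x + t n *\<^sub>R d) - p x) /\<^sub>R t n"
  have int_p: "has_bochner_integral lborel p (integral\<^sup>L lborel p)"
    using compactly_supported_integrable[OF contp supp] by (simp add: has_bochner_integral_iff)
  have zero: "integral\<^sup>L lborel (?s n) = 0" for n
  proof -
    have "has_bochner_integral lborel (?s n) ((integral\<^sup>L lborel p - integral\<^sup>L lborel p) /\<^sub>R t n)"
      by (intro has_bochner_integral_scaleR_right has_bochner_integral_diff int_p
          has_bochner_integral_lborel_translate)
    then show ?thesis by (simp add: has_bochner_integral_iff)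
  qed
  have "(\<lambda>n. integral\<^sup>L lborel (?s n)) \<longlonglongrightarrow> (\<integral>x. p' x d \<partial>lborel)"
  proof (rule integral_dominated_convergence)
    show "integrable lborel (\<lambda>x. C * indicator (cball 0 (R + norm d)) x :: real)"
      by (intro integrable_mult_right integrable_real_indicator) (use emeasure_lborel_cball_finite in \<open>auto simp: infinity_ennreal_def\<close>)
    show "AE x in lborel. (\<lambda>n. ?s n x) \<longlonglongrightarrow> p' x d"
    proof (rule AE_I2)
      fix x
      have "((\<lambda>h. (p (x + h *\<^sub>R d) - p (x + 0 *\<^sub>R d)) /\<^sub>R h) \<longlongrightarrow> p' (x + 0 *\<^sub>R d) d) (at 0)"
        by (rule has_vector_derivative_difference_quotient[OF line])
      then show "(\<lambda>n. ?s n x) \<longlonglongrightarrow> p' x d"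
        using filterlim_compose[OF _ tlim'] by fastforce
    qed
    show "AE x in lborel. norm (?s n x) \<le> C * indicator (cball 0 (R + norm d)) x" for n
    proof (rule AE_I2)
      fix x
      show "norm (?s n x) \<le> C * indicator (cball 0 (R + norm d)) x"
      proof (cases "norm x \<le> R + norm d")
        case True
        then show ?thesis using lip[of "t n" x] t(1)[of n] by (simp add: divide_le_eq divide_inverse_commute[symmetric])
      next
        case False
        have "norm (t n *\<^sub>R d) \<le> norm d" using t[of n] by (simp add: mult_left_le_one_le)
        moreover have "norm x \<le> norm (x + t n *\<^sub>R d) + norm (t n *\<^sub>R d)"
          using norm_triangle_ineq4[of "x + t n *\<^sub>R d" "t n *\<^sub>R d"] by simp
        ultimately have "R < norm (x + t n *\<^sub>R d)" "R < norm x"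
          using False norm_ge_zero[of d] by linarith+
        then show ?thesis using supp C(1) by simp
      qed
    qed
  qed measurable
  then show ?thesis unfolding zero by (simp add: LIMSEQ_const_iff)
qed

lemma Cc_infty_derivative:
  assumes "f \<in> Cc_infty"
  shows "(f has_derivative frechet_derivative f (at x)) (at x)"
    and "continuous_on UNIV (\<lambda>x. frechet_derivative f (at x) d)"
    and "continuous_on UNIV f"
proof -
  have "C_k_on_UNIV (Suc 0) f" "C_k_on_UNIV 0 f" using assms by (simp_all only: Cc_infty_def mem_Collect_eq)
  then show "(f has_derivative frechet_derivative f (at x)) (at x)"
    "continuous_on UNIV (\<lambda>x. frechet_derivative f (at x) d)" "continuous_on UNIV f"
    by (simp_all add: frechet_derivative_works[symmetric])
qed

lemma frechet_derivative_of_real: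
  assumes "f \<in> Cc_infty"
  shows "frechet_derivative (\<lambda>z. complex_of_real (f z)) (at z) = (\<lambda>d. of_real (frechet_derivative f (at z) d))"
  by (rule frechet_derivative_at[symmetric])
     (intro has_derivative_of_real Cc_infty_derivative assms)

definition dbar :: "(complex \<Rightarrow> real) \<Rightarrow> complex \<Rightarrow> complex" where
  "dbar f = wirtinger_dzbar (\<lambda>z. complex_of_real (f z))"

definition dz :: "(complex \<Rightarrow> real) \<Rightarrow> complex \<Rightarrow> complex" where
  "dz f = wirtinger_dz (\<lambda>z. complex_of_real (f z))"

lemma dbar_eq: "f \<in> Cc_infty \<Longrightarrow> dbar f z =
    (of_real (frechet_derivative f (at z) 1) + \<i> * of_real (frechet_derivative f (at z) \<i>)) / 2"
  and dz_eq: "f \<in> Cc_infty \<Longrightarrow> dz f z =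
    (of_real (frechet_derivative f (at z) 1) - \<i> * of_real (frechet_derivative f (at z) \<i>)) / 2"
  by (simp_all add: dbar_def dz_def wirtinger_dz_def wirtinger_dzbar_def frechet_derivative_of_real)

lemma continuous_on_dbar: "f \<in> Cc_infty \<Longrightarrow> continuous_on UNIV (dbar f)"
  and continuous_on_dz: "f \<in> Cc_infty \<Longrightarrow> continuous_on UNIV (dz f)"
proof -
  assume f: "f \<in> Cc_infty"
  note c = Cc_infty_derivative(2)[OF f, THEN continuous_on_of_real]
  have "continuous_on UNIV (\<lambda>z. (of_real (frechet_derivative f (at z) 1) + \<i> * of_real (frechet_derivative f (at z) \<i>)) / 2)"
    by (intro continuous_on_divide continuous_on_add continuous_on_mult continuous_on_const c) simp
  then show "continuous_on UNIV (dbar f)" using f by (simp add: dbar_eq cong: continuous_on_cong)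
  have "continuous_on UNIV (\<lambda>z. (of_real (frechet_derivative f (at z) 1) - \<i> * of_real (frechet_derivative f (at z) \<i>)) / 2)"
    by (intro continuous_on_divide continuous_on_diff continuous_on_mult continuous_on_const c) simp
  then show "continuous_on UNIV (dz f)" using f by (simp add: dz_eq cong: continuous_on_cong)
qed

lemma Cc_infty_support:
  assumes "f \<in> Cc_infty"
  shows "\<exists>R. \<forall>z. R < cmod z \<longrightarrow> f z = 0 \<and> dbar f z = 0 \<and> dz f z = 0"
proof -
  from assms obtain R where R: "\<And>z. R < cmod z \<Longrightarrow> f z = 0" by (auto simp: Cc_infty_iff)
  have "frechet_derivative f (at z) = (\<lambda>_. 0)" if "R < cmod z" for z
    using derivative_eq_0_off_support[OF R Cc_infty_derivative(1)[OF assms] that] .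
  then show ?thesis using R assms by (intro exI[of _ R]) (simp add: dbar_eq dz_eq)
qed

lemma dbar_shift: "f \<in> Cc_infty \<Longrightarrow> dbar (\<lambda>x. f (x - y)) z = dbar f (z - y)"
  and dz_shift: "f \<in> Cc_infty \<Longrightarrow> dz (\<lambda>x. f (x - y)) z = dz f (z - y)"
proof -
  assume f: "f \<in> Cc_infty"
  have "frechet_derivative (\<lambda>x. f (x - y)) (at z) = frechet_derivative f (at (z - y))"
    using Cc_infty_derivative(1)[OF f] by (intro frechet_derivative_shift) (auto simp: differentiable_def)
  then show "dbar (\<lambda>x. f (x - y)) z = dbar f (z - y)" "dz (\<lambda>x. f (x - y)) z = dz f (z - y)"
    using f by (simp_all add: dbar_eq dz_eq Cc_infty_shift)
qed

lemma integral_by_parts: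
  assumes f: "f \<in> Cc_infty"
    and k: "\<And>x. (k has_derivative k' x) (at x)" and cont: "continuous_on UNIV (\<lambda>x. k' x d)"
  shows "has_bochner_integral lborel (\<lambda>x. of_real (frechet_derivative f (at x) d) * k x)
    (- (\<integral>x. of_real (f x) * k' x d \<partial>lborel) :: complex)"
proof -
  obtain R where R: "\<And>z. R < cmod z \<Longrightarrow> f z = 0"
    using Cc_infty_support[OF f] by auto
  have supp': "frechet_derivative f (at z) d = 0" if "R < cmod z" for z
    using derivative_eq_0_off_support[OF R Cc_infty_derivative(1)[OF f] that] by simp
  have contk: "continuous_on UNIV k"
    using k by (auto intro!: continuous_at_imp_continuous_on has_derivative_continuous)
  have c1: "continuous_on UNIV (\<lambda>x. of_real (frechet_derivative f (at x) d) * k x)"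
    and c2: "continuous_on UNIV (\<lambda>x. of_real (f x) * k' x d)"
    by (intro continuous_on_mult continuous_on_of_real Cc_infty_derivative f contk cont)+
  have i1: "integrable lborel (\<lambda>x. of_real (frechet_derivative f (at x) d) * k x)"
    and i2: "integrable lborel (\<lambda>x. of_real (f x) * k' x d)"
    using c1 c2 R supp' by (auto intro!: compactly_supported_integrable[where R=R])
  have "((\<lambda>x. of_real (f x) * k x) has_derivative
      (\<lambda>d. of_real (f x) * k' x d + of_real (frechet_derivative f (at x) d) * k x)) (at x)" for x
    by (intro has_derivative_mult has_derivative_of_real Cc_infty_derivative f k)
  then have "(\<integral>x. of_real (f x) * k' x d + of_real (frechet_derivative f (at x) d) * k x \<partial>lborel) = 0"
    by (rule integral_directional_derivative_eq_0[where R=R])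
       (use c1 c2 R in \<open>auto intro!: continuous_on_add\<close>)
  then show ?thesis
    using i1 i2 by (simp add: has_bochner_integral_iff add_eq_0_iff)
qed

lemma integral_by_parts_wirtinger:
  assumes f: "f \<in> Cc_infty"
    and k: "\<And>x. (k has_derivative k' x) (at x)" and cont: "\<And>d. continuous_on UNIV (\<lambda>x. k' x d)"
  shows "(\<integral>x. dbar f x * k x \<partial>lborel) = - (\<integral>x. of_real (f x) * ((k' x 1 + \<i> * k' x \<i>) / 2) \<partial>lborel)"
    and "(\<integral>x. dz f x * k x \<partial>lborel) = - (\<integral>x. of_real (f x) * ((k' x 1 - \<i> * k' x \<i>) / 2) \<partial>lborel)"
proof -
  note parts = integral_by_parts[OF f k cont]
  obtain R where R: "\<And>z. R < cmod z \<Longrightarrow> f z = 0"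
    using Cc_infty_support[OF f] by auto
  have i: "has_bochner_integral lborel (\<lambda>x. of_real (f x) * k' x d) (\<integral>x. of_real (f x) * k' x d \<partial>lborel)" for d
  proof -
    have "continuous_on UNIV (\<lambda>x. of_real (f x) * k' x d)"
      by (intro continuous_on_mult continuous_on_of_real Cc_infty_derivative f cont)
    from compactly_supported_integrable[OF this, of R] show ?thesis
      using R by (simp add: has_bochner_integral_iff)
  qed
  let ?I = "\<lambda>d. \<integral>x. of_real (f x) * k' x d \<partial>lborel"
  have eq_dbar: "dbar f x * k x = (of_real (frechet_derivative f (at x) 1) * k x
      + \<i> * (of_real (frechet_derivative f (at x) \<i>) * k x)) / 2"
    and eq_dz: "dz f x * k x = (of_real (frechet_derivative f (at x) 1) * k x
      - \<i> * (of_real (frechet_derivative f (at x) \<i>) * k x)) / 2"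
    and eq_k_dbar: "of_real (f x) * ((k' x 1 + \<i> * k' x \<i>) / 2) = (of_real (f x) * k' x 1
      + \<i> * (of_real (f x) * k' x \<i>)) / 2"
    and eq_k_dz: "of_real (f x) * ((k' x 1 - \<i> * k' x \<i>) / 2) = (of_real (f x) * k' x 1
      - \<i> * (of_real (f x) * k' x \<i>)) / 2" for x
    by (simp_all add: dbar_eq[OF f] dz_eq[OF f] algebra_simps)
  have "has_bochner_integral lborel (\<lambda>x. (of_real (frechet_derivative f (at x) 1) * k x
      + \<i> * (of_real (frechet_derivative f (at x) \<i>) * k x)) / 2) ((- ?I 1 + \<i> * - ?I \<i>) / 2)"
    by (intro has_bochner_integral_divide_zero has_bochner_integral_add has_bochner_integral_mult_right parts)
  moreover have "has_bochner_integral lborel (\<lambda>x. (of_real (f x) * k' x 1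
      + \<i> * (of_real (f x) * k' x \<i>)) / 2) ((?I 1 + \<i> * ?I \<i>) / 2)"
    by (intro has_bochner_integral_divide_zero has_bochner_integral_add has_bochner_integral_mult_right i)
  ultimately show "(\<integral>x. dbar f x * k x \<partial>lborel) = - (\<integral>x. of_real (f x) * ((k' x 1 + \<i> * k' x \<i>) / 2) \<partial>lborel)"
    unfolding eq_dbar eq_k_dbar by (simp only: has_bochner_integral_iff) (simp add: minus_divide_left)
  have "has_bochner_integral lborel (\<lambda>x. (of_real (frechet_derivative f (at x) 1) * k x
      - \<i> * (of_real (frechet_derivative f (at x) \<i>) * k x)) / 2) ((- ?I 1 - \<i> * - ?I \<i>) / 2)"
    by (intro has_bochner_integral_divide_zero has_bochner_integral_diff has_bochner_integral_mult_right parts)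
  moreover have "has_bochner_integral lborel (\<lambda>x. (of_real (f x) * k' x 1
      - \<i> * (of_real (f x) * k' x \<i>)) / 2) ((?I 1 - \<i> * ?I \<i>) / 2)"
    by (intro has_bochner_integral_divide_zero has_bochner_integral_diff has_bochner_integral_mult_right i)
  ultimately show "(\<integral>x. dz f x * k x \<partial>lborel) = - (\<integral>x. of_real (f x) * ((k' x 1 - \<i> * k' x \<i>) / 2) \<partial>lborel)"
    unfolding eq_dz eq_k_dz by (simp only: has_bochner_integral_iff) (simp add: minus_divide_left)
qed

text \<open>In both integrands the supports of \<open>F\<close> and \<open>G\<close> confine both variables, so that a continuous kernel
  without any decay is integrable against them.\<close>

lemma integrable_pair_kernel:
  fixes F G k :: "complex \<Rightarrow> 'b::{banach, second_countable_topology, real_normed_algebra}"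
  assumes "continuous_on UNIV F" "continuous_on UNIV G" "continuous_on UNIV k"
    and F: "\<And>z. R < cmod z \<Longrightarrow> F z = 0" and G: "\<And>z. S < cmod z \<Longrightarrow> G z = 0"
  shows "integrable (lborel \<Otimes>\<^sub>M lborel) (\<lambda>(z, w). F z * G w * k (z - w))"
    and "integrable (lborel \<Otimes>\<^sub>M lborel) (\<lambda>(z, w). F z * G (z - w) * k w)"
proof -
  have cont: "continuous_on UNIV (\<lambda>p. F (fst p))" "continuous_on UNIV (\<lambda>p. G (snd p))"
    "continuous_on UNIV (\<lambda>p. k (fst p - snd p))" "continuous_on UNIV (\<lambda>p. G (fst p - snd p))"
    "continuous_on UNIV (\<lambda>p. k (snd p))"
    using assms by (auto intro!: continuous_intros continuous_on_compose2[of UNIV F]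
        continuous_on_compose2[of UNIV G] continuous_on_compose2[of UNIV k])
  have "integrable lborel (\<lambda>p. F (fst p) * G (snd p) * k (fst p - snd p))"
  proof (rule compactly_supported_integrable[where R="\<bar>R\<bar> + \<bar>S\<bar>"])
    fix p :: "complex \<times> complex"
    assume "\<bar>R\<bar> + \<bar>S\<bar> < norm p"
    with norm_Pair_le[of "fst p" "snd p"] have "R < cmod (fst p) \<or> S < cmod (snd p)" by simp linarith
    then show "F (fst p) * G (snd p) * k (fst p - snd p) = 0" using F G by auto
  qed (intro continuous_intros cont)
  then show "integrable (lborel \<Otimes>\<^sub>M lborel) (\<lambda>(z, w). F z * G w * k (z - w))"
    by (simp add: lborel_prod case_prod_unfold)
  have "integrable lborel (\<lambda>p. F (fst p) * G (fst p - snd p) * k (snd p))"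
  proof (rule compactly_supported_integrable[where R="2 * \<bar>R\<bar> + \<bar>S\<bar>"])
    fix p :: "complex \<times> complex"
    assume "2 * \<bar>R\<bar> + \<bar>S\<bar> < norm p"
    with norm_Pair_le[of "fst p" "snd p"] norm_triangle_ineq2[of "snd p" "fst p"]
    have "R < cmod (fst p) \<or> S < cmod (fst p - snd p)" by (simp add: norm_minus_commute) linarith
    then show "F (fst p) * G (fst p - snd p) * k (snd p) = 0" using F G by auto
  qed (intro continuous_intros cont)
  then show "integrable (lborel \<Otimes>\<^sub>M lborel) (\<lambda>(z, w). F z * G (z - w) * k w)"
    by (simp add: lborel_prod case_prod_unfold)
qed

section \<open>Formulas for the covariance\<close>

text \<open>The function \<open>-1/(4\<pi>) \<Delta>q\<^sub>r\<close>, which is the kernel of the covariance acting on the test functions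
  themselves instead of their derivatives.\<close>

definition log_kernel :: "real \<Rightarrow> complex \<Rightarrow> real" where
  "log_kernel r x = 2 * r / pi\<^sup>2 * (r - 2 * (x \<bullet> x)) / (r + x \<bullet> x) ^ 4"

lemma kernel_denominator_pos: "0 < r \<Longrightarrow> 0 < r + x \<bullet> x" for x :: complex
  by (simp add: add_pos_nonneg)

lemma continuous_on_q_kernel: "0 < r \<Longrightarrow> continuous_on UNIV (q_kernel r)"
  unfolding q_kernel_def power2_norm_eq_inner
  by (intro continuous_intros) (use kernel_denominator_pos[of r] in \<open>auto simp: less_imp_neq[symmetric]\<close>)

lemma continuous_on_log_kernel: "0 < r \<Longrightarrow> continuous_on UNIV (log_kernel r)"
  unfolding log_kernel_def
  by (intro continuous_intros) (use kernel_denominator_pos[of r] in \<open>auto simp: less_imp_neq[symmetric]\<close>)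

lemma has_derivative_q_kernel:
  assumes r: "0 < r"
  shows "((\<lambda>z. complex_of_real (q_kernel r (z - w))) has_derivative
    (\<lambda>d. of_real (- 4 * r * ((z - w) \<bullet> d) / (pi * (r + (z - w) \<bullet> (z - w)) ^ 3)))) (at z)"
proof -
  have D: "0 < r + (z - w) \<bullet> (z - w)" by (rule kernel_denominator_pos[OF r])
  have "((\<lambda>z. r + (z - w) \<bullet> (z - w)) has_derivative (\<lambda>d. 2 * ((z - w) \<bullet> d))) (at z)"
    by (auto intro!: derivative_eq_intros simp: inner_commute)
  moreover have "((\<lambda>s. r / (pi * s\<^sup>2)) has_real_derivative - 2 * r / (pi * (r + (z - w) \<bullet> (z - w)) ^ 3))
      (at (r + (z - w) \<bullet> (z - w)))"
    using D by (auto intro!: derivative_eq_intros simp: power2_eq_square power3_eq_cube divide_simps)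
  ultimately have "((\<lambda>z. r / (pi * (r + (z - w) \<bullet> (z - w))\<^sup>2)) has_derivative
      (\<lambda>d. - 4 * r * ((z - w) \<bullet> d) / (pi * (r + (z - w) \<bullet> (z - w)) ^ 3))) (at z)"
    by (rule has_derivative_eq_rhs[OF has_derivative_compose[OF _ has_field_derivative_imp_has_derivative]]) auto
  then show ?thesis
    unfolding q_kernel_def power2_norm_eq_inner by (rule has_derivative_of_real)
qed

text \<open>The derivative of \<open>q\<^sub>r\<close> with respect to the conjugate variable.\<close>

definition q_gradient :: "real \<Rightarrow> complex \<Rightarrow> complex" where
  "q_gradient r x = - (of_real (2 * r / pi) * x / of_real ((r + x \<bullet> x) ^ 3))"

lemma continuous_on_q_gradient: "0 < r \<Longrightarrow> continuous_on UNIV (q_gradient r)"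
  unfolding q_gradient_def
  by (intro continuous_intros)
     (metis kernel_denominator_pos less_irrefl of_real_eq_0_iff power_not_zero)

lemma has_derivative_q_gradient:
  assumes r: "0 < r"
  shows "((\<lambda>w. q_gradient r (z - w)) has_derivative
    (\<lambda>d. of_real (2 * r / pi) * (d / of_real ((r + (z - w) \<bullet> (z - w)) ^ 3)
       - (z - w) * of_real (6 * ((z - w) \<bullet> d)) / of_real ((r + (z - w) \<bullet> (z - w)) ^ 4)))) (at w)"
proof -
  define D where "D = r + (z - w) \<bullet> (z - w)"
  have D: "0 < D" unfolding D_def by (rule kernel_denominator_pos[OF r])
  have 1: "((\<lambda>w. of_real (2 * r / pi) * (z - w)) has_derivative (\<lambda>d. - (of_real (2 * r / pi) * d))) (at w)"
    by (auto intro!: derivative_eq_intros)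
  have 2: "((\<lambda>w. complex_of_real ((r + (z - w) \<bullet> (z - w)) ^ 3)) has_derivative
      (\<lambda>d. of_real (- 6 * ((z - w) \<bullet> d) * D\<^sup>2))) (at w)"
    unfolding D_def
    by (rule has_derivative_of_real, rule has_derivative_eq_rhs, (rule derivative_eq_intros refl)+)
       (auto simp: fun_eq_iff inner_commute algebra_simps)
  have nz: "complex_of_real ((r + (z - w) \<bullet> (z - w)) ^ 3) \<noteq> 0"
    using D unfolding D_def by (simp only: of_real_eq_0_iff power_eq_0_iff) simp
  show ?thesis
    unfolding q_gradient_def
    by (rule has_derivative_eq_rhs[OF has_derivative_minus[OF has_derivative_divide'[OF 1 2 nz]]])
       (use D in \<open>auto simp: fun_eq_iff D_def[symmetric] divide_simps power2_eq_square power3_eq_cube power4_eq_xxxx\<close>, simp add: algebra_simps)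
qed

lemma Gamma_cov_0:
  "Gamma_cov v f g 0 = 1 / of_real pi * (\<integral>z. dbar f z * dz g z \<partial>lborel)"
  by (simp add: Gamma_cov_def dbar_def dz_def)

lemma Gamma_cov_pos:
  assumes "0 < \<tau> * (1 - (cmod v)\<^sup>2)"
  shows "Gamma_cov v f g \<tau> = 1 / of_real pi *
    (\<integral>(z, w). dbar f z * dz g w * of_real (q_kernel (\<tau> * (1 - (cmod v)\<^sup>2)) (z - w)) \<partial>(lborel \<Otimes>\<^sub>M lborel))"
proof -
  have "\<tau> * (1 - (cmod v)\<^sup>2) \<noteq> 0" by (rule less_imp_neq[OF assms, symmetric])
  then show ?thesis unfolding Gamma_cov_def dbar_def dz_def Let_def by (simp only: if_False)
qed

lemma Gamma_cov_0_shift: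
  assumes "f \<in> Cc_infty" "g \<in> Cc_infty"
  shows "Gamma_cov v (\<lambda>x. f (x - y)) (\<lambda>x. g (x - y)) 0 = Gamma_cov v f g 0"
proof -
  have c: "continuous_on UNIV (\<lambda>z. dbar f z * dz g z)"
    by (intro continuous_on_mult continuous_on_dbar continuous_on_dz assms)
  obtain R where "\<And>z. R < cmod z \<Longrightarrow> dbar f z * dz g z = 0"
    using Cc_infty_support[OF assms(1)] by auto
  then have "has_bochner_integral lborel (\<lambda>z. dbar f z * dz g z) (\<integral>z. dbar f z * dz g z \<partial>lborel)"
    using compactly_supported_integrable[OF c, of R] by (simp add: has_bochner_integral_iff)
  from has_bochner_integral_lborel_translate[OF this, of "- y"]
  show ?thesis
    unfolding Gamma_cov_0 by (simp add: dbar_shift dz_shift assms has_bochner_integral_iff)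
qed

text \<open>Positive lags are averages of lag \<open>0\<close> over translations: substitute \<open>w = z - y\<close> in the double
  integral and exchange the order of integration.\<close>

lemma Gamma_cov_average:
  assumes f: "f \<in> Cc_infty" and g: "g \<in> Cc_infty" and r: "0 < r" "r = \<tau> * (1 - (cmod v)\<^sup>2)"
  shows "Gamma_cov v f g \<tau> = (\<integral>y. of_real (q_kernel r y) * Gamma_cov v f (\<lambda>x. g (x - y)) 0 \<partial>lborel)"
    and "(\<lambda>y. Gamma_cov v f (\<lambda>x. g (x - y)) 0) \<in> borel_measurable borel"
proof -
  obtain R where R: "\<And>z. R < cmod z \<Longrightarrow> dbar f z = 0" using Cc_infty_support[OF f] by auto
  obtain S where S: "\<And>z. S < cmod z \<Longrightarrow> dz g z = 0" using Cc_infty_support[OF g] by auto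
  let ?q = "\<lambda>x. complex_of_real (q_kernel r x)"
  note cont = continuous_on_dbar[OF f] continuous_on_dz[OF g]
    continuous_on_of_real[OF continuous_on_q_kernel[OF r(1)]]
  have i1: "integrable (lborel \<Otimes>\<^sub>M lborel) (\<lambda>(z, w). dbar f z * dz g w * ?q (z - w))"
    and i2: "integrable (lborel \<Otimes>\<^sub>M lborel) (\<lambda>(z, w). dbar f z * dz g (z - w) * ?q w)"
    using integrable_pair_kernel[OF cont R S] by auto
  have G0: "Gamma_cov v f (\<lambda>x. g (x - y)) 0 = 1 / of_real pi * (\<integral>z. dbar f z * dz g (z - y) \<partial>lborel)" for y
    unfolding Gamma_cov_0 using g by (simp add: dz_shift)
  have [measurable]: "dbar f \<in> borel_measurable borel" "dz g \<in> borel_measurable borel"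
    using cont by (auto intro: borel_measurable_continuous_onI)
  have "(\<lambda>y. \<integral>z. dbar f z * dz g (z - y) \<partial>lborel) \<in> borel_measurable borel"
    by measurable
  then show "(\<lambda>y. Gamma_cov v f (\<lambda>x. g (x - y)) 0) \<in> borel_measurable borel"
    unfolding G0 by measurable
  have inner: "(\<integral>w. dbar f z * dz g w * ?q (z - w) \<partial>lborel) = (\<integral>w. dbar f z * dz g (z - w) * ?q w \<partial>lborel)" for z
  proof -
    have c: "continuous_on UNIV (\<lambda>w. dbar f z * dz g w * ?q (z - w))"
      by (intro continuous_on_mult continuous_on_const cont continuous_on_compose2[OF cont(3)] continuous_intros) simp
    have "has_bochner_integral lborel (\<lambda>w. dbar f z * dz g w * ?q (z - w)) (\<integral>w. dbar f z * dz g w * ?q (z - w) \<partial>lborel)"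
      using compactly_supported_integrable[OF c, of S] S by (simp add: has_bochner_integral_iff)
    from has_bochner_integral_lborel_reflect[OF this, of z]
    show ?thesis by (simp add: has_bochner_integral_iff)
  qed
  have "(\<integral>(z, w). dbar f z * dz g w * ?q (z - w) \<partial>(lborel \<Otimes>\<^sub>M lborel))
     = (\<integral>z. (\<integral>w. dbar f z * dz g w * ?q (z - w) \<partial>lborel) \<partial>lborel)"
    using lborel_pair.integral_fst'[OF i1] by simp
  also have "\<dots> = (\<integral>w. (\<integral>z. dbar f z * dz g (z - w) * ?q w \<partial>lborel) \<partial>lborel)"
    unfolding inner using lborel_pair.Fubini_integral[OF i2] by simp
  also have "\<dots> = (\<integral>w. (\<integral>z. dbar f z * dz g (z - w) \<partial>lborel) * ?q w \<partial>lborel)"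
    by (simp only: integral_mult_left_zero)
  finally show "Gamma_cov v f g \<tau> = (\<integral>y. ?q y * Gamma_cov v f (\<lambda>x. g (x - y)) 0 \<partial>lborel)"
    using r by (simp add: Gamma_cov_pos G0 mult_ac)
qed

text \<open>Integrating by parts in \<open>z\<close> and then in \<open>w\<close> moves both derivatives to \<open>q\<^sub>r(z - w)\<close>. In this form
  the covariance of nonnegative test functions is controlled by the sign and size of the kernel.\<close>

lemma Gamma_cov_eq_log_kernel:
  assumes f: "f \<in> Cc_infty" and g: "g \<in> Cc_infty" and r: "0 < r" "r = \<tau> * (1 - (cmod v)\<^sup>2)"
  shows "Gamma_cov v f g \<tau> = of_real (\<integral>(z, w). f z * g w * log_kernel r (z - w) \<partial>(lborel \<Otimes>\<^sub>M lborel))"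
proof -
  obtain R where R: "\<And>z. R < cmod z \<Longrightarrow> f z = 0" "\<And>z. R < cmod z \<Longrightarrow> complex_of_real (f z) = 0"
    "\<And>z. R < cmod z \<Longrightarrow> dbar f z = 0"
    using Cc_infty_support[OF f] by auto
  obtain S where S: "\<And>z. S < cmod z \<Longrightarrow> g z = 0" "\<And>z. S < cmod z \<Longrightarrow> complex_of_real (g z) = 0"
    "\<And>z. S < cmod z \<Longrightarrow> dz g z = 0"
    using Cc_infty_support[OF g] by auto
  let ?q = "\<lambda>x. complex_of_real (q_kernel r x)" and ?k = "\<lambda>x. complex_of_real (log_kernel r x)"
  note cf = Cc_infty_derivative(3)[OF f] and cg = Cc_infty_derivative(3)[OF g]
  note cq = continuous_on_of_real[OF continuous_on_q_kernel[OF r(1)]]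
    and ck = continuous_on_log_kernel[OF r(1)] and cn = continuous_on_q_gradient[OF r(1)]
  have i1: "integrable (lborel \<Otimes>\<^sub>M lborel) (\<lambda>(z, w). dbar f z * dz g w * ?q (z - w))"
    using integrable_pair_kernel(1)[OF continuous_on_dbar[OF f] continuous_on_dz[OF g] cq R(3) S(3)] .
  have i2: "integrable (lborel \<Otimes>\<^sub>M lborel) (\<lambda>(z, w). of_real (f z) * dz g w * q_gradient r (z - w))"
    using integrable_pair_kernel(1)[OF continuous_on_of_real[OF cf] continuous_on_dz[OF g] cn R(2) S(3)] .
  have i3: "integrable (lborel \<Otimes>\<^sub>M lborel) (\<lambda>(z, w). f z * g w * log_kernel r (z - w))"
    using integrable_pair_kernel(1)[OF cf cg ck R(1) S(1)] .
  have parts1: "(\<integral>z. dbar f z * ?q (z - w) \<partial>lborel) = - (\<integral>z. of_real (f z) * q_gradient r (z - w) \<partial>lborel)" for w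
  proof -
    have eq: "(of_real (- 4 * r * ((z - w) \<bullet> 1) / (pi * (r + (z - w) \<bullet> (z - w)) ^ 3))
       + \<i> * of_real (- 4 * r * ((z - w) \<bullet> \<i>) / (pi * (r + (z - w) \<bullet> (z - w)) ^ 3))) / 2 = q_gradient r (z - w)" for z
      by (simp add: q_gradient_def complex_eq_iff inner_complex_def del: of_real_power of_real_add)
    have "(\<integral>z. dbar f z * ?q (z - w) \<partial>lborel) = - (\<integral>z. of_real (f z) *
      ((of_real (- 4 * r * ((z - w) \<bullet> 1) / (pi * (r + (z - w) \<bullet> (z - w)) ^ 3))
       + \<i> * of_real (- 4 * r * ((z - w) \<bullet> \<i>) / (pi * (r + (z - w) \<bullet> (z - w)) ^ 3))) / 2) \<partial>lborel)"
      by (rule integral_by_parts_wirtinger(1)[OF f has_derivative_q_kernel[OF r(1)]], intro continuous_intros)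
         (use kernel_denominator_pos[OF r(1)] in \<open>auto simp: less_imp_neq[symmetric]\<close>)
    then show ?thesis unfolding eq .
  qed
  have parts2: "(\<integral>w. dz g w * q_gradient r (z - w) \<partial>lborel) = - (\<integral>w. of_real (g w) * (of_real pi * ?k (z - w)) \<partial>lborel)" for z
  proof -
    let ?D = "\<lambda>w. complex_of_real (r + (z - w) \<bullet> (z - w))"
    let ?N = "\<lambda>w d. of_real (2 * r / pi) * (d / of_real ((r + (z - w) \<bullet> (z - w)) ^ 3)
       - (z - w) * of_real (6 * ((z - w) \<bullet> d)) / of_real ((r + (z - w) \<bullet> (z - w)) ^ 4))"
    have nz: "?D w \<noteq> 0" for w
      using kernel_denominator_pos[OF r(1), of "z - w"] by (simp only: of_real_eq_0_iff)
    have eq: "(?N w 1 - \<i> * ?N w \<i>) / 2 = of_real pi * ?k (z - w)" for w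
    proof -
      define x where "x = z - w"
      define D where "D = r + x \<bullet> x"
      have D: "D \<noteq> 0" using kernel_denominator_pos[OF r(1), of x] by (simp add: D_def)
      \<comment> \<open>The inner products with \<open>1\<close> and \<open>\<i>\<close> are the real and imaginary parts, so this is \<open>x\<close> times its conjugate.\<close>
      have xx: "x * of_real (x \<bullet> 1) - \<i> * (x * of_real (x \<bullet> \<i>)) = of_real (x \<bullet> x)"
        by (simp add: complex_eq_iff inner_complex_def)
      have "(?N w 1 - \<i> * ?N w \<i>) / 2 = of_real (2 * r / pi) * (1 / of_real (D ^ 3)
          - 3 * (x * of_real (x \<bullet> 1) - \<i> * (x * of_real (x \<bullet> \<i>))) / of_real (D ^ 4))"
        unfolding x_def[symmetric] D_def[symmetric] using D by (simp add: field_simps)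
      also have "\<dots> = of_real (2 * r / pi * (1 / D ^ 3 - 3 * (x \<bullet> x) / D ^ 4))"
        unfolding xx by simp
      also have "1 / D ^ 3 - 3 * (x \<bullet> x) / D ^ 4 = (r - 2 * (x \<bullet> x)) / D ^ 4"
        using D by (simp add: D_def power_Suc numeral_eq_Suc divide_simps)
      also have "2 * r / pi * ((r - 2 * (x \<bullet> x)) / D ^ 4) = pi * log_kernel r x"
        by (simp add: log_kernel_def D_def power2_eq_square)
      finally show ?thesis by (simp add: x_def)
    qed
    have "(\<integral>w. dz g w * q_gradient r (z - w) \<partial>lborel) = - (\<integral>w. of_real (g w) * ((?N w 1 - \<i> * ?N w \<i>) / 2) \<partial>lborel)"
      by (rule integral_by_parts_wirtinger(2)[OF g has_derivative_q_gradient[OF r(1)]], intro continuous_intros)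
         (use nz in \<open>auto simp only: of_real_power power_eq_0_iff\<close>)
    then show ?thesis unfolding eq .
  qed
  have "(\<integral>(z, w). dbar f z * dz g w * ?q (z - w) \<partial>(lborel \<Otimes>\<^sub>M lborel))
     = (\<integral>w. (\<integral>z. dz g w * (dbar f z * ?q (z - w)) \<partial>lborel) \<partial>lborel)"
    using lborel_pair.integral_snd[OF i1] by (simp add: mult_ac)
  also have "\<dots> = (\<integral>w. - (\<integral>z. of_real (f z) * dz g w * q_gradient r (z - w) \<partial>lborel) \<partial>lborel)"
  proof (rule Bochner_Integration.integral_cong[OF refl])
    fix w
    have "(\<integral>z. dz g w * (dbar f z * ?q (z - w)) \<partial>lborel) = dz g w * (\<integral>z. dbar f z * ?q (z - w) \<partial>lborel)"
      by (rule integral_mult_right_zero)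
    also have "\<dots> = - (\<integral>z. dz g w * (of_real (f z) * q_gradient r (z - w)) \<partial>lborel)"
      unfolding parts1 by simp
    finally show "(\<integral>z. dz g w * (dbar f z * ?q (z - w)) \<partial>lborel) = - (\<integral>z. of_real (f z) * dz g w * q_gradient r (z - w) \<partial>lborel)"
      by (simp add: mult_ac)
  qed
  also have "\<dots> = - (\<integral>z. (\<integral>w. of_real (f z) * (dz g w * q_gradient r (z - w)) \<partial>lborel) \<partial>lborel)"
    using lborel_pair.Fubini_integral[OF i2] by (simp add: mult_ac)
  also have "\<dots> = (\<integral>z. (\<integral>w. of_real pi * of_real (f z * g w * log_kernel r (z - w)) \<partial>lborel) \<partial>lborel)"
    unfolding integral_mult_right_zero parts2 by (simp add: mult_ac flip: integral_mult_right_zero)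
  also have "\<dots> = of_real pi * of_real (\<integral>z. (\<integral>w. f z * g w * log_kernel r (z - w) \<partial>lborel) \<partial>lborel)"
    by (simp only: integral_mult_right_zero integral_complex_of_real)
  also have "(\<integral>z. (\<integral>w. f z * g w * log_kernel r (z - w) \<partial>lborel) \<partial>lborel)
     = (\<integral>(z, w). f z * g w * log_kernel r (z - w) \<partial>(lborel \<Otimes>\<^sub>M lborel))"
    using lborel_pair.integral_fst'[OF i3] by simp
  finally show ?thesis
    using r by (simp add: Gamma_cov_pos)
qed

section \<open>The spatial kernels do not form a semigroup\<close>

lemma log_kernel_bound:
  assumes r: "0 < r"
  shows "\<bar>log_kernel r x\<bar> \<le> 4 / (pi\<^sup>2 * r\<^sup>2)"
proof -
  define D where "D = r + x \<bullet> x"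
  have D: "r \<le> D" "0 < D" using r by (simp_all add: D_def add_pos_nonneg)
  have "\<bar>r - 2 * (x \<bullet> x)\<bar> \<le> 2 * D" using r inner_ge_zero[of x] unfolding D_def by (simp add: abs_le_iff)
  then have "\<bar>r - 2 * (x \<bullet> x)\<bar> / D ^ 4 \<le> 2 * D / D ^ 4"
    using D by (intro divide_right_mono) auto
  also have "\<dots> = 2 / D ^ 3" using D by (simp add: power_Suc numeral_eq_Suc divide_simps)
  also have "\<dots> \<le> 2 / r ^ 3" using D r by (intro divide_left_mono power_mono) auto
  finally have "2 * r / pi\<^sup>2 * (\<bar>r - 2 * (x \<bullet> x)\<bar> / D ^ 4) \<le> 2 * r / pi\<^sup>2 * (2 / r ^ 3)"
    using r by (intro mult_left_mono) auto
  also have "\<dots> = 4 / (pi\<^sup>2 * r\<^sup>2)" using r by (simp add: power_Suc numeral_eq_Suc divide_simps)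
  finally show ?thesis
    using r D by (simp add: log_kernel_def D_def abs_mult)
qed

text \<open>For fixed \<open>x\<close> the kernel is a rational function of \<open>r\<close> whose derivative is bounded below by
  \<open>-4/(\<pi>\<^sup>2 a\<^sup>3)\<close> for \<open>r \<ge> a\<close>, uniformly in \<open>x\<close>.\<close>

lemma log_kernel_time_lower_bound:
  assumes a: "0 < a" and b: "0 \<le> b"
  shows "log_kernel a x - 4 / (pi\<^sup>2 * a ^ 3) * b \<le> log_kernel (a + b) x"
proof (cases "b = 0")
  case False
  define \<rho> where "\<rho> = x \<bullet> x"
  have \<rho>: "0 \<le> \<rho>" by (simp add: \<rho>_def)
  let ?k = "\<lambda>r. 2 * r / pi\<^sup>2 * (r - 2 * \<rho>) / (r + \<rho>) ^ 4"
  let ?k' = "\<lambda>r. 2 / pi\<^sup>2 * ((- 2 * r\<^sup>2 + 8 * \<rho> * r - 2 * \<rho>\<^sup>2) / (r + \<rho>) ^ 5)"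
  have deriv: "(?k has_real_derivative ?k' r) (at r)" if r: "a \<le> r" for r
  proof -
    define D where "D = r + \<rho>"
    have D: "0 < D" using r a \<rho> by (simp add: D_def)
    have "((\<lambda>r. 2 / pi\<^sup>2 * ((r * (r - 2 * \<rho>)) / (r + \<rho>) ^ 4)) has_real_derivative
       2 / pi\<^sup>2 * (((2 * r - 2 * \<rho>) * D ^ 4 - (r * (r - 2 * \<rho>)) * (4 * D ^ 3)) / (D ^ 4 * D ^ 4))) (at r)"
      using D unfolding D_def by (intro DERIV_cmult) (auto intro!: derivative_eq_intros)
    also have "((2 * r - 2 * \<rho>) * D ^ 4 - (r * (r - 2 * \<rho>)) * (4 * D ^ 3)) / (D ^ 4 * D ^ 4)
       = ((2 * r - 2 * \<rho>) * D - 4 * (r * (r - 2 * \<rho>))) / D ^ 5"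
      using D by (simp add: power_Suc numeral_eq_Suc divide_simps) (simp add: algebra_simps)
    also have "(2 * r - 2 * \<rho>) * D - 4 * (r * (r - 2 * \<rho>)) = - 2 * r\<^sup>2 + 8 * \<rho> * r - 2 * \<rho>\<^sup>2"
      by (simp add: D_def algebra_simps power2_eq_square)
    finally show ?thesis by (simp add: D_def mult.assoc)
  qed
  obtain r where r: "a < r" "r < a + b" "?k (a + b) - ?k a = (a + b - a) * ?k' r"
    using MVT2[of a "a + b" ?k ?k'] deriv False b by auto
  define D where "D = r + \<rho>"
  have D: "a \<le> D" "0 < D" using r a \<rho> by (simp_all add: D_def)
  have "- (2 / a ^ 3) \<le> - (2 / D ^ 3)" using D a by (simp add: frac_le power_mono)
  also have "\<dots> = - 2 * D\<^sup>2 / D ^ 5" using D by (simp add: power_Suc numeral_eq_Suc divide_simps)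
  also have "\<dots> \<le> (- 2 * r\<^sup>2 + 8 * \<rho> * r - 2 * \<rho>\<^sup>2) / D ^ 5"
    using D r a \<rho> by (intro divide_right_mono) (auto simp: D_def power2_eq_square algebra_simps)
  finally have "2 / pi\<^sup>2 * (- (2 / a ^ 3)) \<le> ?k' r"
    unfolding D_def by (intro mult_left_mono) auto
  then have "b * (2 / pi\<^sup>2 * (- (2 / a ^ 3))) \<le> b * ?k' r"
    using b by (rule mult_left_mono)
  then show ?thesis
    using r(3) by (simp add: log_kernel_def \<rho>_def mult_ac)
qed simp

text \<open>As a function \<open>h\<close> of \<open>s = |x|\<^sup>2\<close> the kernel is decreasing near \<open>0\<close> with bounded second derivative.
  Moving \<open>x\<close> by \<open>\<plusminus>y\<close> changes \<open>s\<close> by \<open>|y|\<^sup>2 \<plusminus> 2(x,y)\<close>: the linear terms in \<open>(x,y)\<close> cancel, the term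
  \<open>2 h'(s)|y|\<^sup>2\<close> is negative, and the quadratic error is small compared with it when \<open>x\<close> and \<open>y\<close> are.\<close>

lemma log_kernel_second_difference:
  assumes a: "0 < a"
  shows "\<exists>m>0. \<exists>e>0. \<forall>x y. (cmod x)\<^sup>2 \<le> e \<longrightarrow> (cmod y)\<^sup>2 \<le> e \<longrightarrow>
    log_kernel a (x - y) + log_kernel a (x + y) - 2 * log_kernel a x \<le> - m * (cmod y)\<^sup>2"
proof -
  define c where "c = 2 * a / pi\<^sup>2"
  have c: "0 < c" using a by (simp add: c_def)
  define M where "M = 36 * c / a ^ 5"
  define h where "h s = c * ((a - 2 * s) / (a + s) ^ 4)" for s
  define h' where "h' s = - (6 * c * ((a - s) / (a + s) ^ 5))" for s
  define h'' where "h'' s = 12 * c * ((3 * a - 2 * s) / (a + s) ^ 6)" for s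
  have K: "log_kernel a x = h (x \<bullet> x)" for x by (simp add: log_kernel_def h_def c_def)
  have dh: "(h has_real_derivative h' s) (at s)" and dh': "(h' has_real_derivative h'' s) (at s)" if "0 \<le> s" for s
  proof -
    define D where "D = a + s"
    have D: "0 < D" using that a by (simp add: D_def)
    have "(h has_real_derivative c * (((- 2) * D ^ 4 - (a - 2 * s) * (4 * D ^ 3)) / (D ^ 4 * D ^ 4))) (at s)"
      using D unfolding D_def h_def[abs_def] by (intro DERIV_cmult) (auto intro!: derivative_eq_intros)
    also have "((- 2) * D ^ 4 - (a - 2 * s) * (4 * D ^ 3)) / (D ^ 4 * D ^ 4) = ((- 2) * D - (a - 2 * s) * 4) / D ^ 5"
      using D by (simp add: power_Suc numeral_eq_Suc divide_simps) (simp add: algebra_simps)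
    also have "(- 2) * D - (a - 2 * s) * 4 = - (6 * (a - s))" by (simp add: D_def)
    also have "c * (- (6 * (a - s)) / D ^ 5) = h' s" by (simp add: h'_def D_def diff_divide_distrib algebra_simps)
    finally show "(h has_real_derivative h' s) (at s)" .
    have "(h' has_real_derivative - (6 * c * (((- 1) * D ^ 5 - (a - s) * (5 * D ^ 4)) / (D ^ 5 * D ^ 5)))) (at s)"
      using D unfolding D_def h'_def[abs_def] by (intro DERIV_minus DERIV_cmult) (auto intro!: derivative_eq_intros)
    also have "((- 1) * D ^ 5 - (a - s) * (5 * D ^ 4)) / (D ^ 5 * D ^ 5) = ((- 1) * D - (a - s) * 5) / D ^ 6"
      using D by (simp add: power_Suc numeral_eq_Suc divide_simps) (simp add: algebra_simps)
    also have "(- 1) * D - (a - s) * 5 = - (2 * (3 * a - 2 * s))" by (simp add: D_def)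
    also have "- (6 * c * (- (2 * (3 * a - 2 * s)) / D ^ 6)) = h'' s" by (simp add: h''_def D_def diff_divide_distrib algebra_simps)
    finally show "(h' has_real_derivative h'' s) (at s)" .
  qed
  have h''M: "h'' s \<le> M" if "0 \<le> s" for s
  proof -
    have "(3 * a - 2 * s) / (a + s) ^ 6 \<le> 3 * a / a ^ 6"
      using that a by (intro frac_le power_mono) auto
    also have "\<dots> = 3 / a ^ 5" using a by (simp add: power_Suc numeral_eq_Suc divide_simps)
    finally have "12 * c * ((3 * a - 2 * s) / (a + s) ^ 6) \<le> 12 * c * (3 / a ^ 5)"
      using c by (intro mult_left_mono) auto
    then show ?thesis by (simp add: h''_def M_def)
  qed
  \<comment> \<open>The function \<open>M s\<^sup>2/2 - h s\<close> is convex on the half-line, so it lies above its tangents.\<close>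
  have taylor: "h t \<le> h s + h' s * (t - s) + M / 2 * (t - s)\<^sup>2" if "0 \<le> s" "0 \<le> t" for s t
  proof -
    have "(M * s - h' s) * (t - s) \<le> (M / 2 * t\<^sup>2 - h t) - (M / 2 * s\<^sup>2 - h s)"
    proof (rule f''_imp_f'[of "{0..}" "\<lambda>s. M / 2 * s\<^sup>2 - h s" "\<lambda>s. M * s - h' s" "\<lambda>s. M - h'' s"])
      show "DERIV (\<lambda>s. M / 2 * s\<^sup>2 - h s) s :> M * s - h' s" if "s \<in> {0..}" for s
        using dh[of s] that by (auto intro!: derivative_eq_intros)
      show "DERIV (\<lambda>s. M * s - h' s) s :> M - h'' s" if "s \<in> {0..}" for s
        using dh'[of s] that by (auto intro!: derivative_eq_intros)
    qed (use that h''M in auto)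
    moreover have "M / 2 * t\<^sup>2 - M / 2 * s\<^sup>2 - M * s * (t - s) = M / 2 * (t - s)\<^sup>2"
      by (simp add: power2_eq_square algebra_simps add_divide_distrib[symmetric]) 
    ultimately show ?thesis by (simp add: algebra_simps)
  qed
  have h'_neg: "h' s \<le> - (c / (3 * a ^ 4))" if "0 \<le> s" "s \<le> a / 2" for s
  proof -
    have "1 / (18 * a ^ 4) \<le> a / 2 / (3 / 2 * a) ^ 5"
      using a by (simp add: power_mult_distrib power_divide power_Suc numeral_eq_Suc divide_simps)
    also have "\<dots> \<le> (a - s) / (a + s) ^ 5"
      using that a by (intro frac_le power_mono) auto
    finally have "6 * c * (1 / (18 * a ^ 4)) \<le> 6 * c * ((a - s) / (a + s) ^ 5)"
      using c by (intro mult_left_mono) auto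
    then show ?thesis by (simp add: h'_def)
  qed
  have "log_kernel a (x - y) + log_kernel a (x + y) - 2 * log_kernel a x \<le> - (c / (3 * a ^ 4)) * (cmod y)\<^sup>2"
    \<comment> \<open>With radius \<open>e\<close> the error is at most \<open>5 M e |y|\<^sup>2\<close>; \<open>e = a/540\<close> makes it half of the main term.\<close>
    if x: "(cmod x)\<^sup>2 \<le> a / 540" and y: "(cmod y)\<^sup>2 \<le> a / 540" for x y :: complex
  proof -
    define s where "s = x \<bullet> x"
    define n where "n = y \<bullet> y"
    define p where "p = x \<bullet> y"
    have s: "0 \<le> s" "s \<le> a / 540" and n: "0 \<le> n" "n \<le> a / 540"
      using x y by (simp_all add: s_def n_def power2_norm_eq_inner)
    have p: "p\<^sup>2 \<le> s * n" unfolding p_def s_def n_def by (rule Cauchy_Schwarz_ineq)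
    have m: "(x - y) \<bullet> (x - y) = s + (n - 2 * p)" and pl: "(x + y) \<bullet> (x + y) = s + (n + 2 * p)"
      by (simp_all add: s_def n_def p_def inner_simps inner_commute)
    have "0 \<le> s + (n - 2 * p)" "0 \<le> s + (n + 2 * p)"
      using inner_ge_zero[of "x - y"] inner_ge_zero[of "x + y"] unfolding m pl .
    from taylor[OF s(1) this(1)] taylor[OF s(1) this(2)]
    have "h (s + (n - 2 * p)) + h (s + (n + 2 * p)) - 2 * h s
        \<le> 2 * h' s * n + M / 2 * ((n - 2 * p)\<^sup>2 + (n + 2 * p)\<^sup>2)"
      by (simp add: algebra_simps)
    also have "(n - 2 * p)\<^sup>2 + (n + 2 * p)\<^sup>2 = 2 * n\<^sup>2 + 8 * p\<^sup>2"
      by (simp add: power2_eq_square algebra_simps)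
    also have "2 * h' s * n + M / 2 * (2 * n\<^sup>2 + 8 * p\<^sup>2) \<le> 2 * (- (c / (3 * a ^ 4))) * n + M / 2 * (10 * (a / 540) * n)"
    proof (intro add_mono mult_left_mono mult_right_mono)
      show "h' s \<le> - (c / (3 * a ^ 4))" using h'_neg s a by simp
      have "n * n \<le> a / 540 * n" "s * n \<le> a / 540 * n" using mult_right_mono[OF n(2) n(1)] mult_right_mono[OF s(2) n(1)] by simp_all
      then show "2 * n\<^sup>2 + 8 * p\<^sup>2 \<le> 10 * (a / 540) * n" using p by (simp add: power2_eq_square)
    qed (use n c a in \<open>auto simp: M_def\<close>)
    also have "M / 2 * (10 * (a / 540) * n) = c / (3 * a ^ 4) * n"
      using a by (simp add: M_def power_Suc numeral_eq_Suc divide_simps)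
    finally show ?thesis
      unfolding K m pl s_def[symmetric] power2_norm_eq_inner n_def[symmetric] by simp
  qed
  moreover have "0 < c / (3 * a ^ 4)" "0 < a / 540" using a c by auto
  ultimately show ?thesis by blast
qed

text \<open>By \<open>Gamma_cov_eq_log_kernel\<close> this is the covariance at the lag \<open>\<tau>\<close> with \<open>r = \<tau>(1 - |v|\<^sup>2)\<close>.\<close>

definition log_energy :: "real \<Rightarrow> (complex \<Rightarrow> real) \<Rightarrow> (complex \<Rightarrow> real) \<Rightarrow> real" where
  "log_energy r f g = (\<integral>(z, w). f z * g w * log_kernel r (z - w) \<partial>(lborel \<Otimes>\<^sub>M lborel))"

lemma integrable_log_energy:
  assumes f: "f \<in> Cc_infty" and g: "g \<in> Cc_infty" and r: "0 < r"
  shows "integrable (lborel \<Otimes>\<^sub>M lborel) (\<lambda>(z, w). f z * g w * log_kernel r (z - w - y))"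
proof -
  obtain R where R: "\<And>z. R < cmod z \<Longrightarrow> f z = 0" using Cc_infty_support[OF f] by auto
  obtain S where S: "\<And>z. S < cmod z \<Longrightarrow> g z = 0" using Cc_infty_support[OF g] by auto
  have "continuous_on UNIV (\<lambda>x. log_kernel r (x - y))"
    by (intro continuous_on_compose2[OF continuous_on_log_kernel[OF r]] continuous_intros) simp
  from integrable_pair_kernel(1)[OF Cc_infty_derivative(3)[OF f] Cc_infty_derivative(3)[OF g] this R S]
  show ?thesis .
qed

lemma log_energy_shift:
  assumes f: "f \<in> Cc_infty" and g: "g \<in> Cc_infty" and r: "0 < r"
  shows "log_energy r f (\<lambda>x. g (x - y)) = (\<integral>(z, w). f z * g w * log_kernel r (z - w - y) \<partial>(lborel \<Otimes>\<^sub>M lborel))"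
proof -
  have inner: "(\<integral>w. f z * g (w - y) * log_kernel r (z - w) \<partial>lborel) = (\<integral>w. f z * g w * log_kernel r (z - w - y) \<partial>lborel)" for z
  proof -
    obtain S where S: "\<And>z. S < cmod z \<Longrightarrow> g z = 0" using Cc_infty_support[OF g] by auto
    have c: "continuous_on UNIV (\<lambda>w. f z * g w * log_kernel r (z - w - y))"
      by (intro continuous_on_mult continuous_on_const Cc_infty_derivative g
          continuous_on_compose2[OF continuous_on_log_kernel[OF r]] continuous_intros) simp
    have "has_bochner_integral lborel (\<lambda>w. f z * g w * log_kernel r (z - w - y)) (\<integral>w. f z * g w * log_kernel r (z - w - y) \<partial>lborel)"
      using compactly_supported_integrable[OF c, of S] S by (simp add: has_bochner_integral_iff)
    from has_bochner_integral_lborel_translate[OF this, of "- y"] show ?thesis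
      by (simp add: has_bochner_integral_iff)
  qed
  have "log_energy r f (\<lambda>x. g (x - y)) = (\<integral>z. (\<integral>w. f z * g (w - y) * log_kernel r (z - w) \<partial>lborel) \<partial>lborel)"
    using lborel_pair.integral_fst'[OF integrable_log_energy[OF f Cc_infty_shift[OF g] r, of _ 0]]
    by (simp add: log_energy_def)
  also have "\<dots> = (\<integral>(z, w). f z * g w * log_kernel r (z - w - y) \<partial>(lborel \<Otimes>\<^sub>M lborel))"
    unfolding inner using lborel_pair.integral_fst'[OF integrable_log_energy[OF f g r]] by simp
  finally show ?thesis .
qed

text \<open>For a bump function \<open>f\<close> of small support the function \<open>\<psi>(y)\<close> = \<open>log_energy a f (T\<^sub>y f)\<close> inherits
  the negative second differences of the kernel, so its average over \<open>q\<^sub>b\<close> falls below \<open>\<psi>(0)\<close> by more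
  than any multiple of \<open>b\<close>, whereas \<open>log_energy (a + b) f f\<close> falls below it by at most a multiple of \<open>b\<close>.\<close>

lemma log_energy_not_semigroup:
  assumes a: "0 < a"
  shows "\<exists>f\<in>Cc_infty. \<exists>b0>0. \<forall>b. 0 < b \<and> b < b0 \<longrightarrow>
    (\<integral>y. q_kernel b y * log_energy a f (\<lambda>x. f (x - y)) \<partial>lborel) < log_energy (a + b) f f"
proof -
  obtain m e where m: "0 < m" and e: "0 < e" and diff: "\<And>x y. (cmod x)\<^sup>2 \<le> e \<Longrightarrow> (cmod y)\<^sup>2 \<le> e \<Longrightarrow>
    log_kernel a (x - y) + log_kernel a (x + y) - 2 * log_kernel a x \<le> - m * (cmod y)\<^sup>2"
    using log_kernel_second_difference[OF a] by blast
  \<comment> \<open>Two points of the support have distance at most \<open>\<surd>e\<close>.\<close>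
  define f where "f = bump (e / 4)"
  have f: "f \<in> Cc_infty" by (simp add: f_def bump_in_Cc_infty)
  have f_nonneg: "0 \<le> f z" for z by (simp add: f_def bump_nonneg)
  have f_supp: "cmod z < sqrt e / 2" if "f z \<noteq> 0" for z
  proof -
    have "(cmod z)\<^sup>2 < e / 4" using that bump_eq_0[of "e / 4" z] by (force simp: f_def)
    then have "cmod z < sqrt (e / 4)" by (simp add: real_less_rsqrt)
    then show ?thesis by (simp add: real_sqrt_divide)
  qed
  have cf: "continuous_on UNIV f" by (rule Cc_infty_derivative[OF f])
  have [measurable]: "f \<in> borel_measurable borel" using cf by (rule borel_measurable_continuous_onI)
  have [measurable]: "log_kernel a \<in> borel_measurable borel"
    using continuous_on_log_kernel[OF a] by (rule borel_measurable_continuous_onI)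
  have f_int: "integrable lborel f"
    using f_supp by (intro compactly_supported_integrable[OF cf, of "sqrt e / 2"]) force
  define A where "A = (\<integral>(z, w). f z * f w \<partial>(lborel \<Otimes>\<^sub>M lborel))"
  have f0: "\<And>z. sqrt e / 2 < cmod z \<Longrightarrow> f z = 0" using f_supp by force
  have intA: "integrable (lborel \<Otimes>\<^sub>M lborel) (\<lambda>(z, w). f z * f w)"
  proof -
    have "integrable (lborel \<Otimes>\<^sub>M lborel) (\<lambda>(z, w). f z * f w * 1)"
      by (rule integrable_pair_kernel(1)[OF cf cf continuous_on_const f0 f0])
    then show ?thesis by simp
  qed
  have A0: "0 < A"
  proof -
    have "0 < integral\<^sup>L lborel f"
    proof -
      have "(\<integral>z. exp (- 8 / e) * indicator (ball (0::complex) (sqrt (e / 8))) z \<partial>lborel) \<le> integral\<^sup>L lborel f"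
      proof (rule integral_mono[OF _ f_int])
        show "integrable lborel (\<lambda>z. exp (- 8 / e) * indicator (ball (0::complex) (sqrt (e / 8))) z)"
          using emeasure_lborel_ball_finite by (intro integrable_mult_right integrable_real_indicator) (auto simp: infinity_ennreal_def)
        fix z
        show "exp (- 8 / e) * indicator (ball (0::complex) (sqrt (e / 8))) z \<le> f z"
        proof (cases "z \<in> ball 0 (sqrt (e / 8))")
          case True
          then have "(cmod z)\<^sup>2 < (sqrt (e / 8))\<^sup>2" by (intro power_strict_mono) auto
          then have z: "z \<bullet> z < e / 8" using e by (simp add: power2_norm_eq_inner)
          then have "e / 8 \<le> e / 4 - z \<bullet> z" by simp
          then have "exp (- 8 / e) \<le> exp (- 1 / (e / 4 - z \<bullet> z))"
            using e by (simp add: divide_simps)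
          then show ?thesis using True z e by (simp add: f_def bump_def flat_exp_def)
        qed (simp add: f_nonneg)
      qed
      moreover have "(\<integral>z. exp (- 8 / e) * indicator (ball (0::complex) (sqrt (e / 8))) z \<partial>lborel)
          = exp (- 8 / e) * measure lborel (ball (0::complex) (sqrt (e / 8)))"
        by simp
      moreover have "0 < exp (- 8 / e) * measure lborel (ball (0::complex) (sqrt (e / 8)))"
        using e by (intro mult_pos_pos content_ball_gt_0_iff[THEN iffD2]) auto
      ultimately show ?thesis by linarith
    qed
    moreover have "A = integral\<^sup>L lborel f * integral\<^sup>L lborel f"
      using lborel_pair.integral_fst'[OF intA] by (simp add: A_def)
    ultimately show ?thesis by simp
  qed
  let ?P = "lborel \<Otimes>\<^sub>M lborel :: (complex \<times> complex) measure"
  define \<psi> where "\<psi> y = (\<integral>(z, w). f z * f w * log_kernel a (z - w - y) \<partial>?P)" for y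
  note int\<psi> = integrable_log_energy[OF f f a]
  define B where "B = 4 / (pi\<^sup>2 * a\<^sup>2)"
  have "\<exists>b0>0. \<forall>b. 0 < b \<and> b < b0 \<longrightarrow> (\<integral>y. q_kernel b y * \<psi> y \<partial>lborel) \<le> \<psi> 0 - (4 / (pi\<^sup>2 * a ^ 3) * A + 1) * b"
  proof (rule q_kernel_average_log_defect)
    show "\<psi> \<in> borel_measurable borel"
      unfolding \<psi>_def by measurable
    show "\<bar>\<psi> y\<bar> \<le> B * A" for y
    proof -
      have "\<bar>\<psi> y\<bar> \<le> (\<integral>p. \<bar>case p of (z, w) \<Rightarrow> f z * f w * log_kernel a (z - w - y)\<bar> \<partial>?P)"
        unfolding \<psi>_def by (rule integral_abs_bound)
      also have "\<dots> \<le> (\<integral>p. B * (case p of (z, w) \<Rightarrow> f z * f w) \<partial>?P)"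
      proof (rule integral_mono)
        show "integrable ?P (\<lambda>p. \<bar>case p of (z, w) \<Rightarrow> f z * f w * log_kernel a (z - w - y)\<bar>)"
          using int\<psi> by (rule integrable_abs)
        show "integrable ?P (\<lambda>p. B * (case p of (z, w) \<Rightarrow> f z * f w))"
          using intA by (rule integrable_mult_right)
        fix p :: "complex \<times> complex"
        obtain z w where p: "p = (z, w)" by (cases p)
        have "f z * f w * \<bar>log_kernel a (z - w - y)\<bar> \<le> f z * f w * B"
          unfolding B_def by (intro mult_left_mono log_kernel_bound a) (simp add: f_nonneg)
        then show "\<bar>case p of (z, w) \<Rightarrow> f z * f w * log_kernel a (z - w - y)\<bar> \<le> B * (case p of (z, w) \<Rightarrow> f z * f w)"
          unfolding p by (simp add: abs_mult f_nonneg mult_ac)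
      qed
      finally show ?thesis by (simp add: A_def)
    qed
    show "0 < m * A" using m A0 by simp
    show "0 < e" by fact
    show "\<psi> y + \<psi> (- y) - 2 * \<psi> 0 \<le> - (m * A) * (cmod y)\<^sup>2" if y: "(cmod y)\<^sup>2 \<le> e" for y
    proof -
      let ?f = "\<lambda>y (z, w). f z * f w * log_kernel a (z - w - y)"
      have "\<psi> y + \<psi> (- y) - 2 * \<psi> 0 = (\<integral>p. ?f y p + ?f (- y) p - 2 * ?f 0 p \<partial>?P)"
        unfolding \<psi>_def using int\<psi>[of y] int\<psi>[of "- y"] int\<psi>[of 0] by simp
      also have "\<dots> \<le> (\<integral>p. (- (m * (cmod y)\<^sup>2)) * (case p of (z, w) \<Rightarrow> f z * f w) \<partial>?P)"
      proof (rule integral_mono)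
        show "integrable ?P (\<lambda>p. ?f y p + ?f (- y) p - 2 * ?f 0 p)"
          using int\<psi> by (intro Bochner_Integration.integrable_diff Bochner_Integration.integrable_add integrable_mult_right)
        show "integrable ?P (\<lambda>p. (- (m * (cmod y)\<^sup>2)) * (case p of (z, w) \<Rightarrow> f z * f w))"
          using intA by (rule integrable_mult_right)
        fix p :: "complex \<times> complex"
        obtain z w where p: "p = (z, w)" by (cases p)
        have "f z * f w * (log_kernel a (z - w - y) + log_kernel a (z - w + y) - 2 * log_kernel a (z - w))
          \<le> f z * f w * (- m * (cmod y)\<^sup>2)"
        proof (cases "f z = 0 \<or> f w = 0")
          case False
          then have "cmod (z - w) < sqrt e"
            using f_supp[of z] f_supp[of w] norm_triangle_ineq4[of z w] by simp
          then have "(cmod (z - w))\<^sup>2 \<le> (sqrt e)\<^sup>2" by (intro power_mono) auto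
          then have "(cmod (z - w))\<^sup>2 \<le> e" using e by simp
          from diff[OF this y] show ?thesis
            by (intro mult_left_mono) (simp_all add: f_nonneg)
        qed auto
        then show "?f y p + ?f (- y) p - 2 * ?f 0 p \<le> (- (m * (cmod y)\<^sup>2)) * (case p of (z, w) \<Rightarrow> f z * f w)"
          unfolding p by (simp add: algebra_simps)
      qed
      also have "\<dots> = - (m * A) * (cmod y)\<^sup>2"
        unfolding A_def by simp
      finally show ?thesis .
    qed
  qed
  then obtain b0 where b0: "0 < b0" "\<And>b. 0 < b \<Longrightarrow> b < b0 \<Longrightarrow>
      (\<integral>y. q_kernel b y * \<psi> y \<partial>lborel) \<le> \<psi> 0 - (4 / (pi\<^sup>2 * a ^ 3) * A + 1) * b" by blast
  have "(\<integral>y. q_kernel b y * log_energy a f (\<lambda>x. f (x - y)) \<partial>lborel) < log_energy (a + b) f f"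
    if b: "0 < b" "b < b0" for b
  proof -
    have "(\<integral>y. q_kernel b y * log_energy a f (\<lambda>x. f (x - y)) \<partial>lborel) = (\<integral>y. q_kernel b y * \<psi> y \<partial>lborel)"
      unfolding \<psi>_def log_energy_shift[OF f f a] ..
    also have "\<dots> \<le> \<psi> 0 - (4 / (pi\<^sup>2 * a ^ 3) * A + 1) * b" by (rule b0(2)[OF b])
    also have "\<dots> < \<psi> 0 - 4 / (pi\<^sup>2 * a ^ 3) * b * A"
      using b by (simp add: algebra_simps)
    also have "\<dots> = (\<integral>p. (case p of (z, w) \<Rightarrow> f z * f w * log_kernel a (z - w - 0))
        - 4 / (pi\<^sup>2 * a ^ 3) * b * (case p of (z, w) \<Rightarrow> f z * f w) \<partial>?P)"
      unfolding \<psi>_def A_def using int\<psi>[of 0] intA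
      by (subst Bochner_Integration.integral_diff) auto
    also have "\<dots> \<le> log_energy (a + b) f f"
      unfolding log_energy_def
    proof (rule integral_mono)
      show "integrable ?P (\<lambda>p. (case p of (z, w) \<Rightarrow> f z * f w * log_kernel a (z - w - 0))
        - 4 / (pi\<^sup>2 * a ^ 3) * b * (case p of (z, w) \<Rightarrow> f z * f w))"
        using int\<psi>[of 0] intA by (intro Bochner_Integration.integrable_diff integrable_mult_right)
      show "integrable ?P (\<lambda>(z, w). f z * f w * log_kernel (a + b) (z - w))"
        using integrable_log_energy[OF f f, of "a + b" 0] a b by simp
      fix p :: "complex \<times> complex"
      obtain z w where p: "p = (z, w)" by (cases p)
      have "f z * f w * (log_kernel a (z - w) - 4 / (pi\<^sup>2 * a ^ 3) * b) \<le> f z * f w * log_kernel (a + b) (z - w)"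
        using log_kernel_time_lower_bound[OF a, of b] b f_nonneg by (intro mult_left_mono) auto
      then show "(case p of (z, w) \<Rightarrow> f z * f w * log_kernel a (z - w - 0))
        - 4 / (pi\<^sup>2 * a ^ 3) * b * (case p of (z, w) \<Rightarrow> f z * f w)
        \<le> (case p of (z, w) \<Rightarrow> f z * f w * log_kernel (a + b) (z - w))"
        unfolding p by (simp add: algebra_simps)
    qed
    finally show ?thesis .
  qed
  with f b0(1) show ?thesis by blast
qed

section \<open>Square-integrable and centered Gaussian random variables\<close>

lemma integrable_mult_squares:
  fixes f g :: "'w \<Rightarrow> real"
  assumes [measurable]: "f \<in> borel_measurable M" "g \<in> borel_measurable M"
    and "integrable M (\<lambda>x. (f x)\<^sup>2)" "integrable M (\<lambda>x. (g x)\<^sup>2)"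
  shows "integrable M (\<lambda>x. f x * g x)"
proof (rule Bochner_Integration.integrable_bound)
  show "integrable M (\<lambda>x. (f x)\<^sup>2 + (g x)\<^sup>2)" using assms by simp
  have "\<bar>f x\<bar> * \<bar>g x\<bar> \<le> (f x)\<^sup>2 + (g x)\<^sup>2" for x
  proof -
    have "0 \<le> (\<bar>f x\<bar> - \<bar>g x\<bar>)\<^sup>2" by simp
    then have "2 * (\<bar>f x\<bar> * \<bar>g x\<bar>) \<le> (f x)\<^sup>2 + (g x)\<^sup>2" by (simp add: power2_diff)
    then show ?thesis using mult_nonneg_nonneg[of "\<bar>f x\<bar>" "\<bar>g x\<bar>"] by linarith
  qed
  then show "AE x in M. norm (f x * g x) \<le> norm ((f x)\<^sup>2 + (g x)\<^sup>2)"
    by (intro AE_I2) (simp add: abs_mult)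
qed measurable

lemma Cauchy_Schwarz_integral:
  fixes f g :: "'w \<Rightarrow> real"
  assumes [measurable]: "f \<in> borel_measurable M" "g \<in> borel_measurable M"
    and f: "integrable M (\<lambda>x. (f x)\<^sup>2)" and g: "integrable M (\<lambda>x. (g x)\<^sup>2)"
  shows "(\<integral>x. f x * g x \<partial>M)\<^sup>2 \<le> (\<integral>x. (f x)\<^sup>2 \<partial>M) * (\<integral>x. (g x)\<^sup>2 \<partial>M)"
proof -
  define a b c where "a = (\<integral>x. (f x)\<^sup>2 \<partial>M)" and "b = (\<integral>x. (g x)\<^sup>2 \<partial>M)" and "c = (\<integral>x. f x * g x \<partial>M)"
  note fg = integrable_mult_squares[OF assms]
  have quad: "0 \<le> a - 2 * t * c + t\<^sup>2 * b" for t
  proof -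
    have "0 \<le> (\<integral>x. (f x - t * g x)\<^sup>2 \<partial>M)" by simp
    also have "\<dots> = (\<integral>x. (f x)\<^sup>2 - (2 * t) * (f x * g x) + t\<^sup>2 * (g x)\<^sup>2 \<partial>M)"
      by (simp add: power2_diff power_mult_distrib algebra_simps)
    also have "\<dots> = a - 2 * t * c + t\<^sup>2 * b"
      using f g fg by (simp add: a_def b_def c_def)
    finally show ?thesis .
  qed
  have "c\<^sup>2 \<le> a * b"
  proof (cases "b = 0")
    case True
    have "c = 0"
    proof (rule ccontr)
      assume "c \<noteq> 0"
      then show False using quad[of "(a + 1) / (2 * c)"] True by simp
    qed
    then show ?thesis using True by simp
  next
    case False
    have b: "0 < b" using False by (simp add: b_def less_le)
    have "0 \<le> (a - 2 * (c / b) * c + (c / b)\<^sup>2 * b) * b"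
      using quad[of "c / b"] b by (intro mult_nonneg_nonneg) (simp_all only: less_imp_le)
    also have "\<dots> = a * b - c\<^sup>2" using b by (simp add: field_simps power2_eq_square)
    finally show ?thesis by simp
  qed
  then show ?thesis by (simp add: a_def b_def c_def)
qed

text \<open>A finite signed measure with vanishing Fourier transform is zero. The positive and negative parts
  of \<open>U\<close> have the same integral (frequency \<open>0\<close>); after normalisation they become probability densities
  under which \<open>X\<close> has equal characteristic functions, so the uniqueness theorem applies.\<close>

lemma (in prob_space) integral_indicator_eq_0_of_char_eq_0_real:
  fixes U X :: "'a \<Rightarrow> real"
  assumes U: "integrable M U" and X[measurable]: "X \<in> borel_measurable M"
    and char0: "\<And>\<theta>. (\<integral>x. of_real (U x) * iexp (\<theta> * X x) \<partial>M) = 0"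
    and B[measurable]: "B \<in> sets borel"
  shows "(\<integral>x. U x * indicator B (X x) \<partial>M) = 0"
proof -
  have Um[measurable]: "U \<in> borel_measurable M" using U by simp
  \<comment> \<open>For \<open>s = 1\<close> and \<open>s = -1\<close> this is the positive and the negative part.\<close>
  define p where "p = (\<lambda>(s::real) x. max 0 (s * U x))"
  have [measurable]: "p s \<in> borel_measurable M" for s unfolding p_def by measurable
  have p_nonneg: "0 \<le> p s x" for s x by (simp add: p_def)
  have p_int: "integrable M (p s)" for s
    unfolding p_def using U by (intro integrable_max) auto
  have p_diff: "p 1 x - p (-1) x = U x" for x by (simp add: p_def max_def)
  have pe: "integrable M (\<lambda>x. of_real (p s x) * iexp (\<theta> * X x))" for s \<theta>
    by (rule Bochner_Integration.integrable_bound[OF p_int[of s]]) (auto simp: norm_mult)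
  have pe_eq: "(\<integral>x. of_real (p 1 x) * iexp (\<theta> * X x) \<partial>M) = (\<integral>x. of_real (p (-1) x) * iexp (\<theta> * X x) \<partial>M)" for \<theta>
  proof -
    have "(\<integral>x. of_real (p 1 x) * iexp (\<theta> * X x) \<partial>M) - (\<integral>x. of_real (p (-1) x) * iexp (\<theta> * X x) \<partial>M)
       = (\<integral>x. of_real (U x) * iexp (\<theta> * X x) \<partial>M)"
      unfolding Bochner_Integration.integral_diff[OF pe pe, symmetric] p_diff[symmetric]
      by (simp add: left_diff_distrib)
    then show ?thesis using char0 by simp
  qed
  define c where "c = (\<integral>x. p 1 x \<partial>M)"
  have c: "(\<integral>x. p s x \<partial>M) = c" if "s = 1 \<or> s = -1" for s
    using that pe_eq[of 0] by (auto simp: c_def integral_complex_of_real)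
  have pB: "integrable M (\<lambda>x. p s x * indicator B (X x))" for s
    by (rule Bochner_Integration.integrable_bound[OF p_int[of s]]) (auto simp: indicator_def)
  have key: "(\<integral>x. p 1 x * indicator B (X x) \<partial>M) = (\<integral>x. p (-1) x * indicator B (X x) \<partial>M)"
  proof (cases "c = 0")
    case True
    have "(\<integral>x. p s x * indicator B (X x) \<partial>M) = 0" if "s = 1 \<or> s = -1" for s
    proof -
      have "AE x in M. p s x = 0"
        using c[OF that] True integral_nonneg_eq_0_iff_AE[OF p_int[of s]] p_nonneg by simp
      then show ?thesis by (intro integral_eq_zero_AE) auto
    qed
    then show ?thesis by simp
  next
    case False
    have c0: "0 < c" using False p_nonneg by (simp add: c_def less_le integral_nonneg_AE)
    define D where "D s = density M (\<lambda>x. ennreal (p s x / c))" for s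
    have D_int: "(\<integral>x. g x \<partial>D s) = (\<integral>x. (p s x / c) *\<^sub>R g x \<partial>M)"
      if [measurable]: "g \<in> borel_measurable M" for g :: "'a \<Rightarrow> 'b::{banach, second_countable_topology}" and s
      unfolding D_def using c0 p_nonneg by (subst integral_density) auto
    have D: "real_distribution (distr (D s) borel X)" if s: "s = 1 \<or> s = -1" for s
    proof -
      have "prob_space (D s)"
      proof
        have "emeasure (D s) (space (D s)) = (\<integral>\<^sup>+x. ennreal (p s x / c) \<partial>M)"
          unfolding D_def by (simp add: emeasure_density nn_integral_set_ennreal[symmetric] cong: nn_integral_cong)
        also have "\<dots> = ennreal (\<integral>x. p s x / c \<partial>M)"
          using p_int p_nonneg c0 by (intro nn_integral_eq_integral) auto
        also have "\<dots> = 1" using c[OF s] c0 by simp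
        finally show "emeasure (D s) (space (D s)) = 1" .
      qed
      then show ?thesis
        by (intro prob_space.real_distribution_distr) (auto simp: D_def)
    qed
    have "char (distr (D s) borel X) \<theta> = (\<integral>x. of_real (p s x) * iexp (\<theta> * X x) \<partial>M) / of_real c" for s \<theta>
    proof -
      have "char (distr (D s) borel X) \<theta> = (\<integral>x. iexp (\<theta> * X x) \<partial>D s)"
        unfolding char_def by (subst integral_distr) (auto simp: D_def)
      also have "\<dots> = (\<integral>x. (of_real (p s x) * iexp (\<theta> * X x)) / of_real c \<partial>M)"
        by (subst D_int) (auto simp: scaleR_conv_of_real)
      finally show ?thesis by simp
    qed
    then have "char (distr (D 1) borel X) = char (distr (D (-1)) borel X)"
      using pe_eq by auto
    then have eq: "distr (D 1) borel X = distr (D (-1)) borel X"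
      using D by (intro Levy_uniqueness) auto
    have "measure (distr (D s) borel X) B = (\<integral>x. p s x * indicator B (X x) \<partial>M) / c" for s
    proof -
      have "measure (distr (D s) borel X) B = (\<integral>x. indicator B x \<partial>distr (D s) borel X)"
        by simp
      also have "\<dots> = (\<integral>x. indicator B (X x) \<partial>D s)"
        by (subst integral_distr) (auto simp: D_def)
      also have "\<dots> = (\<integral>x. p s x * indicator B (X x) / c \<partial>M)"
        by (subst D_int) auto
      finally show ?thesis by simp
    qed
    from this[of 1] this[of "-1"] eq c0 show ?thesis by simp
  qed
  have "(\<integral>x. U x * indicator B (X x) \<partial>M)
      = (\<integral>x. p 1 x * indicator B (X x) \<partial>M) - (\<integral>x. p (-1) x * indicator B (X x) \<partial>M)"
    unfolding Bochner_Integration.integral_diff[OF pB pB, symmetric] p_diff[symmetric]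
    by (simp add: left_diff_distrib)
  then show ?thesis using key by simp
qed

text \<open>Replacing \<open>\<theta>\<close> by \<open>-\<theta>\<close> and conjugating gives the hypothesis for the conjugate of \<open>U\<close>, hence for its
  real and imaginary parts. The complex case is needed because the weights contain characters.\<close>

lemma (in prob_space) integral_indicator_eq_0_of_char_eq_0:
  fixes U :: "'a \<Rightarrow> complex" and X :: "'a \<Rightarrow> real"
  assumes U: "integrable M U" and X[measurable]: "X \<in> borel_measurable M"
    and char0: "\<And>\<theta>. (\<integral>x. U x * iexp (\<theta> * X x) \<partial>M) = 0"
    and B[measurable]: "B \<in> sets borel"
  shows "(\<integral>x. U x * indicator B (X x) \<partial>M) = 0"
proof -
  have [measurable]: "U \<in> borel_measurable M" using U by simp
  have [measurable]: "(\<lambda>x. cnj (U x)) \<in> borel_measurable M"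
    using U by (intro borel_measurable_integrable) simp
  have iU: "integrable M (\<lambda>x. U x * iexp (\<theta> * X x))" for \<theta>
    by (rule Bochner_Integration.integrable_bound[OF U]) (auto simp: norm_mult)
  have iU': "integrable M (\<lambda>x. cnj (U x) * iexp (\<theta> * X x))" for \<theta>
    by (rule Bochner_Integration.integrable_bound[OF U]) (auto simp: norm_mult)
  have conj0: "(\<integral>x. cnj (U x) * iexp (\<theta> * X x) \<partial>M) = 0" for \<theta>
  proof -
    have "(\<integral>x. cnj (U x) * iexp (\<theta> * X x) \<partial>M) = (\<integral>x. cnj (U x * iexp (- \<theta> * X x)) \<partial>M)"
      by (simp add: exp_cnj)
    also have "\<dots> = cnj (\<integral>x. U x * iexp (- \<theta> * X x) \<partial>M)"
      by (rule Bochner_Integration.integral_cnj)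
    finally show ?thesis using char0[of "- \<theta>"] by simp
  qed
  have re: "(\<integral>x. Re (U x) * indicator B (X x) \<partial>M) = 0"
  proof (rule integral_indicator_eq_0_of_char_eq_0_real[OF _ X _ B])
    show "integrable M (\<lambda>x. Re (U x))" using U by simp
    fix \<theta>
    have "(\<integral>x. of_real (Re (U x)) * iexp (\<theta> * X x) \<partial>M)
      = (\<integral>x. (U x * iexp (\<theta> * X x) + cnj (U x) * iexp (\<theta> * X x)) / 2 \<partial>M)"
      by (intro Bochner_Integration.integral_cong) (auto simp: complex_add_cnj simp flip: distrib_right)
    also have "\<dots> = 0" using iU iU' char0 conj0 by simp
    finally show "(\<integral>x. of_real (Re (U x)) * iexp (\<theta> * X x) \<partial>M) = 0" .
  qed
  have im: "(\<integral>x. Im (U x) * indicator B (X x) \<partial>M) = 0"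
  proof (rule integral_indicator_eq_0_of_char_eq_0_real[OF _ X _ B])
    show "integrable M (\<lambda>x. Im (U x))" using U by simp
    fix \<theta>
    have "(\<integral>x. of_real (Im (U x)) * iexp (\<theta> * X x) \<partial>M)
      = (\<integral>x. (U x * iexp (\<theta> * X x) - cnj (U x) * iexp (\<theta> * X x)) / (2 * \<i>) \<partial>M)"
    proof (rule Bochner_Integration.integral_cong[OF refl])
      fix x
      have "of_real (Im u) * x = (u * x - cnj u * x) / (2 * \<i>)" for u x :: complex
        by (simp add: left_diff_distrib[symmetric] complex_diff_cnj mult.left_commute[of \<i> "of_real _"])
      then show "of_real (Im (U x)) * iexp (\<theta> * X x)
        = (U x * iexp (\<theta> * X x) - cnj (U x) * iexp (\<theta> * X x)) / (2 * \<i>)" .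
    qed
    also have "\<dots> = 0" using iU iU' char0 conj0 by simp
    finally show "(\<integral>x. of_real (Im (U x)) * iexp (\<theta> * X x) \<partial>M) = 0" .
  qed
  have iB: "integrable M (\<lambda>x. U x * indicator B (X x))"
    by (rule Bochner_Integration.integrable_bound[OF U]) (auto simp: indicator_def)
  have "Re (\<integral>x. U x * indicator B (X x) \<partial>M) = (\<integral>x. Re (U x) * indicator B (X x) \<partial>M)"
    unfolding integral_Re[OF iB, symmetric]
    by (intro Bochner_Integration.integral_cong) (auto simp: indicator_def)
  moreover have "Im (\<integral>x. U x * indicator B (X x) \<partial>M) = (\<integral>x. Im (U x) * indicator B (X x) \<partial>M)"
    unfolding integral_Im[OF iB, symmetric]
    by (intro Bochner_Integration.integral_cong) (auto simp: indicator_def)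
  ultimately show ?thesis using re im by (simp add: complex_eq_iff)
qed

text \<open>Finite linear combinations, not only the given variables: the field need not be linear in the test
  function at every sample point.\<close>

definition lin_combs :: "'i set \<Rightarrow> ('i \<Rightarrow> 'w \<Rightarrow> real) \<Rightarrow> ('w \<Rightarrow> real) set" where
  "lin_combs I X = {\<lambda>x. \<Sum>j\<in>J. a j * X j x | J a. finite J \<and> J \<subseteq> I}"

lemma lin_combs_mono: "I \<subseteq> I' \<Longrightarrow> lin_combs I X \<subseteq> lin_combs I' X"
  unfolding lin_combs_def by blast

lemma lin_combs_zero: "(\<lambda>x. 0) \<in> lin_combs I X"
  unfolding lin_combs_def by (auto intro!: exI[of _ "{}"])

lemma lin_combs_generator: "i \<in> I \<Longrightarrow> X i \<in> lin_combs I X"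
  unfolding lin_combs_def by (auto intro!: exI[of _ "{i}"] exI[of _ "\<lambda>_. 1"])

lemma lin_combs_scale: assumes "Z \<in> lin_combs I X" shows "(\<lambda>x. c * Z x) \<in> lin_combs I X"
proof -
  from assms obtain J a where "finite J" "J \<subseteq> I" "Z = (\<lambda>x. \<Sum>j\<in>J. a j * X j x)"
    unfolding lin_combs_def by blast
  then show ?thesis
    unfolding lin_combs_def
    by (auto intro!: exI[of _ J] exI[of _ "\<lambda>j. c * a j"] simp: sum_distrib_left mult.assoc)
qed

lemma lin_combs_add:
  assumes "Z \<in> lin_combs I X" "W \<in> lin_combs I X" shows "(\<lambda>x. Z x + W x) \<in> lin_combs I X"
proof -
  from assms obtain J a K b where J: "finite J" "J \<subseteq> I" "Z = (\<lambda>x. \<Sum>j\<in>J. a j * X j x)"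
    and K: "finite K" "K \<subseteq> I" "W = (\<lambda>x. \<Sum>j\<in>K. b j * X j x)"
    unfolding lin_combs_def by blast
  let ?c = "\<lambda>j. (if j \<in> J then a j else 0) + (if j \<in> K then b j else 0)"
  have "Z x + W x = (\<Sum>j\<in>J \<union> K. ?c j * X j x)" for x
  proof -
    have "(\<Sum>j\<in>J. a j * X j x) = (\<Sum>j\<in>J \<union> K. (if j \<in> J then a j else 0) * X j x)"
      using J K by (intro sum.mono_neutral_cong_left) auto
    moreover have "(\<Sum>j\<in>K. b j * X j x) = (\<Sum>j\<in>J \<union> K. (if j \<in> K then b j else 0) * X j x)"
      using J K by (intro sum.mono_neutral_cong_left) auto
    ultimately show ?thesis
      unfolding J(3) K(3) by (simp add: distrib_right sum.distrib)
  qed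
  then show ?thesis
    using J K unfolding lin_combs_def by (auto intro!: exI[of _ "J \<union> K"] exI[of _ ?c])
qed

text \<open>Gaussian Hilbert spaces without completeness.\<close>

locale gaussian_space = prob_space M for M :: "'w measure" +
  fixes V :: "('w \<Rightarrow> real) set"
  assumes gaussian: "Z \<in> V \<Longrightarrow> gaussian_rv M Z"
    and mean_zero: "Z \<in> V \<Longrightarrow> expectation Z = 0"
    and scale_mem: "Z \<in> V \<Longrightarrow> (\<lambda>x. c * Z x) \<in> V"
    and add_mem: "Z \<in> V \<Longrightarrow> W \<in> V \<Longrightarrow> (\<lambda>x. Z x + W x) \<in> V"
begin

lemma measurable_mem [measurable_dest]: "Z \<in> V \<Longrightarrow> Z \<in> borel_measurable M"
  using gaussian by (simp add: gaussian_rv_def)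

lemma integrable_square: "Z \<in> V \<Longrightarrow> integrable M (\<lambda>x. (Z x)\<^sup>2)"
  and characteristic_function: "Z \<in> V \<Longrightarrow>
    (\<integral>x. iexp (Z x) \<partial>M) = of_real (exp (- expectation (\<lambda>x. (Z x)\<^sup>2) / 2))"
proof -
  assume Z: "Z \<in> V"
  have [measurable]: "Z \<in> borel_measurable M" using Z by simp
  consider \<mu> \<sigma> where "0 < \<sigma>" "distributed M lborel Z (normal_density \<mu> \<sigma>)" | \<mu> where "AE x in M. Z x = \<mu>"
    using gaussian[OF Z] by (auto simp: gaussian_rv_def)
  then have "integrable M (\<lambda>x. (Z x)\<^sup>2) \<and>
    (\<integral>x. iexp (Z x) \<partial>M) = of_real (exp (- expectation (\<lambda>x. (Z x)\<^sup>2) / 2))"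
  proof cases
    case 1
    have \<mu>: "\<mu> = 0"
      using normal_distributed_expectation[OF 1] mean_zero[OF Z] by simp
    note D = 1(2)[unfolded \<mu>]
    have int: "integrable M (\<lambda>x. (Z x)\<^sup>2)"
      using distributed_integrable[OF D, of "\<lambda>x. x\<^sup>2"] integrable_normal_moment[OF 1(1), of 0 2] by simp
    have var: "expectation (\<lambda>x. (Z x)\<^sup>2) = \<sigma>\<^sup>2"
      using normal_distributed_variance[OF 1(1) D] mean_zero[OF Z] by simp
    have std: "distributed M lborel (\<lambda>x. Z x / \<sigma>) std_normal_density"
      using normal_standard_normal_convert[OF 1(1), of Z 0] D by simp
    have "distr M borel (\<lambda>x. Z x / \<sigma>) = std_normal_distribution"
      using distributed_distr_eq_density[OF std] by (simp cong: distr_cong)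
    then have "char std_normal_distribution \<sigma> = (\<integral>x. iexp (\<sigma> * x) \<partial>distr M borel (\<lambda>x. Z x / \<sigma>))"
      by (simp add: char_def)
    also have "\<dots> = (\<integral>x. iexp (Z x) \<partial>M)"
      using 1(1) by (subst integral_distr) auto
    finally show ?thesis
      using int var by (simp add: char_std_normal_distribution)
  next
    case 2
    have "expectation Z = expectation (\<lambda>x. \<mu>)"
      using 2 by (intro integral_cong_AE) auto
    then have \<mu>: "\<mu> = 0" using mean_zero[OF Z] by (simp add: prob_space)
    have "(\<integral>x. iexp (Z x) \<partial>M) = (\<integral>x. 1 \<partial>M)"
      using 2 \<mu> by (intro integral_cong_AE) auto
    moreover have "expectation (\<lambda>x. (Z x)\<^sup>2) = expectation (\<lambda>x. 0)"
      using 2 \<mu> by (intro integral_cong_AE) auto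
    moreover have "integrable M (\<lambda>x. (Z x)\<^sup>2) \<longleftrightarrow> integrable M (\<lambda>x. 0 :: real)"
      using 2 \<mu> by (intro integrable_cong_AE) auto
    ultimately show ?thesis by (simp add: prob_space)
  qed
  then show "integrable M (\<lambda>x. (Z x)\<^sup>2)"
    "(\<integral>x. iexp (Z x) \<partial>M) = of_real (exp (- expectation (\<lambda>x. (Z x)\<^sup>2) / 2))" by blast+
qed

lemma integrable_mult_mem: "Z \<in> V \<Longrightarrow> W \<in> V \<Longrightarrow> integrable M (\<lambda>x. Z x * W x)"
  by (intro integrable_mult_squares integrable_square) auto

lemma integrable_mem: "Z \<in> V \<Longrightarrow> integrable M Z"
  by (rule square_integrable_imp_integrable) (auto intro: integrable_square)

text \<open>Differentiate the characteristic function of \<open>aZ + W\<close> with respect to \<open>a\<close> at \<open>a = 0\<close>, once under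
  the integral and once in the closed form \<open>exp (- E[(aZ + W)\<^sup>2]/2)\<close>.\<close>

lemma gaussian_integration_by_parts:
  assumes Z: "Z \<in> V" and W: "W \<in> V"
  shows "(\<integral>x. of_real (Z x) * iexp (W x) \<partial>M)
    = \<i> * of_real (expectation (\<lambda>x. Z x * W x)) * (\<integral>x. iexp (W x) \<partial>M)"
proof -
  have [measurable]: "Z \<in> borel_measurable M" "W \<in> borel_measurable M" using Z W by simp_all
  define z c w where "z = expectation (\<lambda>x. (Z x)\<^sup>2)" and "c = expectation (\<lambda>x. Z x * W x)"
    and "w = expectation (\<lambda>x. (W x)\<^sup>2)"
  have char: "(\<integral>x. iexp (a * Z x + W x) \<partial>M) = of_real (exp (- (a\<^sup>2 * z + 2 * a * c + w) / 2))" for a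
  proof -
    have "expectation (\<lambda>x. (a * Z x + W x)\<^sup>2) = expectation (\<lambda>x. a\<^sup>2 * (Z x)\<^sup>2 + 2 * a * (Z x * W x) + (W x)\<^sup>2)"
      by (simp add: power2_sum power_mult_distrib algebra_simps)
    also have "\<dots> = a\<^sup>2 * z + 2 * a * c + w"
      using integrable_square[OF Z] integrable_square[OF W] integrable_mult_mem[OF Z W]
      by (simp add: z_def c_def w_def)
    finally have eq: "expectation (\<lambda>x. (a * Z x + W x)\<^sup>2) = a\<^sup>2 * z + 2 * a * c + w" .
    show ?thesis
      using characteristic_function[OF add_mem[OF scale_mem[OF Z] W], of a] unfolding eq .
  qed
  have int1: "integrable M (\<lambda>x. iexp (a * Z x + W x))" for a
    by (rule integrable_const_bound[where B=1]) auto
  define t where "t n = inverse (real (Suc n))" for n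
  have t: "t n \<noteq> 0" for n by (simp add: t_def)
  have tlim: "filterlim t (at 0) sequentially"
    using LIMSEQ_inverse_real_of_nat t by (auto simp: t_def[abs_def] filterlim_at)
  let ?s = "\<lambda>n x. (iexp (t n * Z x + W x) - iexp (W x)) / of_real (t n)"
  have "(\<lambda>n. \<integral>x. ?s n x \<partial>M) \<longlonglongrightarrow> (\<integral>x. \<i> * of_real (Z x) * iexp (W x) \<partial>M)"
  proof (rule integral_dominated_convergence)
    show "integrable M (\<lambda>x. \<bar>Z x\<bar>)" using integrable_mem[OF Z] by simp
    have d: "((\<lambda>a. iexp (a * Z x + W x)) has_vector_derivative \<i> * of_real (Z x) * iexp (W x)) (at 0)" for x
      by (auto intro!: derivative_eq_intros has_vector_derivative_real_field simp: mult_ac)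
    show "AE x in M. (\<lambda>n. ?s n x) \<longlonglongrightarrow> \<i> * of_real (Z x) * iexp (W x)"
    proof (rule AE_I2)
      fix x
      have "((\<lambda>a. (iexp (a * Z x + W x) - iexp (W x)) / of_real a) \<longlongrightarrow> \<i> * of_real (Z x) * iexp (W x)) (at 0)"
        using has_vector_derivative_difference_quotient[OF d[of x]]
        by (simp add: scaleR_conv_of_real divide_inverse mult.commute)
      from filterlim_compose[OF this tlim] show "(\<lambda>n. ?s n x) \<longlonglongrightarrow> \<i> * of_real (Z x) * iexp (W x)" .
    qed
    show "AE x in M. norm (?s n x) \<le> \<bar>Z x\<bar>" for n
    proof (rule AE_I2)
      fix x
      have eq: "?s n x = iexp (W x) * (iexp (t n * Z x) - 1) / of_real (t n)"
        by (simp add: distrib_left exp_add algebra_simps)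
      have "norm (?s n x) = norm (iexp (t n * Z x) - 1) / \<bar>t n\<bar>"
        unfolding eq by (simp add: norm_divide norm_mult)
      also have "\<dots> \<le> \<bar>t n * Z x\<bar> / \<bar>t n\<bar>"
        using iexp_approx1[of "t n * Z x" 0] by (intro divide_right_mono) auto
      finally show "norm (?s n x) \<le> \<bar>Z x\<bar>" using t[of n] by (simp add: abs_mult)
    qed
  qed measurable
  moreover have "(\<lambda>n. \<integral>x. ?s n x \<partial>M) \<longlonglongrightarrow> of_real (- c * exp (- w / 2))"
  proof -
    let ?g = "\<lambda>a. exp (- (a\<^sup>2 * z + 2 * a * c + w) / 2)"
    have "(?g has_real_derivative - c * exp (- w / 2)) (at 0)"
      by (auto intro!: derivative_eq_intros)
    then have "((\<lambda>a. (?g a - ?g 0) / a) \<longlongrightarrow> - c * exp (- w / 2)) (at 0)"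
      by (simp add: DERIV_def)
    then have "(\<lambda>n. (?g (t n) - ?g 0) / t n) \<longlonglongrightarrow> - c * exp (- w / 2)"
      using tlim by (rule filterlim_compose)
    then have "(\<lambda>n. complex_of_real ((?g (t n) - ?g 0) / t n)) \<longlonglongrightarrow> of_real (- c * exp (- w / 2))"
      by (rule tendsto_of_real)
    moreover have "(\<integral>x. ?s n x \<partial>M) = complex_of_real ((?g (t n) - ?g 0) / t n)" for n
      using char[of "t n"] char[of 0] int1[of "t n"] int1[of 0] by simp
    ultimately show ?thesis by (simp only:)
  qed
  ultimately have "(\<integral>x. \<i> * (of_real (Z x) * iexp (W x)) \<partial>M) = of_real (- c * exp (- w / 2))"
    by (simp add: LIMSEQ_unique mult.assoc)
  then have "\<i> * (\<integral>x. of_real (Z x) * iexp (W x) \<partial>M) = - (of_real c * (\<integral>x. iexp (W x) \<partial>M))"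
    using char[of 0] by simp
  then have "\<i> * (\<i> * (\<integral>x. of_real (Z x) * iexp (W x) \<partial>M)) = - (\<i> * of_real c * (\<integral>x. iexp (W x) \<partial>M))"
    by simp
  then show ?thesis by (simp add: c_def flip: mult.assoc)
qed

end

text \<open>The characters \<open>exp (iW)\<close> determine the \<open>\<sigma>\<close>-algebra: in a finite-dimensional cylinder the factors
  \<open>exp (i\<theta>X\<^sub>k)\<close> are exchanged for indicators of \<open>X\<^sub>k\<close> one coordinate at a time by the one-dimensional
  uniqueness theorem, which avoids characteristic functions of random vectors. Cylinders are stable
  under intersection and generate.\<close>

lemma (in prob_space) integral_eq_0_of_orthogonal_to_characters:
  fixes Z :: "'a \<Rightarrow> real" and X :: "'i \<Rightarrow> 'a \<Rightarrow> real"
  assumes Z: "integrable M Z" and X: "\<And>i. i \<in> I \<Longrightarrow> X i \<in> borel_measurable M"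
    and orth: "\<And>W. W \<in> lin_combs I X \<Longrightarrow> (\<integral>x. of_real (Z x) * iexp (W x) \<partial>M) = 0"
    and A: "A \<in> sigma_sets (space M) {X i -` B \<inter> space M | i B. i \<in> I \<and> B \<in> sets borel}"
  shows "(\<integral>x. Z x * indicator A x \<partial>M) = 0"
proof -
  have Wm: "W \<in> borel_measurable M" if "W \<in> lin_combs I X" for W
    using that X unfolding lin_combs_def by (auto intro!: borel_measurable_sum borel_measurable_times)
  have [measurable]: "Z \<in> borel_measurable M" using Z by simp
  have cylinder: "(\<integral>x. of_real (Z x) * (\<Prod>k\<in>K. indicator (B k) (X k x)) * iexp (W x) \<partial>M) = 0"
    if "finite K" "K \<subseteq> I" "\<And>k. k \<in> K \<Longrightarrow> B k \<in> sets borel" "W \<in> lin_combs I X" for K B W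
    using that
  proof (induction K arbitrary: W rule: finite_induct)
    case empty
    then show ?case using orth by simp
  next
    case (insert k K)
    have [measurable]: "X i \<in> borel_measurable M" if "i \<in> insert k K" for i
      using X insert.prems(1) that by auto
    have Bm[measurable]: "B i \<in> sets borel" if "i \<in> insert k K" for i
      using insert.prems(2) that by auto
    have [measurable]: "W \<in> borel_measurable M" using Wm insert.prems by auto
    let ?U = "\<lambda>x. of_real (Z x) * (\<Prod>k\<in>K. indicator (B k) (X k x)) * iexp (W x)"
    have pm: "(\<lambda>x. \<Prod>k\<in>K. indicator (B k) (X k x) :: complex) \<in> borel_measurable M"
      by (intro borel_measurable_prod) measurable
    have bd: "norm (\<Prod>k\<in>K. indicator (B k) (X k x) :: complex) \<le> 1" for x
      by (subst prod_norm[symmetric], intro prod_le_1) (auto simp: indicator_def)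
    have "(\<integral>x. ?U x * indicator (B k) (X k x) \<partial>M) = 0"
    proof (rule integral_indicator_eq_0_of_char_eq_0)
      show "integrable M ?U"
        by (rule Bochner_Integration.integrable_bound[OF Z])
           (use pm bd in \<open>auto simp: norm_mult intro!: mult_left_le\<close>)
      show "X k \<in> borel_measurable M" "B k \<in> sets borel" by (auto intro: Bm)
      fix \<theta>
      have "(\<lambda>x. W x + \<theta> * X k x) \<in> lin_combs I X"
        using insert.prems by (intro lin_combs_add lin_combs_scale lin_combs_generator) auto
      from insert.IH[OF _ _ this] insert.prems
      have "(\<integral>x. of_real (Z x) * (\<Prod>k\<in>K. indicator (B k) (X k x)) * iexp (W x + \<theta> * X k x) \<partial>M) = 0"
        by auto
      then show "(\<integral>x. ?U x * iexp (\<theta> * X k x) \<partial>M) = 0"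
        by (simp add: exp_add distrib_left mult.assoc)
    qed
    then show ?case using insert.hyps by (simp add: mult_ac)
  qed
  define P where "P = {{x \<in> space M. \<forall>k\<in>K. X k x \<in> B k} | K B. finite K \<and> K \<subseteq> I \<and> (\<forall>k\<in>K. B k \<in> sets borel)}"
  have null: "(\<integral>x. Z x * indicator A x \<partial>M) = 0" if "A \<in> P" for A
  proof -
    from that obtain K B where K: "finite K" "K \<subseteq> I" "\<And>k. k \<in> K \<Longrightarrow> B k \<in> sets borel"
      and A: "A = {x \<in> space M. \<forall>k\<in>K. X k x \<in> B k}" unfolding P_def by blast
    have "(\<integral>x. of_real (Z x * indicator A x) \<partial>M)
       = (\<integral>x. of_real (Z x) * (\<Prod>k\<in>K. indicator (B k) (X k x)) * iexp ((\<lambda>_. 0) x) \<partial>M)"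
    proof (rule Bochner_Integration.integral_cong[OF refl])
      fix x assume "x \<in> space M"
      then have "(\<Prod>k\<in>K. indicator (B k) (X k x)) = (indicator A x :: complex)"
        using K(1) unfolding A by (auto simp: indicator_def prod_eq_1_iff)
      then show "complex_of_real (Z x * indicator A x)
        = of_real (Z x) * (\<Prod>k\<in>K. indicator (B k) (X k x)) * iexp ((\<lambda>_. 0) x)"
        by (simp add: indicator_def)
    qed
    also have "\<dots> = 0" using cylinder[OF K lin_combs_zero] by simp
    finally show ?thesis by (simp only: integral_complex_of_real of_real_eq_0_iff)
  qed
  have P_events: "P \<subseteq> events"
  proof
    fix A assume "A \<in> P"
    then obtain K B where K: "finite K" "K \<subseteq> I" "\<And>k. k \<in> K \<Longrightarrow> B k \<in> sets borel"
      and A: "A = {x \<in> space M. \<forall>k\<in>K. X k x \<in> B k}" unfolding P_def by blast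
    have "{x \<in> space M. X k x \<in> B k} \<in> events" if "k \<in> K" for k
      using measurable_sets[OF X K(3)] that K(2) by (auto simp: vimage_def Int_def conj_commute)
    then show "A \<in> events"
      unfolding A using K(1) by (intro sets.sets_Collect_finite_All) (auto intro: sets.sets_Collect)
  qed
  have PP: "Int_stable P"
    unfolding Int_stable_def
  proof (intro ballI)
    fix A A' assume "A \<in> P" "A' \<in> P"
    from \<open>A \<in> P\<close> obtain K B where K: "finite K" "K \<subseteq> I" "\<And>k. k \<in> K \<Longrightarrow> B k \<in> sets borel"
      and A: "A = {x \<in> space M. \<forall>k\<in>K. X k x \<in> B k}"
      unfolding P_def by blast
    from \<open>A' \<in> P\<close> obtain K' B' where K': "finite K'" "K' \<subseteq> I" "\<And>k. k \<in> K' \<Longrightarrow> B' k \<in> sets borel"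
      and A': "A' = {x \<in> space M. \<forall>k\<in>K'. X k x \<in> B' k}" unfolding P_def by blast
    define C where "C k = (if k \<in> K then B k else UNIV) \<inter> (if k \<in> K' then B' k else UNIV)" for k
    have "A \<inter> A' = {x \<in> space M. \<forall>k\<in>K \<union> K'. X k x \<in> C k}"
      unfolding A A' C_def by auto
    moreover have "\<forall>k\<in>K \<union> K'. C k \<in> sets borel" using K K' by (auto simp: C_def)
    ultimately show "A \<inter> A' \<in> P"
      unfolding P_def using K(1,2) K'(1,2) by (intro CollectI exI[of _ "K \<union> K'"] exI[of _ C]) simp
  qed
  have "{X i -` B \<inter> space M | i B. i \<in> I \<and> B \<in> sets borel} \<subseteq> P"
  proof clarify
    fix i B assume "i \<in> I" "B \<in> sets (borel :: real measure)"
    then show "X i -` B \<inter> space M \<in> P"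
      unfolding P_def by (intro CollectI exI[of _ "{i}"] exI[of _ "\<lambda>_. B"]) auto
  qed
  then have A: "A \<in> sigma_sets (space M) P"
    using A sigma_sets_mono' by blast
  have P_Pow: "P \<subseteq> Pow (space M)" using P_events sets.space_closed by blast
  have events: "A \<in> events" if "A \<in> sigma_sets (space M) P" for A
    using that P_events sets.sigma_sets_subset by blast
  have int: "integrable M (\<lambda>x. Z x * indicator A x)" if "A \<in> events" for A
    using integrable_real_mult_indicator[OF that Z] by simp
  show ?thesis
    using PP P_Pow A
  proof (induction rule: sigma_sets_induct_disjoint)
    case (basic A)
    then show ?case by (rule null)
  next
    case empty
    then show ?case by simp
  next
    case (compl A)
    have "(\<integral>x. Z x * indicator (space M) x \<partial>M) = 0"
      by (rule null) (auto simp: P_def intro!: exI[of _ "{}"])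
    moreover have "(\<integral>x. Z x * indicator (space M - A) x \<partial>M)
        = (\<integral>x. Z x * indicator (space M) x - Z x * indicator A x \<partial>M)"
      by (intro Bochner_Integration.integral_cong) (auto simp: indicator_def)
    ultimately show ?case
      using compl events[OF compl(1)] by (simp add: int)
  next
    case (union A)
    have [measurable]: "A i \<in> events" for i using union(2) events by blast
    have ind: "(\<lambda>i. indicator (A i) x :: real) sums indicator (\<Union>i. A i) x" for x
      using union(1) by (intro indicator_sums) (auto simp: disjoint_family_on_def)
    have "(\<lambda>n. \<integral>x. (\<Sum>i<n. Z x * indicator (A i) x) \<partial>M) \<longlonglongrightarrow> (\<integral>x. Z x * indicator (\<Union>i. A i) x \<partial>M)"
    proof (rule integral_dominated_convergence[where w="\<lambda>x. \<bar>Z x\<bar>"])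
      show "AE x in M. (\<lambda>n. \<Sum>i<n. Z x * indicator (A i) x) \<longlonglongrightarrow> Z x * indicator (\<Union>i. A i) x"
        using sums_mult[OF ind] by (simp add: sums_def)
      show "AE x in M. norm (\<Sum>i<n. Z x * indicator (A i) x) \<le> \<bar>Z x\<bar>" for n
      proof (rule AE_I2)
        fix x
        have "(\<Sum>i<n. indicator (A i) x :: real) \<le> (\<Sum>i. indicator (A i) x)"
          using ind[of x] by (intro sum_le_suminf) (auto simp: sums_iff)
        also have "\<dots> \<le> 1" using ind[of x] by (simp add: sums_iff indicator_def)
        finally have "\<bar>\<Sum>i<n. indicator (A i) x :: real\<bar> \<le> 1"
          by (simp add: sum_nonneg)
        then show "norm (\<Sum>i<n. Z x * indicator (A i) x) \<le> \<bar>Z x\<bar>"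
          by (simp add: sum_distrib_left[symmetric] abs_mult mult_left_le)
      qed
    qed (use Z in auto)
    moreover have "(\<integral>x. (\<Sum>i<n. Z x * indicator (A i) x) \<partial>M) = 0" for n
      using union(3) by (subst Bochner_Integration.integral_sum) (auto intro: int)
    ultimately show ?case by (simp add: LIMSEQ_const_iff)
  qed
qed

text \<open>Completeness of \<open>L\<^sup>2\<close> with a limit that is measurable with respect to the smaller \<open>\<sigma>\<close>-algebra: an
  almost surely convergent subsequence gives the limit, and Fatou's lemma the convergence in \<open>L\<^sup>2\<close>.\<close>

lemma (in prob_space) L2_complete:
  fixes h :: "nat \<Rightarrow> 'a \<Rightarrow> real"
  assumes F: "subalgebra M F" and hF: "\<And>n. h n \<in> borel_measurable F"
    and sq: "\<And>n. integrable M (\<lambda>x. (h n x)\<^sup>2)"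
    and cauchy: "\<And>m n. expectation (\<lambda>x. (h n x - h m x)\<^sup>2) \<le> \<epsilon> n + \<epsilon> m"
    and \<epsilon>: "\<epsilon> \<longlonglongrightarrow> 0"
  shows "\<exists>H. H \<in> borel_measurable F \<and> integrable M (\<lambda>x. (H x)\<^sup>2) \<and>
    (\<lambda>n. expectation (\<lambda>x. (h n x - H x)\<^sup>2)) \<longlonglongrightarrow> 0"
proof -
  have hM[measurable]: "h n \<in> borel_measurable M" for n
    using measurable_from_subalg[OF F hF] .
  have hint: "integrable M (h n)" for n
    using square_integrable_imp_integrable[OF hM sq] .
  have dsq: "integrable M (\<lambda>x. (h n x - h m x)\<^sup>2)" for m n
    unfolding power2_diff using sq integrable_mult_squares[OF hM hM sq sq, of n m]
    by (auto simp: mult.assoc)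
  have L1: "\<exists>N. \<forall>i\<ge>N. \<forall>j\<ge>N. expectation (\<lambda>x. norm (h i x - h j x)) < e" if "0 < e" for e
  proof -
    obtain N where N: "\<And>n. N \<le> n \<Longrightarrow> \<epsilon> n < e\<^sup>2 / 2"
      using order_tendstoD(2)[OF \<epsilon>, of "e\<^sup>2 / 2"] \<open>0 < e\<close> by (auto simp: eventually_sequentially)
    have "expectation (\<lambda>x. norm (h i x - h j x)) < e" if "N \<le> i" "N \<le> j" for i j
    proof -
      have "(expectation (\<lambda>x. \<bar>h i x - h j x\<bar> * 1))\<^sup>2
          \<le> expectation (\<lambda>x. \<bar>h i x - h j x\<bar>\<^sup>2) * expectation (\<lambda>x. 1\<^sup>2)"
        using dsq[of i j] by (intro Cauchy_Schwarz_integral) auto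
      also have "\<dots> \<le> \<epsilon> i + \<epsilon> j" using cauchy[of i j] by (simp add: prob_space)
      also have "\<dots> < e\<^sup>2" using N[OF that(1)] N[OF that(2)] by simp
      finally show ?thesis
        using \<open>0 < e\<close> by (simp add: power_less_imp_less_base)
    qed
    then show ?thesis by blast
  qed
  obtain r where r: "strict_mono r" "AE x in M. Cauchy (\<lambda>i. h (r i) x)"
    using cauchy_L1_AE_cauchy_subseq[OF hint L1] by blast
  define H where "H x = lim (\<lambda>i. h (r i) x)" for x
  have HF: "H \<in> borel_measurable F"
    unfolding H_def by (intro borel_measurable_lim_metric hF)
  have HM[measurable]: "H \<in> borel_measurable M" using measurable_from_subalg[OF F HF] .
  have conv: "AE x in M. (\<lambda>i. h (r i) x) \<longlonglongrightarrow> H x"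
    using r(2) by eventually_elim (simp add: H_def Cauchy_convergent_iff convergent_LIMSEQ_iff)
  have \<epsilon>r: "(\<lambda>i. \<epsilon> (r i)) \<longlonglongrightarrow> 0" using LIMSEQ_subseq_LIMSEQ[OF \<epsilon> r(1)] by (simp add: o_def)
  have nn: "(\<integral>\<^sup>+x. ennreal ((h n x - H x)\<^sup>2) \<partial>M) \<le> ennreal (\<epsilon> n)" for n
  proof -
    have "(\<integral>\<^sup>+x. ennreal ((h n x - H x)\<^sup>2) \<partial>M)
        = (\<integral>\<^sup>+x. liminf (\<lambda>i. ennreal ((h n x - h (r i) x)\<^sup>2)) \<partial>M)"
    proof (rule nn_integral_cong_AE)
      show "AE x in M. ennreal ((h n x - H x)\<^sup>2) = liminf (\<lambda>i. ennreal ((h n x - h (r i) x)\<^sup>2))"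
        using conv
      proof eventually_elim
        case (elim x)
        then have "(\<lambda>i. ennreal ((h n x - h (r i) x)\<^sup>2)) \<longlonglongrightarrow> ennreal ((h n x - H x)\<^sup>2)"
          by (intro tendsto_intros)
        then show ?case using lim_imp_Liminf[OF sequentially_bot] by metis
      qed
    qed
    also have "\<dots> \<le> liminf (\<lambda>i. \<integral>\<^sup>+x. ennreal ((h n x - h (r i) x)\<^sup>2) \<partial>M)"
      by (rule nn_integral_liminf) measurable
    also have "\<dots> \<le> liminf (\<lambda>i. ennreal (\<epsilon> n + \<epsilon> (r i)))"
      using cauchy[of n] dsq
      by (intro Liminf_mono always_eventually allI) (auto simp: nn_integral_eq_integral intro: ennreal_leI)
    also have "\<dots> = ennreal (\<epsilon> n)"
    proof -
      have "(\<lambda>i. \<epsilon> n + \<epsilon> (r i)) \<longlonglongrightarrow> \<epsilon> n + 0"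
        by (intro tendsto_add tendsto_const \<epsilon>r)
      then have "(\<lambda>i. ennreal (\<epsilon> n + \<epsilon> (r i))) \<longlonglongrightarrow> ennreal (\<epsilon> n)"
        by (intro tendsto_ennrealI) simp
      then show ?thesis using lim_imp_Liminf[OF sequentially_bot] by metis
    qed
    finally show ?thesis .
  qed
  have \<epsilon>0: "0 \<le> \<epsilon> n" for n
  proof -
    have "0 \<le> expectation (\<lambda>x. (h n x - h n x)\<^sup>2)" by simp
    with cauchy[of n n] show ?thesis by simp
  qed
  have int: "integrable M (\<lambda>x. (h n x - H x)\<^sup>2)" for n
    using nn[of n] by (intro integrableI_bounded) (auto intro: le_less_trans)
  have le: "expectation (\<lambda>x. (h n x - H x)\<^sup>2) \<le> \<epsilon> n" for n
    using nn[of n] int[of n] \<epsilon>0 by (simp add: nn_integral_eq_integral)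
  have "(\<lambda>n. expectation (\<lambda>x. (h n x - H x)\<^sup>2)) \<longlonglongrightarrow> 0"
    by (rule tendsto_sandwich[OF _ _ tendsto_const \<epsilon>]) (use le in auto)
  moreover have "integrable M (\<lambda>x. (H x)\<^sup>2)"
  proof -
    have "integrable M (\<lambda>x. (h 0 x)\<^sup>2 - 2 * (h 0 x * (h 0 x - H x)) + (h 0 x - H x)\<^sup>2)"
      using sq int integrable_mult_squares[OF hM _ sq int, of 0 0] by simp
    then show ?thesis by (simp add: power2_eq_square algebra_simps)
  qed
  ultimately show ?thesis using HF by blast
qed

context gaussian_space
begin

text \<open>The first half of the projection theorem. The parallelogram law shows that a sequence of almost
  minimal distance to \<open>Y\<close> is Cauchy, and perturbing it in the direction \<open>w\<close> shows that the residuals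
  become orthogonal to \<open>w\<close>.\<close>

lemma minimizing_sequence:
  assumes W: "W \<subseteq> V" "(\<lambda>_. 0) \<in> W" "\<And>w c. w \<in> W \<Longrightarrow> (\<lambda>x. c * w x) \<in> W"
    "\<And>w w'. w \<in> W \<Longrightarrow> w' \<in> W \<Longrightarrow> (\<lambda>x. w x + w' x) \<in> W"
    and Y: "Y \<in> V"
  shows "\<exists>h. (\<forall>n. h n \<in> W)
    \<and> (\<forall>m n. expectation (\<lambda>x. (h n x - h m x)\<^sup>2) \<le> 2 / real (Suc n) + 2 / real (Suc m))
    \<and> (\<forall>w\<in>W. (\<lambda>n. expectation (\<lambda>x. (Y x - h n x) * w x)) \<longlonglongrightarrow> 0)"
proof -
  define D where "D w = expectation (\<lambda>x. (Y x - w x)\<^sup>2)" for w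
  define d where "d = (INF w\<in>W. D w)"
  have bdd: "bdd_below (D ` W)" by (intro bdd_belowI[of _ 0]) (auto simp: D_def)
  have d_le: "d \<le> D w" if "w \<in> W" for w unfolding d_def using bdd that by (rule cINF_lower)
  have "\<exists>w\<in>W. D w < d + 1 / real (Suc n)" for n
  proof -
    have "Inf (D ` W) < d + 1 / real (Suc n)" by (simp add: d_def)
    then show ?thesis using cInf_less_iff[of "D ` W"] W(2) bdd by auto
  qed
  then obtain h where h: "\<And>n. h n \<in> W" "\<And>n. D (h n) < d + 1 / real (Suc n)" by metis
  have sub: "(\<lambda>x. Y x - w x) \<in> V" if "w \<in> W" for w
    using add_mem[OF Y scale_mem[of w "-1"]] that W(1) by auto
  have sqint: "integrable M (\<lambda>x. (Y x - w x)\<^sup>2)" if "w \<in> W" for w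
    using integrable_square[OF sub[OF that]] .
  have cauchy: "expectation (\<lambda>x. (h n x - h m x)\<^sup>2) \<le> 2 / real (Suc n) + 2 / real (Suc m)" for m n
  proof -
    define u where "u x = 1 / 2 * (h n x + h m x)" for x
    have u: "u \<in> W" unfolding u_def by (intro W(3,4) h)
    have "expectation (\<lambda>x. (h n x - h m x)\<^sup>2)
        = expectation (\<lambda>x. 2 * (Y x - h n x)\<^sup>2 + 2 * (Y x - h m x)\<^sup>2 - 4 * (Y x - u x)\<^sup>2)"
      by (intro Bochner_Integration.integral_cong) (auto simp: u_def power2_eq_square algebra_simps)
    also have "\<dots> = 2 * D (h n) + 2 * D (h m) - 4 * D u"
      using sqint h(1) u by (simp add: D_def)
    also have "\<dots> \<le> 2 / real (Suc n) + 2 / real (Suc m)"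
      using h(2)[of n] h(2)[of m] d_le[OF u] by simp
    finally show ?thesis .
  qed
  have orth: "(\<lambda>n. expectation (\<lambda>x. (Y x - h n x) * w x)) \<longlonglongrightarrow> 0" if w: "w \<in> W" for w
  proof -
    define s where "s = expectation (\<lambda>x. (w x)\<^sup>2)"
    define c where "c n = expectation (\<lambda>x. (Y x - h n x) * w x)" for n
    have s: "0 \<le> s" by (simp add: s_def)
    have wV: "w \<in> V" using w W(1) by blast
    have bound: "2 * t * c n - t\<^sup>2 * s \<le> 1 / real (Suc n)" for t n
    proof -
      have "d \<le> D (\<lambda>x. h n x + t * w x)"
        by (intro d_le W(3,4) h w)
      also have "\<dots> = expectation (\<lambda>x. (Y x - h n x)\<^sup>2 - 2 * t * ((Y x - h n x) * w x) + t\<^sup>2 * (w x)\<^sup>2)"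
        unfolding D_def
        by (intro Bochner_Integration.integral_cong) (auto simp: power2_eq_square algebra_simps)
      also have "\<dots> = D (h n) - 2 * t * c n + t\<^sup>2 * s"
        using sqint[OF h(1)] integrable_mult_mem[OF sub[OF h(1)] wV] integrable_square[OF wV]
        by (simp add: D_def c_def s_def)
      finally show ?thesis using h(2)[of n] by linarith
    qed
    have "(c n)\<^sup>2 \<le> (s + 1) * (1 / real (Suc n))" for n
    proof -
      have "(c n)\<^sup>2 / (s + 1) = (c n)\<^sup>2 * (s + 1) / (s + 1)\<^sup>2"
        using s by (simp add: power2_eq_square)
      also have "\<dots> \<le> (c n)\<^sup>2 * (s + 2) / (s + 1)\<^sup>2"
        by (intro divide_right_mono mult_left_mono) auto
      \<comment> \<open>The step \<open>t = c/(s + 1)\<close> is nearly optimal and also makes sense for \<open>s = 0\<close>.\<close>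
      also have "\<dots> = 2 * (c n / (s + 1)) * c n - (c n / (s + 1))\<^sup>2 * s"
        using s by (simp add: power2_eq_square divide_simps) (simp add: algebra_simps)
      also have "\<dots> \<le> 1 / real (Suc n)" by (rule bound)
      finally show ?thesis using s by (simp add: divide_le_eq mult.commute)
    qed
    then have le: "\<forall>\<^sub>F n in sequentially. (c n)\<^sup>2 \<le> (s + 1) * (1 / real (Suc n))" by simp
    have lim: "(\<lambda>n. (s + 1) * (1 / real (Suc n))) \<longlonglongrightarrow> (s + 1) * 0"
      using LIMSEQ_inverse_real_of_nat by (intro tendsto_mult tendsto_const) (simp add: inverse_eq_divide)
    have "(\<lambda>n. (c n)\<^sup>2) \<longlonglongrightarrow> 0"
      by (rule tendsto_sandwich[OF _ le tendsto_const lim[simplified mult_zero_right]]) simp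
    then have "(\<lambda>n. sqrt ((c n)\<^sup>2)) \<longlonglongrightarrow> sqrt 0" by (rule tendsto_real_sqrt)
    then have "(\<lambda>n. \<bar>c n\<bar>) \<longlonglongrightarrow> 0" by simp
    then show ?thesis unfolding c_def by (rule tendsto_rabs_zero_cancel)
  qed
  show ?thesis using h(1) cauchy orth by (intro exI[of _ h] conjI allI ballI)
qed

end

section \<open>Conditional expectation as a limit of linear combinations\<close>

definition generated_sigma :: "'w measure \<Rightarrow> ('i \<Rightarrow> 'w \<Rightarrow> real) \<Rightarrow> 'i set \<Rightarrow> 'w measure" where
  "generated_sigma M X I = sigma (space M) {X i -` B \<inter> space M | i B. i \<in> I \<and> B \<in> sets borel}"

lemma space_generated_sigma [simp]: "space (generated_sigma M X I) = space M"
  and sets_generated_sigma: "sets (generated_sigma M X I) =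
    sigma_sets (space M) {X i -` B \<inter> space M | i B. i \<in> I \<and> B \<in> sets borel}"
  unfolding generated_sigma_def by (intro space_measure_of sets_measure_of; blast)+

lemma measurable_generated_sigma: "i \<in> I \<Longrightarrow> X i \<in> borel_measurable (generated_sigma M X I)"
  by (intro measurableI) (auto simp: sets_generated_sigma)

lemma subalgebra_generated_sigma:
  assumes "\<And>i. i \<in> I \<Longrightarrow> X i \<in> borel_measurable M"
  shows "subalgebra M (generated_sigma M X I)"
  unfolding subalgebra_def sets_generated_sigma
  using assms by (auto intro!: sets.sigma_sets_subset measurable_sets)

lemma subalgebra_generated_sigma_mono:
  assumes "I \<subseteq> I'"
  shows "subalgebra (generated_sigma M X I') (generated_sigma M X I)"
proof -
  have "{X i -` B \<inter> space M | i B. i \<in> I \<and> B \<in> sets borel} \<subseteq> {X i -` B \<inter> space M | i B. i \<in> I' \<and> B \<in> sets borel}"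
    using assms by blast
  then show ?thesis
    unfolding subalgebra_def sets_generated_sigma by (simp add: sigma_sets_mono')
qed

lemma measurable_lin_combs:
  assumes "W \<in> lin_combs I X" shows "W \<in> borel_measurable (generated_sigma M X I)"
proof -
  from assms obtain J a where "finite J" "J \<subseteq> I" "W = (\<lambda>x. \<Sum>j\<in>J. a j * X j x)"
    unfolding lin_combs_def by blast
  then show ?thesis
    by (auto intro!: borel_measurable_sum borel_measurable_times measurable_generated_sigma)
qed

lemma (in prob_space) sigma_finite_subalgebraI: "subalgebra M F \<Longrightarrow> sigma_finite_subalgebra M F"
  by (intro finite_measure_subalgebra_is_sigma_finite)
     (simp add: finite_measure_subalgebra_def finite_measure_subalgebra_axioms_def finite_measure_axioms)

text \<open>The projection on the closed span of the \<open>X\<^sub>i\<close> is the conditional expectation given them: the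
  residual \<open>Y - H\<close> integrates to \<open>0\<close> against every \<open>exp (iW)\<close> because the residuals \<open>Y - h\<^sub>n\<close> do so in
  the limit by Gaussian integration by parts. The approximating sequence is part of the
  conclusion since covariances are known for finite linear combinations only.\<close>

lemma (in gaussian_space) conditional_expectation_approximation:
  assumes I: "lin_combs I X \<subseteq> V" and Y: "Y \<in> V"
  defines "F \<equiv> generated_sigma M X I"
  shows "\<exists>h H. (\<forall>n. h n \<in> lin_combs I X)
    \<and> H \<in> borel_measurable F \<and> integrable M (\<lambda>x. (H x)\<^sup>2)
    \<and> (AE x in M. real_cond_exp M F Y x = H x)
    \<and> (\<lambda>n. expectation (\<lambda>x. (h n x - H x)\<^sup>2)) \<longlonglongrightarrow> 0
    \<and> (\<forall>w\<in>lin_combs I X. (\<lambda>n. expectation (\<lambda>x. (Y x - h n x) * w x)) \<longlonglongrightarrow> 0)"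
proof -
  have XV: "X i \<in> V" if "i \<in> I" for i using lin_combs_generator[OF that] I by blast
  have subF: "subalgebra M F"
    unfolding F_def by (rule subalgebra_generated_sigma) (auto dest: XV)
  obtain h where h: "\<And>n. h n \<in> lin_combs I X"
    and cauchy: "\<And>m n. expectation (\<lambda>x. (h n x - h m x)\<^sup>2) \<le> 2 / real (Suc n) + 2 / real (Suc m)"
    and orth: "\<And>w. w \<in> lin_combs I X \<Longrightarrow> (\<lambda>n. expectation (\<lambda>x. (Y x - h n x) * w x)) \<longlonglongrightarrow> 0"
    using minimizing_sequence[OF I lin_combs_zero lin_combs_scale lin_combs_add Y] by blast
  have hV: "h n \<in> V" for n using h I by blast
  have lim0: "(\<lambda>n. 2 / real (Suc n)) \<longlonglongrightarrow> 0"
    using tendsto_mult[OF tendsto_const[of 2] LIMSEQ_inverse_real_of_nat] by (simp add: divide_inverse)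
  obtain H where H: "H \<in> borel_measurable F" "integrable M (\<lambda>x. (H x)\<^sup>2)"
    and conv: "(\<lambda>n. expectation (\<lambda>x. (h n x - H x)\<^sup>2)) \<longlonglongrightarrow> 0"
    using L2_complete[OF subF _ integrable_square[OF hV] cauchy lim0] measurable_lin_combs[OF h]
    unfolding F_def by blast
  have HM[measurable]: "H \<in> borel_measurable M" using measurable_from_subalg[OF subF H(1)] .
  have Hint: "integrable M H" using square_integrable_imp_integrable[OF HM H(2)] .
  have Yint: "integrable M Y" using integrable_mem[OF Y] .
  have Ym[measurable]: "Y \<in> borel_measurable M" and hm[measurable]: "h n \<in> borel_measurable M" for n
    using Y hV by simp_all
  have dsq: "integrable M (\<lambda>x. (h n x - H x)\<^sup>2)" for n
    unfolding power2_diff using integrable_square[OF hV] H(2) integrable_mult_squares[OF hm HM integrable_square[OF hV] H(2)]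
    by (auto simp: mult.assoc)
  have L1: "(\<lambda>n. expectation (\<lambda>x. \<bar>h n x - H x\<bar>)) \<longlonglongrightarrow> 0"
  proof (rule tendsto_sandwich[OF _ _ tendsto_const])
    show "(\<lambda>n. sqrt (expectation (\<lambda>x. (h n x - H x)\<^sup>2))) \<longlonglongrightarrow> 0"
      using tendsto_real_sqrt[OF conv] by simp
    have "expectation (\<lambda>x. \<bar>h n x - H x\<bar>) \<le> sqrt (expectation (\<lambda>x. (h n x - H x)\<^sup>2))" for n
    proof (rule real_le_rsqrt)
      have "(expectation (\<lambda>x. \<bar>h n x - H x\<bar> * 1))\<^sup>2
          \<le> expectation (\<lambda>x. \<bar>h n x - H x\<bar>\<^sup>2) * expectation (\<lambda>x. 1\<^sup>2)"
        using dsq by (intro Cauchy_Schwarz_integral) auto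
      then show "(expectation (\<lambda>x. \<bar>h n x - H x\<bar>))\<^sup>2 \<le> expectation (\<lambda>x. (h n x - H x)\<^sup>2)"
        by (simp add: prob_space)
    qed
    then show "\<forall>\<^sub>F n in sequentially. expectation (\<lambda>x. \<bar>h n x - H x\<bar>) \<le> sqrt (expectation (\<lambda>x. (h n x - H x)\<^sup>2))"
      by simp
  qed auto
  have char0: "(\<integral>x. of_real (Y x - H x) * iexp (W x) \<partial>M) = 0" if W: "W \<in> lin_combs I X" for W
  proof -
    have WV: "W \<in> V" using W I by blast
    have [measurable]: "W \<in> borel_measurable M" using WV by simp
    have sub: "(\<lambda>x. Y x - h n x) \<in> V" for n
      using add_mem[OF Y scale_mem[OF hV, of "-1"]] by simp
    have i: "integrable M (\<lambda>x. of_real (U x) * iexp (W x))" if "integrable M U" for U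
      by (rule Bochner_Integration.integrable_bound[OF that]) (use that in \<open>auto simp: norm_mult\<close>)
    let ?z = "\<integral>x. of_real (Y x - H x) * iexp (W x) \<partial>M"
    let ?zn = "\<lambda>n. \<integral>x. of_real (Y x - h n x) * iexp (W x) \<partial>M"
    have "?zn \<longlonglongrightarrow> \<i> * of_real 0 * (\<integral>x. iexp (W x) \<partial>M)"
      unfolding gaussian_integration_by_parts[OF sub WV]
      by (intro tendsto_mult tendsto_const tendsto_of_real orth W)
    moreover have "?zn \<longlonglongrightarrow> ?z"
    proof (rule LIM_zero_cancel, rule Lim_null_comparison[OF _ L1], rule always_eventually, rule allI)
      fix n
      have "?zn n - ?z = (\<integral>x. of_real (H x - h n x) * iexp (W x) \<partial>M)"
        using i[OF integrable_mem[OF sub]] i[of "\<lambda>x. Y x - H x"] Yint Hint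
        by (subst Bochner_Integration.integral_diff[symmetric]) (auto simp: algebra_simps)
      also have "norm \<dots> \<le> (\<integral>x. norm (of_real (H x - h n x) * iexp (W x)) \<partial>M)"
        by (rule integral_norm_bound)
      also have "\<dots> = expectation (\<lambda>x. \<bar>h n x - H x\<bar>)"
        by (simp add: norm_mult abs_minus_commute flip: of_real_diff)
      finally show "norm (?zn n - ?z) \<le> expectation (\<lambda>x. \<bar>h n x - H x\<bar>)" .
    qed
    ultimately show ?thesis using LIMSEQ_unique by fastforce
  qed
  interpret F: sigma_finite_subalgebra M F
    by (rule sigma_finite_subalgebraI[OF subF])
  have "AE x in M. real_cond_exp M F Y x = H x"
  proof (rule F.real_cond_exp_charact)
    fix A assume A: "A \<in> sets F"
    have Am: "A \<in> events" using A subF by (auto simp: subalgebra_def)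
    have "(\<integral>x. (Y x - H x) * indicator A x \<partial>M) = 0"
      using A Yint Hint char0 XV unfolding F_def sets_generated_sigma
      by (intro integral_eq_0_of_orthogonal_to_characters[where X=X and I=I]) auto
    then show "(\<integral>x\<in>A. Y x \<partial>M) = (\<integral>x\<in>A. H x \<partial>M)"
      unfolding left_diff_distrib
        Bochner_Integration.integral_diff[OF integrable_real_mult_indicator[OF Am Yint] integrable_real_mult_indicator[OF Am Hint]]
      by (simp add: set_lebesgue_integral_def mult.commute)
  qed (use Yint Hint H in auto)
  then show ?thesis
    using h H conv orth by (intro exI[of _ h] exI[of _ H] conjI allI ballI)
qed

lemma gaussian_rv_integrable:
  assumes "prob_space M" and Z: "gaussian_rv M Z" shows "integrable M Z"
proof -
  interpret prob_space M by fact
  have [measurable]: "Z \<in> borel_measurable M" using Z by (simp add: gaussian_rv_def)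
  consider \<mu> \<sigma> where "0 < \<sigma>" "distributed M lborel Z (normal_density \<mu> \<sigma>)" | \<mu> where "AE x in M. Z x = \<mu>"
    using Z by (auto simp: gaussian_rv_def)
  then show ?thesis
  proof cases
    case 1
    then show ?thesis
      using distributed_integrable[OF 1(2), of "\<lambda>x. x"] integrable_normal_moment_nz_1[OF 1(1)] by simp
  next
    case 2
    then have "integrable M Z \<longleftrightarrow> integrable M (\<lambda>_. \<mu>)" by (intro integrable_cong_AE) auto
    then show ?thesis by simp
  qed
qed

lemma gaussian_space_lin_combs:
  assumes X: "centered_gaussian_family M I X"
  shows "gaussian_space M (lin_combs I X)"
proof -
  have M: "prob_space M" using X by (simp add: centered_gaussian_family_def)
  interpret prob_space M by fact
  have rv: "gaussian_rv M (\<lambda>x. \<Sum>j\<in>J. a j * X j x)" if "finite J" "J \<subseteq> I" for J a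
    using X that by (simp add: centered_gaussian_family_def)
  have int: "integrable M (X i)" if "i \<in> I" for i
    using gaussian_rv_integrable[OF M rv[of "{i}" "\<lambda>_. 1"]] that by simp
  have mean: "expectation (\<lambda>x. \<Sum>j\<in>J. a j * X j x) = 0" if "finite J" "J \<subseteq> I" for J a
  proof -
    have "expectation (\<lambda>x. \<Sum>j\<in>J. a j * X j x) = (\<Sum>j\<in>J. expectation (\<lambda>x. a j * X j x))"
      using int that(2) by (intro Bochner_Integration.integral_sum integrable_mult_right) auto
    also have "\<dots> = 0"
      using X that(2) by (intro sum.neutral) (auto simp: centered_gaussian_family_def)
    finally show ?thesis .
  qed
  show ?thesis
  proof (intro gaussian_space.intro gaussian_space_axioms.intro M)
    show "gaussian_rv M Z" "expectation Z = 0" if "Z \<in> lin_combs I X" for Z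
      using that rv mean unfolding lin_combs_def by auto
  qed (auto intro: lin_combs_scale lin_combs_add)
qed

lemma field_sigma_eq_generated_sigma:
  "field_sigma M L T = generated_sigma M (\<lambda>(f, s). L f s) (Cc_infty \<times> T)"
proof -
  have "{L g u -` B \<inter> space M |g u B. g \<in> Cc_infty \<and> u \<in> T \<and> B \<in> sets borel}
    = {(case i of (f, s) \<Rightarrow> L f s) -` B \<inter> space M |i B. i \<in> Cc_infty \<times> T \<and> B \<in> sets borel}"
    by auto
  then show ?thesis by (simp add: field_sigma_def generated_sigma_def)
qed

text \<open>Test the conditional expectation against its own sign, which is measurable for the subalgebra.\<close>

lemma (in sigma_finite_subalgebra) real_cond_exp_L1_contraction:
  assumes g: "integrable M g"
  shows "(\<integral>x. \<bar>real_cond_exp M F g x\<bar> \<partial>M) \<le> (\<integral>x. \<bar>g x\<bar> \<partial>M)"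
proof -
  let ?s = "\<lambda>x. sgn (real_cond_exp M F g x)"
  have sF[measurable]: "?s \<in> borel_measurable F" by measurable
  have [measurable]: "?s \<in> borel_measurable M" using measurable_from_subalg[OF subalg sF] .
  have [measurable]: "g \<in> borel_measurable M" using g by simp
  have i: "integrable M (\<lambda>x. ?s x * g x)"
    by (rule Bochner_Integration.integrable_bound[OF g]) (auto simp: abs_mult sgn_if)
  have "(\<integral>x. \<bar>real_cond_exp M F g x\<bar> \<partial>M) = (\<integral>x. ?s x * real_cond_exp M F g x \<partial>M)"
    by (intro Bochner_Integration.integral_cong) (auto simp: abs_sgn mult.commute)
  also have "\<dots> = (\<integral>x. ?s x * g x \<partial>M)" by (rule real_cond_exp_intg(2)[OF i sF]) simp
  also have "\<dots> \<le> (\<integral>x. \<bar>g x\<bar> \<partial>M)"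
    using i g by (intro integral_mono) (auto simp: sgn_if)
  finally show ?thesis .
qed

text \<open>Truncations converge in \<open>L\<^sup>1\<close> and conditional expectations are \<open>L\<^sup>1\<close> contractions, so equality of
  the two conditional expectations passes to the limit.\<close>

lemma (in prob_space) conditional_expectation_eq_of_truncations:
  assumes F2: "subalgebra M F2" and F1: "subalgebra F2 F1" and Y: "integrable M Y"
    and trunc: "\<And>n::nat. AE x in M. real_cond_exp M F2 (\<lambda>x. max (- real n) (min (real n) (Y x))) x
      = real_cond_exp M F1 (\<lambda>x. max (- real n) (min (real n) (Y x))) x"
  shows "AE x in M. real_cond_exp M F2 Y x = real_cond_exp M F1 Y x"
proof -
  have F1M: "subalgebra M F1" using F1 F2 by (auto simp: subalgebra_def)
  interpret F2: sigma_finite_subalgebra M F2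
    by (rule sigma_finite_subalgebraI[OF F2])
  interpret F1: sigma_finite_subalgebra M F1
    by (rule sigma_finite_subalgebraI[OF F1M])
  have [measurable]: "Y \<in> borel_measurable M" using Y by simp
  define y where "y n x = max (- real n) (min (real n) (Y x))" for n x
  have ym[measurable]: "y n \<in> borel_measurable M" for n unfolding y_def by measurable
  have y_le: "\<bar>y n x\<bar> \<le> \<bar>Y x\<bar>" for n x by (auto simp: y_def)
  have yi: "integrable M (y n)" for n
    by (rule Bochner_Integration.integrable_bound[OF Y]) (auto simp: y_le)
  have yY: "(\<lambda>n. y n x) \<longlonglongrightarrow> Y x" for x
  proof (rule tendsto_eventually)
    obtain N :: nat where "\<bar>Y x\<bar> \<le> real N" using real_arch_simple by blast
    then show "\<forall>\<^sub>F n in sequentially. y n x = Y x"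
      unfolding eventually_sequentially by (intro exI[of _ N]) (auto simp: y_def)
  qed
  have L1: "(\<lambda>n. \<integral>x. \<bar>y n x - Y x\<bar> \<partial>M) \<longlonglongrightarrow> (\<integral>x. 0 \<partial>M)"
  proof (rule integral_dominated_convergence[where w="\<lambda>x. 2 * \<bar>Y x\<bar>"])
    show "AE x in M. (\<lambda>n. \<bar>y n x - Y x\<bar>) \<longlonglongrightarrow> 0"
      using yY by (auto intro!: AE_I2 tendsto_rabs_zero simp: LIM_zero_iff)
    show "AE x in M. norm \<bar>y n x - Y x\<bar> \<le> 2 * \<bar>Y x\<bar>" for n
    proof (rule AE_I2)
      fix x show "norm \<bar>y n x - Y x\<bar> \<le> 2 * \<bar>Y x\<bar>" using y_le[of n x] by simp
    qed
  qed (use Y in auto)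
  let ?C = "real_cond_exp M F1 Y" and ?c = "\<lambda>n. real_cond_exp M F1 (y n)"
  note Ci = F1.real_cond_exp_int(1)[OF Y] and ci = F1.real_cond_exp_int(1)[OF yi]
  have CL1: "(\<integral>x. \<bar>?c n x - ?C x\<bar> \<partial>M) \<le> (\<integral>x. \<bar>y n x - Y x\<bar> \<partial>M)" for n
  proof -
    have "(\<integral>x. \<bar>?c n x - ?C x\<bar> \<partial>M) = (\<integral>x. \<bar>real_cond_exp M F1 (\<lambda>x. y n x - Y x) x\<bar> \<partial>M)"
      using F1.real_cond_exp_diff[OF yi[of n] Y] by (intro integral_cong_AE) auto
    also have "\<dots> \<le> (\<integral>x. \<bar>y n x - Y x\<bar> \<partial>M)"
      using yi Y by (intro F1.real_cond_exp_L1_contraction) auto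
    finally show ?thesis .
  qed
  show ?thesis
  proof (rule F2.real_cond_exp_charact[OF _ Y Ci])
    show "?C \<in> borel_measurable F2"
      by (rule measurable_from_subalg[OF F1]) simp
    fix A assume A: "A \<in> sets F2"
    then have Am[measurable]: "A \<in> events" using F2 by (auto simp: subalgebra_def)
    have ind: "integrable M (\<lambda>x. indicator A x *\<^sub>R g x)" if "integrable M g" for g :: "'a \<Rightarrow> real"
      using integrable_mult_indicator[OF Am that] .
    have approx: "(\<lambda>n. \<integral>x\<in>A. k n x \<partial>M) \<longlonglongrightarrow> (\<integral>x\<in>A. K x \<partial>M)"
      if k: "\<And>n. integrable M (k n)" and K: "integrable M K"
        and le: "\<And>n. (\<integral>x. \<bar>k n x - K x\<bar> \<partial>M) \<le> (\<integral>x. \<bar>y n x - Y x\<bar> \<partial>M)" for k K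
    proof (rule LIM_zero_cancel, rule Lim_null_comparison)
      show "(\<lambda>n. \<integral>x. \<bar>y n x - Y x\<bar> \<partial>M) \<longlonglongrightarrow> 0" using L1 by simp
      have "norm ((\<integral>x\<in>A. k n x \<partial>M) - (\<integral>x\<in>A. K x \<partial>M)) \<le> (\<integral>x. \<bar>y n x - Y x\<bar> \<partial>M)" for n
      proof -
        have "(\<integral>x\<in>A. k n x \<partial>M) - (\<integral>x\<in>A. K x \<partial>M) = (\<integral>x. indicator A x *\<^sub>R k n x - indicator A x *\<^sub>R K x \<partial>M)"
          unfolding set_lebesgue_integral_def by (rule Bochner_Integration.integral_diff[OF ind[OF k] ind[OF K], symmetric])
        also have "norm \<dots> \<le> (\<integral>x. norm (indicator A x *\<^sub>R k n x - indicator A x *\<^sub>R K x) \<partial>M)"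
          by (rule integral_norm_bound)
        also have "\<dots> \<le> (\<integral>x. \<bar>k n x - K x\<bar> \<partial>M)"
          using ind[OF k[of n]] ind[OF K] k K by (intro integral_mono) (auto simp: indicator_def)
        finally show ?thesis using le[of n] by simp
      qed
      then show "\<forall>\<^sub>F n in sequentially. norm ((\<integral>x\<in>A. k n x \<partial>M) - (\<integral>x\<in>A. K x \<partial>M)) \<le> (\<integral>x. \<bar>y n x - Y x\<bar> \<partial>M)"
        by simp
    qed
    have "(\<integral>x\<in>A. y n x \<partial>M) = (\<integral>x\<in>A. ?c n x \<partial>M)" for n
    proof -
      have "(\<integral>x\<in>A. y n x \<partial>M) = (\<integral>x\<in>A. real_cond_exp M F2 (y n) x \<partial>M)"
        by (rule F2.real_cond_exp_intA[OF yi A])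
      also have "\<dots> = (\<integral>x\<in>A. ?c n x \<partial>M)"
        unfolding set_lebesgue_integral_def
      proof (rule integral_cong_AE)
        show "AE x in M. indicator A x *\<^sub>R real_cond_exp M F2 (y n) x = indicator A x *\<^sub>R ?c n x"
          using trunc[of n] unfolding y_def[abs_def] by eventually_elim simp
      qed auto
      finally show ?thesis .
    qed
    then have "(\<lambda>n. \<integral>x\<in>A. y n x \<partial>M) \<longlonglongrightarrow> (\<integral>x\<in>A. ?C x \<partial>M)"
      using approx[OF ci Ci CL1] by simp
    with approx[OF yi Y order_refl] show "(\<integral>x\<in>A. Y x \<partial>M) = (\<integral>x\<in>A. ?C x \<partial>M)"
      by (rule LIMSEQ_unique)
  qed
qed

section \<open>Failure of the Markov property\<close>

text \<open>The conditional expectation \<open>H\<close> given the present is a limit of combinations \<open>h\<^sub>n\<close> of the present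
  field. The Markov identity makes \<open>Y - H\<close> orthogonal to \<open>U = L(g,u)\<close> for the earlier time \<open>u\<close>. The
  covariance of \<open>h\<^sub>n\<close> with \<open>U\<close> is the average over \<open>q\<^sub>b\<close> of its covariances with the translates
  \<open>L(T\<^sub>yg,s)\<close>, which tend to those of \<open>Y\<close>, with a bound from the Cauchy-Schwarz inequality that does not
  depend on \<open>n\<close> and \<open>y\<close>.\<close>

lemma markov_step_forces_semigroup:
  fixes v :: complex and M :: "'w measure"
    and L :: "(complex \<Rightarrow> real) \<Rightarrow> real \<Rightarrow> 'w \<Rightarrow> real"
  assumes v: "cmod v < 1"
    and gaussian: "centered_gaussian_family M (Cc_infty \<times> {0..}) (\<lambda>(f, s). L f s)"
    and covariance: "\<And>f g s t. f \<in> Cc_infty \<Longrightarrow> g \<in> Cc_infty \<Longrightarrow> 0 \<le> s \<Longrightarrow> 0 \<le> t \<Longrightarrow>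
      complex_of_real (\<integral>x. L f t x * L g s x \<partial>M) = Gamma_cov v f g \<bar>t - s\<bar>"
    and st: "0 < s" "s < t" and f: "f \<in> Cc_infty" and g: "g \<in> Cc_infty"
    and markov: "AE x in M. real_cond_exp M (field_sigma M L {0..s}) (L f t) x =
      real_cond_exp M (field_sigma M L {s}) (L f t) x"
    and b: "0 < b" "b \<le> s * (1 - (cmod v)\<^sup>2)"
  shows "log_energy ((t - s) * (1 - (cmod v)\<^sup>2) + b) f g
    = (\<integral>y. q_kernel b y * log_energy ((t - s) * (1 - (cmod v)\<^sup>2)) f (\<lambda>x. g (x - y)) \<partial>lborel)"
proof -
  define \<kappa> where "\<kappa> = 1 - (cmod v)\<^sup>2"
  have \<kappa>: "0 < \<kappa>" using v by (simp add: \<kappa>_def power_less_one_iff)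
  \<comment> \<open>The time whose lag \<open>s - u\<close> corresponds to the kernel parameter \<open>b\<close>; the bound on \<open>b\<close> says \<open>u \<ge> 0\<close>.\<close>
  define u where "u = s - b / \<kappa>"
  have u: "0 \<le> u" "u < s" "(s - u) * \<kappa> = b"
    using b \<kappa> by (simp_all add: u_def \<kappa>_def[symmetric] divide_le_eq)
  define a where "a = (t - s) * \<kappa>"
  have a: "0 < a" using st \<kappa> by (simp add: a_def)
  let ?X = "\<lambda>(f, s). L f s"
  let ?V = "lin_combs (Cc_infty \<times> {0..}) ?X"
  let ?W = "lin_combs (Cc_infty \<times> {s}) ?X"
  interpret gaussian_space M ?V
    by (rule gaussian_space_lin_combs[OF gaussian])
  have L_mem: "L h r \<in> ?V" if "h \<in> Cc_infty" "0 \<le> r" for h r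
    using lin_combs_generator[of "(h, r)" "Cc_infty \<times> {0..}" ?X] that by simp
  have W_sub: "?W \<subseteq> ?V"
    using st by (intro lin_combs_mono) auto
  have L_W: "L h s \<in> ?W" if "h \<in> Cc_infty" for h
    using lin_combs_generator[of "(h, s)" "Cc_infty \<times> {s}" ?X] that by simp
  have t0: "0 \<le> t" and s0: "0 \<le> s" using st by auto
  define T where "T y = (\<lambda>x. g (x - y))" for y
  have T: "T y \<in> Cc_infty" for y unfolding T_def by (rule Cc_infty_shift[OF g])
  define Y where "Y = L f t"
  define U where "U = L g u"
  have Y: "Y \<in> ?V" unfolding Y_def by (rule L_mem[OF f t0])
  have U: "U \<in> ?V" unfolding U_def by (rule L_mem[OF g u(1)])
  note TV = L_mem[OF T s0]
  obtain h H where h: "\<And>n. h n \<in> ?W"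
    and H: "H \<in> borel_measurable (field_sigma M L {s})" "integrable M (\<lambda>x. (H x)\<^sup>2)"
    and H_cond: "AE x in M. real_cond_exp M (field_sigma M L {s}) Y x = H x"
    and conv: "(\<lambda>n. expectation (\<lambda>x. (h n x - H x)\<^sup>2)) \<longlonglongrightarrow> 0"
    and orth: "\<And>w. w \<in> ?W \<Longrightarrow> (\<lambda>n. expectation (\<lambda>x. (Y x - h n x) * w x)) \<longlonglongrightarrow> 0"
    using conditional_expectation_approximation[OF W_sub Y] unfolding field_sigma_eq_generated_sigma by blast
  have hV: "h n \<in> ?V" for n using h W_sub by blast
  have sub_present: "subalgebra M (field_sigma M L {s})" and sub_past: "subalgebra M (field_sigma M L {0..s})"
    unfolding field_sigma_eq_generated_sigma using st
    by (auto intro!: subalgebra_generated_sigma measurable_mem L_mem)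
  have HM[measurable]: "H \<in> borel_measurable M" using measurable_from_subalg[OF sub_present H(1)] .
  have [measurable]: "Y \<in> borel_measurable M" "U \<in> borel_measurable M" "h n \<in> borel_measurable M" for n
    using Y U hV by simp_all
  have dsq: "integrable M (\<lambda>x. (h n x - H x)\<^sup>2)" for n
    unfolding power2_diff using integrable_square[OF hV] H(2)
      integrable_mult_squares[OF measurable_mem[OF hV] HM integrable_square[OF hV] H(2)]
    by (auto simp: mult.assoc)
  define c where "c n y = expectation (\<lambda>x. h n x * L (T y) s x)" for n y
  define c' where "c' y = expectation (\<lambda>x. Y x * L (T y) s x)" for y
  define G where "G = expectation (\<lambda>x. (L g s x)\<^sup>2)"
  \<comment> \<open>Translation invariance at lag \<open>0\<close>.\<close>
  have G: "expectation (\<lambda>x. (L (T y) s x)\<^sup>2) = G" for y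
  proof -
    have "complex_of_real (expectation (\<lambda>x. (L (T y) s x)\<^sup>2)) = Gamma_cov v (T y) (T y) 0"
      using covariance[OF T T s0 s0, of y y] by (simp add: power2_eq_square)
    also have "\<dots> = Gamma_cov v g g 0" unfolding T_def by (rule Gamma_cov_0_shift[OF g g])
    also have "\<dots> = complex_of_real G"
      using covariance[OF g g s0 s0] by (simp add: G_def power2_eq_square)
    finally show ?thesis by simp
  qed
  have c_bound: "\<bar>expectation (\<lambda>x. Z x * L (T y) s x)\<bar> \<le> sqrt (expectation (\<lambda>x. (Z x)\<^sup>2) * G)"
    if Z: "Z \<in> ?V" for Z y
    using Cauchy_Schwarz_integral[OF measurable_mem[OF Z] measurable_mem[OF TV] integrable_square[OF Z] integrable_square[OF TV], of y]
    unfolding G by (intro real_le_rsqrt) simp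
  have present: "c n \<in> borel_measurable borel \<and> expectation (\<lambda>x. h n x * U x) = (\<integral>y. q_kernel b y * c n y \<partial>lborel)" for n
  proof -
    obtain J \<alpha> where J: "finite J" "J \<subseteq> Cc_infty \<times> {s}" and hn: "h n = (\<lambda>x. \<Sum>j\<in>J. \<alpha> j * ?X j x)"
      using h[of n] unfolding lin_combs_def by blast
    have expand: "complex_of_real (expectation (\<lambda>x. h n x * L k r x)) = (\<Sum>j\<in>J. of_real (\<alpha> j) * Gamma_cov v (fst j) k (s - r))"
      if k: "k \<in> Cc_infty" and r: "0 \<le> r" "r \<le> s" for k r
    proof -
      have j: "fst j \<in> Cc_infty" "?X j = L (fst j) s" if "j \<in> J" for j
        using that J(2) by (auto simp: case_prod_beta)
      have "expectation (\<lambda>x. h n x * L k r x) = expectation (\<lambda>x. \<Sum>j\<in>J. \<alpha> j * (?X j x * L k r x))"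
        unfolding hn by (simp add: sum_distrib_right mult.assoc)
      also have "\<dots> = (\<Sum>j\<in>J. \<alpha> j * expectation (\<lambda>x. ?X j x * L k r x))"
        using j by (subst Bochner_Integration.integral_sum)
          (auto intro!: integrable_mult_right integrable_mult_mem L_mem k r s0)
      also have "\<dots> = (\<Sum>j\<in>J. \<alpha> j * expectation (\<lambda>x. L (fst j) s x * L k r x))"
        using j by (intro sum.cong) auto
      finally show ?thesis
        using covariance[OF j(1) k r(1) s0] r by (simp cong: sum.cong)
    qed
    have c_eq: "complex_of_real (c n y) = (\<Sum>j\<in>J. of_real (\<alpha> j) * Gamma_cov v (fst j) (T y) 0)" for y
      unfolding c_def using expand[OF T s0 order_refl] by simp
    have bu: "0 < b" "b = (s - u) * (1 - (cmod v)\<^sup>2)" using b(1) u(3) by (simp_all add: \<kappa>_def)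
    have meas: "(\<lambda>y. Gamma_cov v (fst j) (T y) 0) \<in> borel_measurable borel" if "j \<in> J" for j
      using Gamma_cov_average(2)[OF _ g bu, of "fst j"] that J(2) unfolding T_def by auto
    have "(\<lambda>y. complex_of_real (c n y)) \<in> borel_measurable borel"
      unfolding c_eq by (intro borel_measurable_sum borel_measurable_times borel_measurable_const meas)
    then have cm: "c n \<in> borel_measurable borel"
      by (subst (asm) borel_measurable_complex_iff) simp
    have int: "integrable lborel (\<lambda>y. of_real (\<alpha> j) * (of_real (q_kernel b y) * Gamma_cov v (fst j) (T y) 0))" if j: "j \<in> J" for j
    proof -
      have fj: "fst j \<in> Cc_infty" using j J(2) by auto
      have eq: "Gamma_cov v (fst j) (T y) 0 = of_real (expectation (\<lambda>x. L (fst j) s x * L (T y) s x))" for y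
        using covariance[OF fj T s0 s0] by simp
      have "integrable lborel (\<lambda>y. q_kernel b y *\<^sub>R Gamma_cov v (fst j) (T y) 0)"
        using c_bound[OF L_mem[OF fj s0]] by (intro integrable_q_kernel_mult b meas j) (simp add: eq)
      then show ?thesis by (intro integrable_mult_right) (simp add: scaleR_conv_of_real)
    qed
    have "complex_of_real (expectation (\<lambda>x. h n x * U x)) = (\<Sum>j\<in>J. of_real (\<alpha> j) * Gamma_cov v (fst j) g (s - u))"
      unfolding U_def using u by (intro expand g) auto
    also have "\<dots> = (\<Sum>j\<in>J. of_real (\<alpha> j) * (\<integral>y. of_real (q_kernel b y) * Gamma_cov v (fst j) (T y) 0 \<partial>lborel))"
      using J(2) Gamma_cov_average(1)[OF _ g bu] unfolding T_def by (intro sum.cong) auto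
    also have "\<dots> = (\<integral>y. (\<Sum>j\<in>J. of_real (\<alpha> j) * (of_real (q_kernel b y) * Gamma_cov v (fst j) (T y) 0)) \<partial>lborel)"
      using int by (subst Bochner_Integration.integral_sum) auto
    also have "\<dots> = (\<integral>y. complex_of_real (q_kernel b y * c n y) \<partial>lborel)"
      by (simp add: c_eq sum_distrib_left mult_ac)
    finally show ?thesis
      using cm by (simp only: integral_complex_of_real of_real_eq_iff)
  qed
  have c_lim: "(\<lambda>n. c n y) \<longlonglongrightarrow> c' y" for y
  proof -
    have "(\<lambda>n. c' y - expectation (\<lambda>x. (Y x - h n x) * L (T y) s x)) \<longlonglongrightarrow> c' y - 0"
      by (intro tendsto_diff tendsto_const orth L_W T)
    moreover have "c' y - expectation (\<lambda>x. (Y x - h n x) * L (T y) s x) = c n y" for n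
      using integrable_mult_mem[OF Y TV] integrable_mult_mem[OF hV TV]
      by (simp add: c_def c'_def left_diff_distrib)
    ultimately show ?thesis by simp
  qed
  \<comment> \<open>In general \<open>U\<close> is outside the closed span of the present, so that convergence of \<open>h\<close> in \<open>L\<^sup>2\<close> is needed.\<close>
  have U_lim: "(\<lambda>n. expectation (\<lambda>x. h n x * U x)) \<longlonglongrightarrow> expectation (\<lambda>x. H x * U x)"
  proof (rule LIM_zero_cancel, rule Lim_null_comparison)
    show "(\<lambda>n. sqrt (expectation (\<lambda>x. (h n x - H x)\<^sup>2) * expectation (\<lambda>x. (U x)\<^sup>2))) \<longlonglongrightarrow> 0"
      using tendsto_real_sqrt[OF tendsto_mult[OF conv tendsto_const]] by simp
    have "norm (expectation (\<lambda>x. h n x * U x) - expectation (\<lambda>x. H x * U x))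
      \<le> sqrt (expectation (\<lambda>x. (h n x - H x)\<^sup>2) * expectation (\<lambda>x. (U x)\<^sup>2))" for n
    proof -
      have "expectation (\<lambda>x. h n x * U x) - expectation (\<lambda>x. H x * U x) = expectation (\<lambda>x. (h n x - H x) * U x)"
        using integrable_mult_mem[OF hV U] integrable_mult_squares[OF HM measurable_mem[OF U] H(2) integrable_square[OF U]]
        by (simp add: left_diff_distrib)
      then show ?thesis
        using Cauchy_Schwarz_integral[OF _ measurable_mem[OF U] dsq[of n] integrable_square[OF U]]
        by (simp add: real_le_rsqrt)
    qed
    then show "\<forall>\<^sub>F n in sequentially. norm (expectation (\<lambda>x. h n x * U x) - expectation (\<lambda>x. H x * U x))
      \<le> sqrt (expectation (\<lambda>x. (h n x - H x)\<^sup>2) * expectation (\<lambda>x. (U x)\<^sup>2))" by simp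
  qed
  have "\<exists>B. \<forall>n. expectation (\<lambda>x. (h n x)\<^sup>2) \<le> B"
  proof -
    obtain B where B: "\<And>n. expectation (\<lambda>x. (h n x - H x)\<^sup>2) \<le> B"
      using convergent_imp_Bseq[OF convergentI[OF conv]] by (auto simp: Bseq_def)
    have "expectation (\<lambda>x. (h n x)\<^sup>2) \<le> 2 * B + 2 * expectation (\<lambda>x. (H x)\<^sup>2)" for n
    proof -
      have "expectation (\<lambda>x. (h n x)\<^sup>2) \<le> expectation (\<lambda>x. 2 * (h n x - H x)\<^sup>2 + 2 * (H x)\<^sup>2)"
      proof (rule integral_mono[OF integrable_square[OF hV]])
        show "integrable M (\<lambda>x. 2 * (h n x - H x)\<^sup>2 + 2 * (H x)\<^sup>2)" using dsq H(2) by simp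
        fix x
        have "0 \<le> (h n x - 2 * H x)\<^sup>2" by simp
        then show "(h n x)\<^sup>2 \<le> 2 * (h n x - H x)\<^sup>2 + 2 * (H x)\<^sup>2"
          by (simp add: power2_eq_square algebra_simps)
      qed
      also have "\<dots> \<le> 2 * B + 2 * expectation (\<lambda>x. (H x)\<^sup>2)" using dsq[of n] H(2) B[of n] by simp
      finally show ?thesis .
    qed
    then show ?thesis by blast
  qed
  then obtain B where B: "\<And>n. expectation (\<lambda>x. (h n x)\<^sup>2) \<le> B" by blast
  have G0: "0 \<le> G" by (simp add: G_def)
  have avg_lim: "(\<lambda>n. \<integral>y. q_kernel b y * c n y \<partial>lborel) \<longlonglongrightarrow> (\<integral>y. q_kernel b y * c' y \<partial>lborel)"
  proof (rule integral_dominated_convergence[where w="\<lambda>y. q_kernel b y * sqrt (B * G)"])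
    have cm[measurable]: "c n \<in> borel_measurable borel" for n using present by blast
    have "c' \<in> borel_measurable borel" using c_lim by (rule borel_measurable_LIMSEQ_real[OF _ cm])
    then show "(\<lambda>y. q_kernel b y * c' y) \<in> borel_measurable lborel" by measurable
    show "(\<lambda>y. q_kernel b y * c n y) \<in> borel_measurable lborel" for n by measurable
    show "integrable lborel (\<lambda>y. q_kernel b y * sqrt (B * G))"
      using has_bochner_integral_q_kernel[OF b(1)] by (simp add: has_bochner_integral_iff)
    show "AE y in lborel. (\<lambda>n. q_kernel b y * c n y) \<longlonglongrightarrow> q_kernel b y * c' y"
      by (intro AE_I2 tendsto_mult tendsto_const c_lim)
    show "AE y in lborel. norm (q_kernel b y * c n y) \<le> q_kernel b y * sqrt (B * G)" for n
    proof (rule AE_I2)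
      fix y
      have "\<bar>c n y\<bar> \<le> sqrt (expectation (\<lambda>x. (h n x)\<^sup>2) * G)" unfolding c_def by (rule c_bound[OF hV])
      also have "\<dots> \<le> sqrt (B * G)" using B[of n] G0 by (intro real_sqrt_le_mono mult_right_mono)
      finally show "norm (q_kernel b y * c n y) \<le> q_kernel b y * sqrt (B * G)"
        using q_kernel_nonneg[of b y] b(1) by (simp add: abs_mult mult_left_mono)
    qed
  qed
  have HU: "expectation (\<lambda>x. H x * U x) = expectation (\<lambda>x. Y x * U x)"
  proof -
    interpret past: sigma_finite_subalgebra M "field_sigma M L {0..s}"
      by (rule sigma_finite_subalgebraI[OF sub_past])
    have Um: "U \<in> borel_measurable (field_sigma M L {0..s})"
      using measurable_generated_sigma[of "(g, u)" "Cc_infty \<times> {0..s}" ?X M] g u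
      unfolding field_sigma_eq_generated_sigma U_def by simp
    have "expectation (\<lambda>x. H x * U x) = expectation (\<lambda>x. U x * real_cond_exp M (field_sigma M L {0..s}) Y x)"
    proof (rule integral_cong_AE)
      show "AE x in M. H x * U x = U x * real_cond_exp M (field_sigma M L {0..s}) Y x"
        using H_cond markov unfolding Y_def by eventually_elim simp
    qed measurable
    also have "\<dots> = expectation (\<lambda>x. U x * Y x)"
      using integrable_mult_mem[OF U Y] Um by (rule past.real_cond_exp_intg(2)) simp
    finally show ?thesis by (simp add: mult.commute)
  qed
  have "expectation (\<lambda>x. Y x * U x) = (\<integral>y. q_kernel b y * c' y \<partial>lborel)"
    using U_lim avg_lim present LIMSEQ_unique unfolding HU by simp
  moreover have "expectation (\<lambda>x. Y x * U x) = log_energy (a + b) f g"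
  proof -
    have "complex_of_real (expectation (\<lambda>x. Y x * U x)) = Gamma_cov v f g (t - u)"
      unfolding Y_def U_def using covariance[OF f g u(1) t0] u st by simp
    also have "\<dots> = of_real (log_energy (a + b) f g)"
      unfolding log_energy_def
      by (rule Gamma_cov_eq_log_kernel[OF f g]) (use a b u in \<open>auto simp: a_def \<kappa>_def algebra_simps\<close>)
    finally show ?thesis by simp
  qed
  moreover have "c' y = log_energy a f (T y)" for y
  proof -
    have "complex_of_real (c' y) = Gamma_cov v f (T y) (t - s)"
      unfolding c'_def Y_def using covariance[OF f T s0 t0] st by simp
    also have "\<dots> = of_real (log_energy a f (T y))"
      unfolding log_energy_def
      by (rule Gamma_cov_eq_log_kernel[OF f T a]) (simp add: a_def \<kappa>_def)
    finally show ?thesis by simp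
  qed
  ultimately show ?thesis by (simp add: a_def \<kappa>_def T_def)
qed

theorem proposition2p10:
  fixes v :: complex
    and M :: "'w measure"
    and L :: "(complex \<Rightarrow> real) \<Rightarrow> real \<Rightarrow> 'w \<Rightarrow> real"
  assumes v: "cmod v < 1"
    and gaussian: "centered_gaussian_family M (Cc_infty \<times> {0..}) (\<lambda>(f, s). L f s)"
    and covariance: "\<And>f g s t. f \<in> Cc_infty \<Longrightarrow> g \<in> Cc_infty \<Longrightarrow> 0 \<le> s \<Longrightarrow> 0 \<le> t \<Longrightarrow>
      complex_of_real (\<integral>\<omega>. L f t \<omega> * L g s \<omega> \<partial>M) = Gamma_cov v f g \<bar>t - s\<bar>"
  shows "\<not> markovian_in_time M L \<and>
    (\<forall>s t. 0 < s \<and> s < t \<longrightarrow>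
      (\<exists>f\<in>Cc_infty.
        measure M {\<omega> \<in> space M.
          real_cond_exp M (field_sigma M L {0..s}) (L f t) \<omega> =
          real_cond_exp M (field_sigma M L {s}) (L f t) \<omega>} < 1))"
proof -
  interpret gaussian_space M "lin_combs (Cc_infty \<times> {0..}) (\<lambda>(f, s). L f s)"
    by (rule gaussian_space_lin_combs[OF assms(2)])
  have L_mem: "L f s \<in> lin_combs (Cc_infty \<times> {0..}) (\<lambda>(f, s). L f s)" if "f \<in> Cc_infty" "0 \<le> s" for f s
    using lin_combs_generator[of "(f, s)" "Cc_infty \<times> {0..}" "\<lambda>(f, s). L f s"] that by simp
  have sub: "subalgebra M (field_sigma M L T)" if "T \<subseteq> {0..}" for T
    unfolding field_sigma_eq_generated_sigma using that
    by (auto intro!: subalgebra_generated_sigma measurable_mem L_mem)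
  have not_AE: "\<exists>f\<in>Cc_infty. \<not> (AE \<omega> in M. real_cond_exp M (field_sigma M L {0..s}) (L f t) \<omega> =
      real_cond_exp M (field_sigma M L {s}) (L f t) \<omega>)" if st: "0 < s" "s < t" for s t
  proof -
    have \<kappa>: "0 < 1 - (cmod v)\<^sup>2" using v by (simp add: power_less_one_iff)
    define a where "a = (t - s) * (1 - (cmod v)\<^sup>2)"
    have a: "0 < a" using st \<kappa> by (simp add: a_def)
    obtain f b0 where f: "f \<in> Cc_infty" and b0: "0 < b0" and less: "\<And>b. 0 < b \<Longrightarrow> b < b0 \<Longrightarrow>
        (\<integral>y. q_kernel b y * log_energy a f (\<lambda>x. f (x - y)) \<partial>lborel) < log_energy (a + b) f f"
      using log_energy_not_semigroup[OF a] by blast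
    \<comment> \<open>Small enough for the strict inequality, and not reaching back beyond time \<open>0\<close>.\<close>
    define b where "b = min (b0 / 2) (s * (1 - (cmod v)\<^sup>2))"
    have b: "0 < b" "b < b0" "b \<le> s * (1 - (cmod v)\<^sup>2)"
      using b0 st \<kappa> by (auto simp: b_def min_less_iff_disj)
    show ?thesis
    proof (rule bexI[OF _ f], rule notI)
      assume AE: "AE \<omega> in M. real_cond_exp M (field_sigma M L {0..s}) (L f t) \<omega> =
        real_cond_exp M (field_sigma M L {s}) (L f t) \<omega>"
      have "log_energy (a + b) f f = (\<integral>y. q_kernel b y * log_energy a f (\<lambda>x. f (x - y)) \<partial>lborel)"
        unfolding a_def by (rule markov_step_forces_semigroup[OF v assms(2) covariance st f f AE b(1,3)])
      with less[OF b(1,2)] show False by simp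
    qed
  qed
  have less_1: "measure M {\<omega> \<in> space M. real_cond_exp M (field_sigma M L {0..s}) (L f t) \<omega> =
      real_cond_exp M (field_sigma M L {s}) (L f t) \<omega>} < 1"
    if "\<not> (AE \<omega> in M. real_cond_exp M (field_sigma M L {0..s}) (L f t) \<omega> =
      real_cond_exp M (field_sigma M L {s}) (L f t) \<omega>)" for f s t
    using that prob_Collect_eq_1[of "\<lambda>\<omega>. real_cond_exp M (field_sigma M L {0..s}) (L f t) \<omega> =
      real_cond_exp M (field_sigma M L {s}) (L f t) \<omega>"] by (simp add: less_le)
  have part2: "\<forall>s t. 0 < s \<and> s < t \<longrightarrow> (\<exists>f\<in>Cc_infty.
        measure M {\<omega> \<in> space M. real_cond_exp M (field_sigma M L {0..s}) (L f t) \<omega> =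
          real_cond_exp M (field_sigma M L {s}) (L f t) \<omega>} < 1)"
  proof (intro allI impI)
    fix s t :: real
    assume "0 < s \<and> s < t"
    then obtain f where f: "f \<in> Cc_infty" and
      "\<not> (AE \<omega> in M. real_cond_exp M (field_sigma M L {0..s}) (L f t) \<omega> =
        real_cond_exp M (field_sigma M L {s}) (L f t) \<omega>)"
      using not_AE[of s t] by auto
    from less_1[OF this(2)] f show "\<exists>f\<in>Cc_infty.
        measure M {\<omega> \<in> space M. real_cond_exp M (field_sigma M L {0..s}) (L f t) \<omega> =
          real_cond_exp M (field_sigma M L {s}) (L f t) \<omega>} < 1"
      by (intro bexI[of _ f])
  qed
  have "\<not> markovian_in_time M L"
  proof
    assume markov: "markovian_in_time M L"
    obtain f where f: "f \<in> Cc_infty" and bad: "\<not> (AE \<omega> in M. real_cond_exp M (field_sigma M L {0..1}) (L f 2) \<omega> =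
      real_cond_exp M (field_sigma M L {1}) (L f 2) \<omega>)"
      using not_AE[of 1 2] by auto
    have "AE \<omega> in M. real_cond_exp M (field_sigma M L {0..1}) (L f 2) \<omega> = real_cond_exp M (field_sigma M L {1}) (L f 2) \<omega>"
    proof (rule conditional_expectation_eq_of_truncations)
      show "subalgebra M (field_sigma M L {0..1})" by (rule sub) auto
      show "subalgebra (field_sigma M L {0..1}) (field_sigma M L {1})"
        unfolding field_sigma_eq_generated_sigma by (rule subalgebra_generated_sigma_mono) auto
      show "integrable M (L f 2)" by (intro integrable_mem L_mem f) simp
      fix n :: nat
      have Lm: "L f 2 \<in> borel_measurable (field_sigma M L {2})"
        using measurable_generated_sigma[of "(f, 2)" "Cc_infty \<times> {2}" "\<lambda>(f, s). L f s" M] f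
        unfolding field_sigma_eq_generated_sigma by simp
      show "AE \<omega> in M. real_cond_exp M (field_sigma M L {0..1}) (\<lambda>\<omega>. max (- real n) (min (real n) (L f 2 \<omega>))) \<omega>
        = real_cond_exp M (field_sigma M L {1}) (\<lambda>\<omega>. max (- real n) (min (real n) (L f 2 \<omega>))) \<omega>"
      proof (rule markov[unfolded markovian_in_time_def, rule_format, of 1 2], intro conjI)
        show "(\<lambda>\<omega>. max (- real n) (min (real n) (L f 2 \<omega>))) \<in> borel_measurable (field_sigma M L {2})"
          using Lm by measurable
        show "\<exists>B. \<forall>\<omega>\<in>space M. \<bar>max (- real n) (min (real n) (L f 2 \<omega>))\<bar> \<le> B"
          by (rule exI[of _ "real n"]) auto
      qed auto
    qed
    with bad show False ..
  qed
  then show ?thesis using part2 by (rule conjI)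
qed

end
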